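(* Let $p$ be any odd prime. Then $$\sum_{k=0}^{p-1}(-1)^kA_k(-2)\equiv\sum_{k=0}^{p-1}(-1)^kA_k\left(\frac14\right)\pmod{p^2},$$ and both sums are congruent modulo $p^2$ to $4x^2-2p$ if $p\equiv1\pmod4$ and $p=x^2+y^2$ with $x,y$ integers and $x$ odd, and to $0$ if $p\equiv3\pmod4$.
   Context: For $n\in\{0,1,2,\ldots\}$, $A_n(x)=\sum_{k=0}^n\binom nk^2\binom{n+k}k^2x^k$. For rational numbers $a,b$ and $m\ge1$, $a\equiv b\pmod{p^m}$ means that $(a-b)/p^m$ has denominator prime to $p$. *)

theory Defs
  imports Complex_Main "HOL-Computational_Algebra.Primes"
begin

definition apery_poly :: "nat \<Rightarrow> rat \<Rightarrow> rat" where
  "apery_poly n x = (\<Sum>k=0..n. of_nat (n choose k) ^ 2 * of_nat ((n + k) choose k) ^ 2 * x ^ k)"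

(* quotient_of returns the fraction in lowest terms, so its second component is the denominator. *)
definition rat_cong :: "nat \<Rightarrow> nat \<Rightarrow> rat \<Rightarrow> rat \<Rightarrow> bool" where
  "rat_cong p m a b \<longleftrightarrow> coprime (snd (quotient_of ((a - b) / of_nat (p ^ m)))) (int p)"

end

theory Submission
  imports Defs "HOL-Number_Theory.Number_Theory" "HOL-Computational_Algebra.Polynomial"
    "HOL-Computational_Algebra.Formal_Power_Series"
begin

text \<open>
  Write \<open>p = 2n + 1\<close>, and let all congruences be modulo \<open>p\<^sup>2\<close>.

  After an interchange of summation the alternating sum of the \<open>A\<^sub>k(x)\<close> is
  \<open>\<Sum>\<^sub>j C(2j,j)\<^sup>2 x\<^sup>j S\<^sub>j\<close> with \<open>S\<^sub>j = \<Sum>\<^bsub>k<p\<^esub> (-1)\<^sup>k C(k+j,2j)\<^sup>2\<close>.  A telescoping certificate gives a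
  first-order recurrence in \<open>j\<close> for \<open>S\<^sub>j\<close> whose inhomogeneous term is divisible by \<open>p\<^sup>2\<close>, so that
  \<open>S\<^sub>j \<equiv> C(2j,j)/16\<^sup>j\<close> for \<open>j \<le> n\<close>, while for \<open>n < j < p\<close> the factor \<open>C(2j,j)\<^sup>2\<close> vanishes.  Since
  \<open>C(2j,j)\<^sup>2/16\<^sup>j \<equiv> (-1)\<^sup>j C(n,j) C(n+j,j)\<close>, the sum is congruent to
  \<open>\<Sum>\<^sub>j C(n,j) C(n+j,j) C(2j,j) (-x)\<^sup>j\<close>.  By an identity of Clausen type (lemma \<open>clausen_legendre\<close>) this
  equals \<open>L(z)\<^sup>2\<close>, where \<open>z(1+z) = -x\<close> and \<open>L(z) = \<Sum>\<^sub>k C(n,k) C(n+k,k) z\<^sup>k\<close> is the Legendre polynomial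
  \<open>P\<^sub>n(1+2z)\<close>.  The two arguments \<open>x = -2\<close> and \<open>x = 1/4\<close> correspond to \<open>z = 1\<close> and \<open>z = -1/2\<close>.

  \<open>L(-1/2) = P\<^sub>n(0)\<close> is \<open>0\<close> for odd \<open>n\<close> and \<open>\<plusminus>C(2m,m)/4\<^sup>m\<close> for \<open>n = 2m\<close>.  The
  number \<open>L(1)\<close> is the hypergeometric value \<open>F(-n, n+1; c; -1)\<close> at \<open>c = 1\<close> and has no closed form, but at
  \<open>c = 1 + p\<close> and \<open>c = 1 - p\<close> Kummer's summation theorem applies.  These two values differ from \<open>L(1)\<close> by
  opposite terms of order \<open>p\<close>, hence their product is congruent to \<open>L(1)\<^sup>2\<close>.  For odd \<open>n\<close> this product is
  \<open>0\<close>.  For \<open>n = 2m\<close> both squares are congruent to \<open>W = C(2m,m)\<^sup>2 (1 - p (1/(m+1) + \<dots> + 1/(2m)))\<close>.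

  It remains to show \<open>4x\<^sup>2 - 2p \<equiv> W\<close> when \<open>p = 4m + 1 = x\<^sup>2 + y\<^sup>2\<close> with \<open>x\<close> odd.  Let
  \<open>J(a)\<close> be the sum of the Legendre symbols of \<open>t(1 - a t\<^sup>2)\<close>.  Jacobsthal's theorem says that
  \<open>J(1)\<^sup>2 + J(g)\<^sup>2 = 4p\<close> for a nonresidue \<open>g\<close>, and a parity argument gives \<open>J(1)\<^sup>2 = 4x\<^sup>2\<close>.  Modulo \<open>p\<^sup>2\<close> the
  Legendre symbol of \<open>u\<close> is \<open>u\<^bsup>pn\<^esup>\<close>, and \<open>t\<close> may be replaced by the Teichmueller representative \<open>t\<^sup>p\<close>, whose
  power sums are trivial.  This yields \<open>J(1) \<equiv> \<plusminus>(p-1)(E + F)\<close> and \<open>J(g)\<^sup>2 \<equiv> -(p-1)\<^sup>2 (E - F)\<^sup>2\<close>, where \<open>E\<close> and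
  \<open>F\<close> are sums of binomial coefficients \<open>C(2pm, m l)\<close> over \<open>l \<equiv> 1\<close> and \<open>l \<equiv> 3\<close> modulo 4, and \<open>p\<close> divides
  \<open>F\<close>.  Adding the squares gives \<open>(p-1)\<^sup>2 E F \<equiv> p\<close>, whence \<open>4x\<^sup>2 - 2p \<equiv> (p-1)\<^sup>2 E\<^sup>2\<close>.  Finally the terms of
  \<open>E\<close> are computed modulo \<open>p\<^sup>2\<close>; only \<open>C(2pm, pm) \<equiv> C(2m,m)\<close> is a unit, and the others add up, by an
  alternating binomial identity, to the correction that turns \<open>C(2m,m)\<^sup>2\<close> into \<open>W\<close>.
\<close>

section \<open>Rationals that are integral at a prime\<close>

locale prime_modulus =
  fixes p :: nat
  assumes prime_p: "prime p"
begin

text \<open>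
  The local ring at \<open>p\<close>, that is \<open>\<rat> \<inter> \<int>\<^sub>p\<close>.  The fraction need not be in lowest terms, which makes the
  closure properties immediate.
\<close>

definition p_integral :: "rat \<Rightarrow> bool" where
  "p_integral r \<longleftrightarrow> (\<exists>a b. \<not> int p dvd b \<and> r = of_int a / of_int b)"

definition p_unit :: "rat \<Rightarrow> bool" where
  "p_unit r \<longleftrightarrow> r \<noteq> 0 \<and> p_integral r \<and> p_integral (1 / r)"

lemma p_pos: "p > 0" and p_gt_1: "p > 1"
  using prime_p prime_gt_0_nat prime_gt_1_nat by auto

lemma prime_int_p: "prime (int p)"
  using prime_p by simp

lemma p_integralI: "\<not> int p dvd b \<Longrightarrow> p_integral (of_int a / of_int b)"
  unfolding p_integral_def by blast

lemma p_integral_iff_coprime: "p_integral r \<longleftrightarrow> coprime (snd (quotient_of r)) (int p)"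
proof
  assume "p_integral r"
  then obtain a b where ab: "\<not> int p dvd b" "r = of_int a / of_int b"
    unfolding p_integral_def by blast
  obtain c d where cd: "quotient_of r = (c, d)" by force
  have d: "d > 0" "coprime c d" "r = of_int c / of_int d"
    using quotient_of_denom_pos[OF cd] quotient_of_coprime[OF cd] quotient_of_div[OF cd] by auto
  have b0: "b \<noteq> 0" using ab(1) by auto
  have "rat_of_int (a * d) = of_int (c * b)"
    using ab(2) d(1,3) b0 by (simp add: field_simps)
  hence "a * d = c * b" by (simp only: of_int_eq_iff)
  hence "d dvd c * b" by (metis dvd_triv_right)
  hence "d dvd b" using d(2) by (simp add: coprime_dvd_mult_right_iff coprime_commute)
  hence "\<not> int p dvd d" using ab(1) dvd_trans by blast
  thus "coprime (snd (quotient_of r)) (int p)"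
    using prime_int_p cd by (metis coprime_commute prime_imp_coprime snd_conv)
next
  assume *: "coprime (snd (quotient_of r)) (int p)"
  obtain c d where cd: "quotient_of r = (c, d)" by force
  have "\<not> int p dvd d"
    using * cd prime_int_p by (metis coprime_absorb_right not_prime_unit snd_conv)
  thus "p_integral r" using quotient_of_div[OF cd] p_integralI by auto
qed

lemma rat_cong_iff: "rat_cong p m a b \<longleftrightarrow> p_integral ((a - b) / of_nat (p ^ m))"
  unfolding rat_cong_def p_integral_iff_coprime ..

lemma p_integral_of_int [simp, intro]: "p_integral (of_int a)"
  using p_integralI[of 1 a] prime_int_p not_prime_unit by fastforce

lemma p_integral_of_nat [simp, intro]: "p_integral (of_nat a)"
  using p_integral_of_int[of "int a"] by simp

lemma p_integral_numeral [simp, intro]: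
  "p_integral 0" "p_integral 1" "p_integral (numeral k)"
  using p_integral_of_int[of 0] p_integral_of_int[of 1] p_integral_of_int[of "numeral k"] by auto

lemma p_integral_add [intro]:
  assumes "p_integral x" "p_integral y" shows "p_integral (x + y)"
proof -
  obtain a b c d where h: "\<not> int p dvd b" "x = of_int a / of_int b" "\<not> int p dvd d" "y = of_int c / of_int d"
    using assms unfolding p_integral_def by blast
  have "b \<noteq> 0" "d \<noteq> 0" using h by auto
  hence "x + y = of_int (a * d + c * b) / of_int (b * d)" using h by (simp add: field_simps)
  moreover have "\<not> int p dvd b * d" using h prime_int_p by (simp add: prime_dvd_mult_iff)
  ultimately show ?thesis using p_integralI by metis
qed

lemma p_integral_mult [intro]:
  assumes "p_integral x" "p_integral y" shows "p_integral (x * y)"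
proof -
  obtain a b c d where h: "\<not> int p dvd b" "x = of_int a / of_int b" "\<not> int p dvd d" "y = of_int c / of_int d"
    using assms unfolding p_integral_def by blast
  have "x * y = of_int (a * c) / of_int (b * d)" using h by simp
  moreover have "\<not> int p dvd b * d" using h prime_int_p by (simp add: prime_dvd_mult_iff)
  ultimately show ?thesis using p_integralI by metis
qed

lemma p_integral_uminus [intro]: "p_integral x \<Longrightarrow> p_integral (- x)"
  using p_integral_mult[OF p_integral_of_int[of "-1"], of x] by simp

lemma p_integral_diff [intro]: "p_integral x \<Longrightarrow> p_integral y \<Longrightarrow> p_integral (x - y)"
  using p_integral_add[OF _ p_integral_uminus, of x y] by simp

lemma p_integral_power [intro]: "p_integral x \<Longrightarrow> p_integral (x ^ k)"
  by (induction k) (auto)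

lemma p_integral_sum [intro]: "(\<And>i. i \<in> A \<Longrightarrow> p_integral (f i)) \<Longrightarrow> p_integral (sum f A)"
  by (induction A rule: infinite_finite_induct) auto

lemma p_integral_prod [intro]: "(\<And>i. i \<in> A \<Longrightarrow> p_integral (f i)) \<Longrightarrow> p_integral (prod f A)"
  by (induction A rule: infinite_finite_induct) auto

lemma p_unit_imp_integral: "p_unit r \<Longrightarrow> p_integral r"
  by (simp add: p_unit_def)

lemma p_unit_nonzero: "p_unit r \<Longrightarrow> r \<noteq> 0"
  by (simp add: p_unit_def)

lemma p_unit_of_int: "\<not> int p dvd a \<Longrightarrow> p_unit (of_int a)"
  using p_integralI[of a 1] by (auto simp: p_unit_def)

lemma p_unit_of_nat: "\<not> p dvd a \<Longrightarrow> p_unit (of_nat a)"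
  using p_unit_of_int[of "int a"] by simp

lemma p_unit_of_nat_less: "0 < a \<Longrightarrow> a < p \<Longrightarrow> p_unit (of_nat a)"
  by (intro p_unit_of_nat) (auto dest: dvd_imp_le)

lemma p_unit_1 [simp]: "p_unit 1"
  by (simp add: p_unit_def)

lemma p_unit_mult [intro]: "p_unit x \<Longrightarrow> p_unit y \<Longrightarrow> p_unit (x * y)"
  using p_integral_mult[of "1 / x" "1 / y"] by (auto simp: p_unit_def)

lemma p_unit_power [intro]: "p_unit x \<Longrightarrow> p_unit (x ^ k)"
  by (induction k) auto

lemma p_unit_prod [intro]: "(\<And>i. i \<in> A \<Longrightarrow> p_unit (f i)) \<Longrightarrow> p_unit (prod f A)"
  by (induction A rule: infinite_finite_induct) auto

lemma p_unit_inverse: "p_unit x \<Longrightarrow> p_unit (1 / x)"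
  by (auto simp: p_unit_def)

lemma p_integral_divide [intro]: "p_integral x \<Longrightarrow> p_unit y \<Longrightarrow> p_integral (x / y)"
  using p_integral_mult[of x "1 / y"] by (auto simp: p_unit_def)

lemma p_unit_fact: "k < p \<Longrightarrow> p_unit (fact k)"
  using p_unit_of_nat[of "fact k"] prime_p by (simp add: prime_dvd_fact_iff)

lemma rat_cong_refl [simp, intro]: "rat_cong p m a a"
  by (simp add: rat_cong_iff)

lemma rat_cong_sym: "rat_cong p m a b \<Longrightarrow> rat_cong p m b a"
  unfolding rat_cong_iff using p_integral_uminus[of "(a - b) / of_nat (p ^ m)"]
  by (simp add: minus_divide_left)

lemma rat_cong_add [intro]:
  "rat_cong p m a b \<Longrightarrow> rat_cong p m c d \<Longrightarrow> rat_cong p m (a + c) (b + d)"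
  unfolding rat_cong_iff using p_integral_add[of "(a - b) / of_nat (p ^ m)" "(c - d) / of_nat (p ^ m)"]
  by (simp add: add_divide_distrib diff_divide_distrib algebra_simps)

lemma rat_cong_uminus: "rat_cong p m a b \<Longrightarrow> rat_cong p m (- a) (- b)"
  unfolding rat_cong_iff using p_integral_uminus[of "(a - b) / of_nat (p ^ m)"]
  by (simp add: minus_divide_left)

lemma rat_cong_diff [intro]:
  "rat_cong p m a b \<Longrightarrow> rat_cong p m c d \<Longrightarrow> rat_cong p m (a - c) (b - d)"
  using rat_cong_add[OF _ rat_cong_uminus, of m a b c d] by simp

lemma rat_cong_trans [trans]:
  "rat_cong p m a b \<Longrightarrow> rat_cong p m b c \<Longrightarrow> rat_cong p m a c"
  unfolding rat_cong_iff using p_integral_add[of "(a - b) / of_nat (p ^ m)" "(b - c) / of_nat (p ^ m)"]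
  by (simp add: add_divide_distrib diff_divide_distrib)

lemma rat_cong_scale:
  "p_integral c \<Longrightarrow> rat_cong p m a b \<Longrightarrow> rat_cong p m (c * a) (c * b)"
  unfolding rat_cong_iff using p_integral_mult[of c "(a - b) / of_nat (p ^ m)"]
  by (simp add: right_diff_distrib)

lemma rat_cong_scale_right:
  "p_integral c \<Longrightarrow> rat_cong p m a b \<Longrightarrow> rat_cong p m (a * c) (b * c)"
  using rat_cong_scale[of c m a b] by (simp add: mult.commute)

lemma rat_cong_divide:
  "p_unit u \<Longrightarrow> rat_cong p m a b \<Longrightarrow> rat_cong p m (a / u) (b / u)"
  using rat_cong_scale[of "1 / u" m a b] p_unit_inverse[of u] p_unit_imp_integral by simp

lemma rat_cong_cancel:
  "p_unit u \<Longrightarrow> rat_cong p m (u * a) (u * b) \<Longrightarrow> rat_cong p m a b"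
  using rat_cong_divide[of u m "u * a" "u * b"] p_unit_nonzero[of u] by simp

text \<open>
  Congruent factors may be multiplied only between integral elements; integrality of one element on
  each side suffices, because it passes to the other one by \<open>rat_cong_integral\<close>.
\<close>

lemma rat_cong_mult:
  assumes "rat_cong p m a b" "rat_cong p m c d" "p_integral a" "p_integral d"
  shows "rat_cong p m (a * c) (b * d)"
  using rat_cong_trans[OF rat_cong_scale[OF assms(3,2)], of "b * d"]
    rat_cong_scale[OF assms(4,1)] by (simp add: mult.commute)

lemma rat_cong_integral:
  assumes "rat_cong p m a b" "p_integral a" shows "p_integral b"
proof -
  have "p_integral (of_nat (p ^ m) * ((a - b) / of_nat (p ^ m)))"
    using assms(1) unfolding rat_cong_iff by blast
  hence "p_integral (a - b)" using p_pos by simp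
  from p_integral_diff[OF assms(2) this] show ?thesis by simp
qed

lemma rat_cong_power:
  assumes "rat_cong p m a b" "p_integral a"
  shows "rat_cong p m (a ^ k) (b ^ k)"
proof (induction k)
  case (Suc k)
  have "p_integral b" using rat_cong_integral assms by blast
  thus ?case using rat_cong_mult[OF assms(1) Suc.IH] assms(2) by auto
qed simp

lemma rat_cong_sum:
  "(\<And>i. i \<in> A \<Longrightarrow> rat_cong p m (f i) (g i)) \<Longrightarrow> rat_cong p m (sum f A) (sum g A)"
  by (induction A rule: infinite_finite_induct) auto

lemma rat_cong_0I:
  assumes "p_integral c" shows "rat_cong p m (of_nat p ^ m * c) 0"
  unfolding rat_cong_iff using assms p_pos by simp

lemma rat_cong_D:
  assumes "rat_cong p m a b" obtains c where "p_integral c" "a = b + of_nat p ^ m * c"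
proof
  show "p_integral ((a - b) / of_nat p ^ m)" using assms by (simp add: rat_cong_iff)
qed (use p_pos in auto)

lemma rat_cong_of_int_iff:
  "rat_cong p m (of_int a) (of_int b) \<longleftrightarrow> [a = b] (mod int p ^ m)"
proof
  assume "rat_cong p m (of_int a) (of_int b)"
  then obtain r where r: "p_integral r" "rat_of_int a = of_int b + of_nat p ^ m * r"
    using rat_cong_D by blast
  obtain c d where cd: "\<not> int p dvd d" "r = of_int c / of_int d"
    using r(1) unfolding p_integral_def by blast
  have "d \<noteq> 0" using cd by auto
  hence "rat_of_int ((a - b) * d) = of_int (int p ^ m * c)"
    using r(2) cd(2) by (simp add: field_simps)
  hence "(a - b) * d = int p ^ m * c" by (simp only: of_int_eq_iff)
  hence "int p ^ m dvd (a - b) * d" by simp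
  moreover have "coprime (int p ^ m) d"
    using cd(1) prime_int_p by (simp add: prime_imp_coprime)
  ultimately have "int p ^ m dvd a - b" by (simp add: coprime_dvd_mult_left_iff)
  thus "[a = b] (mod int p ^ m)" by (simp add: cong_iff_dvd_diff)
next
  assume "[a = b] (mod int p ^ m)"
  then obtain k where "a - b = int p ^ m * k" by (auto simp: cong_iff_dvd_diff)
  hence "(rat_of_int a - of_int b) = of_nat p ^ m * of_int k"
    by (metis of_int_diff of_int_mult of_int_of_nat_eq of_int_power)
  thus "rat_cong p m (of_int a) (of_int b)" using p_pos by (simp add: rat_cong_iff)
qed

text \<open>
  First-order expansion: the ideal generated by \<open>p\<close> squares to zero modulo \<open>p\<^sup>2\<close>.  All harmonic numbers
  below arise in this way from products.
\<close>

lemma prod_one_plus_p: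
  assumes "\<And>i. i \<in> A \<Longrightarrow> p_integral (f i)"
  shows "rat_cong p 2 (\<Prod>i\<in>A. 1 + of_nat p * f i) (1 + of_nat p * (\<Sum>i\<in>A. f i))"
  using assms
proof (induction A rule: infinite_finite_induct)
  case (insert x A)
  let ?P = "of_nat p :: rat"
  have "rat_cong p 2 ((1 + ?P * f x) * (\<Prod>i\<in>A. 1 + ?P * f i)) ((1 + ?P * f x) * (1 + ?P * sum f A))"
    using insert by (intro rat_cong_scale) auto
  also have "(1 + ?P * f x) * (1 + ?P * sum f A) = 1 + ?P * (f x + sum f A) + ?P ^ 2 * (f x * sum f A)"
    by (simp add: algebra_simps power2_eq_square)
  also have "rat_cong p 2 \<dots> (1 + ?P * (f x + sum f A) + 0)"
    using insert by (intro rat_cong_add rat_cong_0I rat_cong_refl) auto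
  finally show ?case using insert by simp
qed simp_all

end

locale odd_prime_modulus = prime_modulus +
  fixes n :: nat
  assumes p_eq: "p = 2 * n + 1"
begin

lemma n_pos: "n > 0" using p_gt_1 p_eq by simp

lemma less_pI: "k \<le> 2 * n \<Longrightarrow> k < p" by (simp add: p_eq)

lemma odd_p: "odd p" by (simp add: p_eq)

lemma p_unit_2: "p_unit 2"
  using p_unit_of_nat_less[of 2] p_eq n_pos by simp

end

section \<open>The square of a Legendre polynomial\<close>

definition legendre_coeff :: "nat \<Rightarrow> nat \<Rightarrow> rat" where
  "legendre_coeff n k = of_nat (n choose k) * of_nat ((n + k) choose k)"

text \<open>
  The Legendre polynomial \<open>P\<^sub>n\<close> in the variable \<open>z = (t - 1)/2\<close>.
\<close>

definition legendre_sum :: "nat \<Rightarrow> rat \<Rightarrow> rat" where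
  "legendre_sum n z = (\<Sum>k\<le>n. legendre_coeff n k * z ^ k)"

lemma legendre_coeff_Suc:
  "of_nat (Suc k) ^ 2 * legendre_coeff n (Suc k)
     = (of_nat n * of_nat (Suc n) - of_nat k * of_nat (Suc k)) * legendre_coeff n k"
proof (cases "k \<le> n")
  case True
  have "(Suc k) * (n choose Suc k) = (n - k) * (n choose k)"
    by (metis binomial_absorb_comp binomial_absorption mult.commute)
  hence a: "of_nat (Suc k) * (of_nat (n choose Suc k) :: rat) = (of_nat n - of_nat k) * of_nat (n choose k)"
    using True by (metis of_nat_diff of_nat_mult)
  have "Suc k * ((n + Suc k) choose Suc k) = Suc (n + k) * ((n + k) choose k)"
    by (metis Suc_times_binomial add_Suc_right)
  hence b: "of_nat (Suc k) * (of_nat ((n + Suc k) choose Suc k) :: rat)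
             = (of_nat n + of_nat k + 1) * of_nat ((n + k) choose k)"
    by (metis (no_types, lifting) of_nat_Suc of_nat_add of_nat_mult add.commute add.left_commute)
  have "of_nat (Suc k) ^ 2 * legendre_coeff n (Suc k)
      = (of_nat (Suc k) * of_nat (n choose Suc k)) * (of_nat (Suc k) * of_nat ((n + Suc k) choose Suc k))"
    unfolding legendre_coeff_def by (simp add: power2_eq_square algebra_simps)
  also have "\<dots> = (of_nat n - of_nat k) * (of_nat n + of_nat k + 1) * legendre_coeff n k"
    unfolding a b legendre_coeff_def by (simp add: algebra_simps)
  finally show ?thesis by (simp add: algebra_simps)
qed (simp add: legendre_coeff_def binomial_eq_0)

lemma central_binomial_Suc:
  "of_nat (Suc j) * of_nat ((2 * Suc j) choose Suc j) = (2 * of_nat (2 * j + 1) * of_nat ((2 * j) choose j) :: rat)"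
proof -
  have "Suc j * ((2 * Suc j) choose Suc j) = 2 * (Suc j * (Suc (2 * j) choose j))"
    using Suc_times_binomial[of j "2 * j + 1"] by simp
  also have "Suc j * (Suc (2 * j) choose j) = Suc (2 * j) * ((2 * j) choose j)"
    using binomial_absorb_comp[of "Suc (2 * j)" j] by (simp add: Suc_diff_le)
  finally have "Suc j * ((2 * Suc j) choose Suc j) = 2 * (2 * j + 1) * ((2 * j) choose j)" by simp
  thus ?thesis by (metis (no_types, lifting) of_nat_mult of_nat_numeral)
qed

abbreviation qpoly :: "rat poly" where "qpoly \<equiv> [:0, 1, 1:]"
abbreviation qpoly' :: "rat poly" where "qpoly' \<equiv> [:1, 2:]"

lemma pderiv_qpoly [simp]: "pderiv qpoly = qpoly'" "pderiv qpoly' = 2"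
  by (simp_all add: pderiv_pCons numeral_poly)

lemma coeff_qpoly_mult:
  "poly.coeff (qpoly * g) r = (if r = 0 then 0 else poly.coeff g (r - 1) + (if r = 1 then 0 else poly.coeff g (r - 2)))"
  by (cases r; cases "r - 1") (auto simp: coeff_pCons split: nat.splits)

lemma coeff_qpoly'_mult:
  "poly.coeff (qpoly' * g) r = poly.coeff g r + (if r = 0 then 0 else 2 * poly.coeff g (r - 1))"
  by (cases r) (auto simp: coeff_pCons)

text \<open>
  With \<open>q = z(1+z)\<close>, Legendre's equation reads \<open>(q f')' = l f\<close> with \<open>l = n(n+1)\<close>.  The operator below is
  its symmetric square, the third-order operator that annihilates the products of two solutions.
\<close>

definition clausen_op :: "rat \<Rightarrow> rat poly \<Rightarrow> rat poly" where
  "clausen_op l h = qpoly * pderiv (pderiv (qpoly * pderiv h)) + qpoly' * pderiv (qpoly * pderiv h)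
     - [:4 * l:] * (qpoly * pderiv h) - [:2 * l:] * (qpoly' * h)"

lemma clausen_op_diff: "clausen_op l (g - h) = clausen_op l g - clausen_op l h"
  unfolding clausen_op_def by (simp only: pderiv_diff ring_distribs)

lemma clausen_op_add: "clausen_op l (g + h) = clausen_op l g + clausen_op l h"
  unfolding clausen_op_def by (simp only: pderiv_add ring_distribs)

lemma clausen_op_const_mult: "clausen_op l ([:c:] * h) = [:c:] * clausen_op l h"
  unfolding clausen_op_def
  by (simp add: pderiv_smult smult_add_right smult_diff_right mult_ac pderiv_add pderiv_pCons)

lemma clausen_op_sum: "clausen_op l (sum f A) = (\<Sum>i\<in>A. clausen_op l (f i))"
proof (induction A rule: infinite_finite_induct)
  case (insert x A) thus ?case by (simp add: clausen_op_add)
qed (simp_all add: clausen_op_def)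

text \<open>
  At \<open>z = 0\<close> the operator sends \<open>z\<^sup>r\<close> to \<open>r\<^sup>3 z\<^bsup>r-1\<^esup>\<close> plus higher terms: its indicial polynomial is \<open>r\<^sup>3\<close>, so
  that a solution is determined by its constant term.
\<close>

lemma clausen_op_unique:
  assumes "clausen_op l h = 0" "poly.coeff h 0 = 0"
  shows "h = 0"
proof -
  have "poly.coeff h r = 0" for r
  proof (induction r rule: less_induct)
    case (less r)
    show ?case
    proof (cases r)
      case 0 thus ?thesis using assms(2) by simp
    next
      case (Suc s)
      define G where "G = qpoly * pderiv h"
      have hz: "poly.coeff h i = 0" if "i \<le> s" for i using less Suc that by auto
      have dz: "poly.coeff (pderiv h) i = 0" if "i < s" for i using hz that by (simp add: coeff_pderiv)
      have Gz: "poly.coeff G i = 0" if "i \<le> s" for i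
        unfolding G_def coeff_qpoly_mult using that dz by auto
      have G1: "poly.coeff G (Suc s) = of_nat (Suc s) * poly.coeff h (Suc s)"
        unfolding G_def coeff_qpoly_mult using hz by (auto simp: coeff_pderiv)
      have "poly.coeff (clausen_op l h) s = 
          poly.coeff (qpoly * pderiv (pderiv G)) s + poly.coeff (qpoly' * pderiv G) s
          - 4 * l * poly.coeff G s - 2 * l * poly.coeff (qpoly' * h) s"
        unfolding clausen_op_def G_def[symmetric]
        by (simp del: mult_pCons_left add: mult_pCons_left[of _ 0])
      also have "\<dots> = of_nat s * of_nat (Suc s) * poly.coeff G (Suc s) + of_nat (Suc s) * poly.coeff G (Suc s)"
        unfolding coeff_qpoly_mult coeff_qpoly'_mult coeff_pderiv using Gz hz
        by (cases s) (auto)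
      also have "\<dots> = of_nat (Suc s) ^ 3 * poly.coeff h (Suc s)"
        unfolding G1 by (simp add: algebra_simps power3_eq_cube)
      finally show ?thesis using assms(1) Suc by simp
    qed
  qed
  thus ?thesis by (simp add: poly_eq_iff)
qed

definition legendre_poly :: "nat \<Rightarrow> rat poly" where
  "legendre_poly n = (\<Sum>k\<le>n. Polynomial.monom (legendre_coeff n k) k)"

lemma coeff_legendre_poly: "poly.coeff (legendre_poly n) k = legendre_coeff n k"
  unfolding legendre_poly_def by (auto simp: coeff_sum sum.If_cases legendre_coeff_def)

lemma legendre_ode:
  "pderiv (qpoly * pderiv (legendre_poly n)) = [:of_nat n * of_nat (Suc n):] * legendre_poly n"
proof (rule poly_eqI)
  fix k
  let ?u = "legendre_coeff n"
  have "poly.coeff (pderiv (qpoly * pderiv (legendre_poly n))) k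
      = of_nat (Suc k) ^ 2 * ?u (Suc k) + of_nat k * of_nat (Suc k) * ?u k"
    unfolding coeff_pderiv coeff_qpoly_mult coeff_legendre_poly
    by (cases k) (simp_all add: algebra_simps power2_eq_square)
  also have "\<dots> = of_nat n * of_nat (Suc n) * ?u k"
    unfolding legendre_coeff_Suc by (simp add: algebra_simps)
  finally show "poly.coeff (pderiv (qpoly * pderiv (legendre_poly n))) k
      = poly.coeff ([:of_nat n * of_nat (Suc n):] * legendre_poly n) k"
    by (simp add: coeff_legendre_poly)
qed

text \<open>
  With \<open>h = q f'\<^sup>2\<close> one has \<open>(q (f\<^sup>2)')' = 2 h + 2 l f\<^sup>2\<close> and \<open>q h' + q' h = l q (f\<^sup>2)'\<close>, both from the
  second-order equation; eliminating \<open>h\<close> leaves the third-order one.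
\<close>

lemma clausen_op_square:
  assumes ode: "pderiv (qpoly * pderiv f) = [:l:] * f"
  shows "clausen_op l (f * f) = 0"
proof -
  define q q' L f1 f2 where d: "q = qpoly" "q' = qpoly'" "L = [:l:]" "f1 = pderiv f" "f2 = pderiv f1"
  have pd: "pderiv q = q'" "pderiv f = f1" "pderiv f1 = f2" "pderiv L = 0" by (simp_all add: d pderiv_pCons)
  have e1: "q * f2 + q' * f1 = L * f"
    using ode unfolding d[symmetric] pderiv_mult pd by (simp add: algebra_simps)
  have e2: "pderiv (q * f1) = L * f" using ode by (simp add: d)
  have g1: "q * pderiv (f * f) = 2 * (f * (q * f1))"
    unfolding pderiv_mult pd by (simp add: algebra_simps)
  have g2: "pderiv (q * pderiv (f * f)) = 2 * (f1 * (q * f1)) + 2 * (L * (f * f))"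
  proof -
    have "q * pderiv (f * f) = f * (q * f1) + f * (q * f1)" unfolding g1 by simp
    thus ?thesis by (simp only: pderiv_add pderiv_mult[of f] e2 pd) (simp add: algebra_simps)
  qed
  have g3: "pderiv (pderiv (q * pderiv (f * f))) = 2 * (f1 * (L * f) + q * f1 * f2) + 2 * (L * (2 * f * f1))"
  proof -
    have "pderiv (q * pderiv (f * f)) = f1 * (q * f1) + f1 * (q * f1) + L * (f * f) + L * (f * f)"
      unfolding g2 by simp
    thus ?thesis by (simp only: pderiv_add pderiv_mult[of f1] e2 pderiv_mult[of L] pderiv_mult[of f] pd)
        (simp add: algebra_simps)
  qed
  have c: "[:4 * l:] = 4 * L" "[:2 * l:] = 2 * L" by (simp_all add: d numeral_poly)
  have "clausen_op l (f * f) = q * (2 * (f1 * (L * f) + q * f1 * f2) + 2 * (L * (2 * f * f1)))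
      + q' * (2 * (f1 * (q * f1)) + 2 * (L * (f * f))) - 4 * L * (2 * (f * (q * f1))) - 2 * L * (q' * (f * f))"
    unfolding clausen_op_def c d(1,2)[symmetric] g3 unfolding g2 unfolding g1 ..
  also have "\<dots> = 2 * q * f1 * ((q * f2 + q' * f1) - L * f)" by (simp add: algebra_simps)
  also have "\<dots> = 0" unfolding e1 by simp
  finally show ?thesis .
qed

text \<open>
  On powers of \<open>q\<close> the operator has only two terms, because \<open>q'\<^sup>2 = 1 + 4q\<close>.  A polynomial in \<open>q\<close> is
  therefore annihilated as soon as its coefficients satisfy a two-term recurrence.
\<close>

lemma clausen_op_power:
  "clausen_op l (qpoly ^ k) = qpoly' * ([:of_nat k ^ 3:] * qpoly ^ (k - 1)
     - [:(4 * of_nat k + 2) * (l - of_nat k * of_nat (Suc k)):] * qpoly ^ k)"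
proof -
  define q q' L K e e' Q R where d: "q = qpoly" "q' = qpoly'" "L = [:l:]" "K = (of_nat k :: rat poly)"
    "e = pderiv (q ^ k)" "e' = pderiv e" "Q = q ^ k" "R = q ^ (k - 1)"
  have pd: "pderiv q = q'" "pderiv q' = 2" "pderiv K = 0" "pderiv Q = e" "pderiv e = e'" by (simp_all add: d)
  have e0: "e = K * R * q'"
    by (simp add: d(4,5,8) pderiv_power pd of_nat_poly)
  have Q: "K * Q = K * (q * R)" by (cases k) (simp_all add: d)
  have 1: "q * e = K * (q' * Q)"
  proof -
    have "q * e = q' * (K * (q * R))" unfolding e0 by (simp only: mult_ac)
    also have "\<dots> = K * (q' * Q)" unfolding Q[symmetric] by (simp only: mult_ac)
    finally show ?thesis .
  qed
  have 4: "q' * q' = 1 + 4 * q" by (simp add: d numeral_poly one_pCons)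
  have 2: "q' * e + q * e' = 2 * K * Q + K * q' * e"
  proof -
    have "pderiv (q * e) = pderiv (K * (q' * Q))" using 1 by simp
    thus ?thesis unfolding pderiv_mult pd by (simp add: algebra_simps)
  qed
  have 3: "q' * e = K * R + 4 * K * Q"
  proof -
    have "q' * e = K * R * (q' * q')" unfolding e0 by (simp only: mult_ac)
    also have "\<dots> = K * R + 4 * (K * (q * R))" unfolding 4 by (simp add: algebra_simps)
    finally show ?thesis unfolding Q[symmetric] by (simp add: mult.assoc)
  qed
  have g2: "pderiv (K * (q' * Q)) = K * (2 * Q + q' * e)"
    unfolding pderiv_mult pd by (simp add: algebra_simps)
  have g3: "pderiv (K * (2 * Q + q' * e)) = K * (4 * e + q' * e')"
  proof -
    have "pderiv (K * (Q + Q + q' * e)) = K * (4 * e + q' * e')"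
      by (simp only: pderiv_add pderiv_mult pd) (simp add: algebra_simps)
    thus ?thesis by (simp add: algebra_simps)
  qed
  have c: "[:4 * l:] = 4 * L" "[:2 * l:] = 2 * L" "[:of_nat k ^ 3:] = K ^ 3"
    "[:(4 * of_nat k + 2) * (l - of_nat k * of_nat (Suc k)):] = (4 * K + 2) * (L - K * (K + 1))"
    by (simp_all add: d numeral_poly of_nat_poly power3_eq_cube one_pCons) (simp add: algebra_simps)
  have "clausen_op l (q ^ k) = q * (K * (4 * e + q' * e')) + q' * (K * (2 * Q + q' * e))
      - 4 * L * (K * (q' * Q)) - 2 * L * (q' * Q)"
    unfolding clausen_op_def c d(1,2)[symmetric] d(5)[symmetric] 1 unfolding g2 g3 unfolding d ..
  also have "\<dots> = q' * (K ^ 3 * R - (4 * K + 2) * (L - K * (K + 1)) * Q)"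
  proof -
    have "q * (K * (4 * e + q' * e')) + q' * (K * (2 * Q + q' * e)) - 4 * L * (K * (q' * Q)) - 2 * L * (q' * Q)
          - q' * (K ^ 3 * R - (4 * K + 2) * (L - K * (K + 1)) * Q)
        = 4 * K * (q * e - K * (q' * Q)) + K * q' * ((q' * e + q * e') - (2 * K * Q + K * q' * e))
          + K * K * q' * (q' * e - (K * R + 4 * K * Q))"
      by (simp add: algebra_simps power3_eq_cube)
    also have "\<dots> = 0" unfolding 2 unfolding 1 3 by simp
    finally show ?thesis by simp
  qed
  finally show ?thesis unfolding c by (simp only: d)
qed

text \<open>
  Both sides are polynomials with constant term 1 that the operator annihilates: the left side as the
  square of a solution of Legendre's equation, the right side because its coefficients as a polynomial in
  \<open>q = z(1+z)\<close> satisfy the two-term recurrence above, so that the sum telescopes.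
\<close>

theorem clausen_legendre:
  "(legendre_sum n z) ^ 2
     = (\<Sum>k\<le>n. legendre_coeff n k * of_nat ((2 * k) choose k) * (z * (1 + z)) ^ k)"
proof -
  define l :: rat where "l = of_nat n * of_nat (Suc n)"
  define v where "v k = legendre_coeff n k * of_nat ((2 * k) choose k)" for k
  have v_Suc: "of_nat (Suc k) ^ 3 * v (Suc k) = (4 * of_nat k + 2) * (l - of_nat k * of_nat (Suc k)) * v k" for k
  proof -
    have central: "of_nat (Suc k) * of_nat ((2 * Suc k) choose Suc k) = (4 * of_nat k + 2) * rat_of_nat ((2 * k) choose k)"
      unfolding central_binomial_Suc by (simp add: algebra_simps)
    have "of_nat (Suc k) ^ 3 * v (Suc k)
        = (of_nat (Suc k) ^ 2 * legendre_coeff n (Suc k)) * (of_nat (Suc k) * of_nat ((2 * Suc k) choose Suc k))"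
      unfolding v_def by (simp only: power3_eq_cube power2_eq_square mult_ac)
    thus ?thesis unfolding central legendre_coeff_Suc v_def l_def by (simp only: mult_ac)
  qed
  define g where "g = (\<Sum>k\<le>n. [:v k:] * qpoly ^ k)"
  define w where "w k = [:v k * of_nat k ^ 3:] * qpoly ^ (k - 1)" for k
  have "clausen_op l g = (\<Sum>k\<le>n. qpoly' * (w k - w (Suc k)))"
    unfolding g_def clausen_op_sum clausen_op_const_mult clausen_op_power
  proof (rule sum.cong[OF refl])
    fix k
    have "w (Suc k) = [:v k:] * ([:(4 * of_nat k + 2) * (l - of_nat k * of_nat (Suc k)):] * qpoly ^ k)"
      unfolding w_def using v_Suc[of k] by (simp add: mult.commute)
    moreover have "w k = [:v k:] * ([:of_nat k ^ 3:] * qpoly ^ (k - 1))"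
      unfolding w_def by (simp add: mult.commute)
    ultimately show "[:v k:] * (qpoly' * ([:of_nat k ^ 3:] * qpoly ^ (k - 1) -
          [:(4 * of_nat k + 2) * (l - of_nat k * of_nat (Suc k)):] * qpoly ^ k)) = qpoly' * (w k - w (Suc k))"
      by (simp only: right_diff_distrib mult.left_commute)
  qed
  also have "\<dots> = qpoly' * (w 0 - w (Suc n))"
    unfolding sum_distrib_left[symmetric] by (simp only: sum_telescope)
  also have "\<dots> = 0" by (simp add: w_def v_def legendre_coeff_def)
  finally have Lg: "clausen_op l g = 0" .
  define h where "h = legendre_poly n * legendre_poly n - g"
  have "clausen_op l h = 0"
    unfolding h_def clausen_op_diff Lg using clausen_op_square[OF legendre_ode[of n]] by (simp add: l_def)
  moreover have "poly.coeff h 0 = 0"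
  proof -
    have "poly.coeff g 0 = (\<Sum>k\<le>n. v k * 0 ^ k)"
      unfolding g_def coeff_sum by (intro sum.cong) (simp_all add: coeff_0_power)
    also have "\<dots> = v 0" by (simp add: power_0_left if_distrib sum.delta cong: if_cong)
    finally show ?thesis
      by (simp add: h_def coeff_mult_0 coeff_legendre_poly v_def legendre_coeff_def)
  qed
  ultimately have "h = 0" by (rule clausen_op_unique)
  hence "poly (legendre_poly n * legendre_poly n) z = poly g z" unfolding h_def by simp
  moreover have "poly (legendre_poly n) z = legendre_sum n z"
    unfolding legendre_poly_def legendre_sum_def poly_sum poly_monom ..
  moreover have "poly g z = (\<Sum>k\<le>n. v k * (z * (1 + z)) ^ k)"
    unfolding g_def poly_sum by (intro sum.cong) (simp_all add: algebra_simps)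
  ultimately show ?thesis by (simp add: v_def power2_eq_square)
qed

section \<open>Closed forms for Legendre and Kummer sums\<close>

text \<open>
  Expand \<open>(1+z)\<^bsup>n-k\<^esup>\<close> and collect powers of \<open>z\<close>; the coefficients are given by Vandermonde's convolution.
\<close>

lemma legendre_sum_alt:
  "legendre_sum n z = (\<Sum>k\<le>n. of_nat (n choose k) ^ 2 * z ^ k * (1 + z) ^ (n - k))"
proof -
  let ?g = "\<lambda>k i. of_nat (n choose k) ^ 2 * of_nat ((n - k) choose i) * z ^ (k + i)"
  have "(\<Sum>k\<le>n. of_nat (n choose k) ^ 2 * z ^ k * (1 + z) ^ (n - k)) = (\<Sum>k\<le>n. \<Sum>i\<le>n-k. ?g k i)"
    using binomial_ring[of z 1] by (simp add: add.commute sum_distrib_left mult_ac power_add)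
  also have "\<dots> = (\<Sum>(k, i)\<in>{(k, i). k + i \<le> n}. ?g k i)"
    by (subst sum.Sigma) (auto intro!: sum.cong)
  also have "\<dots> = (\<Sum>j\<le>n. \<Sum>k\<le>j. ?g k (j - k))"
    by (rule sum.triangle_reindex_eq)
  also have "\<dots> = (\<Sum>j\<le>n. legendre_coeff n j * z ^ j)"
  proof (rule sum.cong[OF refl])
    fix j assume "j \<in> {..n}"
    hence j: "j \<le> n" by simp
    have "(\<Sum>k\<le>j. (n choose k) ^ 2 * ((n - k) choose (j - k))) = (\<Sum>k\<le>j. (n choose j) * ((n choose k) * (j choose (j - k))))"
    proof (rule sum.cong[OF refl])
      fix k assume "k \<in> {..j}"
      thus "(n choose k) ^ 2 * ((n - k) choose (j - k)) = (n choose j) * ((n choose k) * (j choose (j - k)))"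
        using choose_mult[of k j n] j by (simp add: power2_eq_square binomial_symmetric[symmetric])
    qed
    also have "\<dots> = (n choose j) * ((n + j) choose j)"
      unfolding sum_distrib_left[symmetric] vandermonde ..
    finally have "rat_of_nat (\<Sum>k\<le>j. (n choose k) ^ 2 * ((n - k) choose (j - k))) = of_nat ((n choose j) * ((n + j) choose j))"
      by simp
    thus "(\<Sum>k\<le>j. ?g k (j - k)) = legendre_coeff n j * z ^ j"
      by (simp add: legendre_coeff_def sum_distrib_right[symmetric])
  qed
  finally show ?thesis unfolding legendre_sum_def ..
qed

text \<open>
  Apply the linear functional \<open>T\<^sup>s \<mapsto> w(s)\<close> to \<open>(1+T)\<^sup>n (1-T)\<^sup>n = (1-T\<^sup>2)\<^sup>n\<close>.  The weight \<open>[s = n]\<close> extracts a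
  coefficient; the weight \<open>1/(n+1+s)\<close> is integration against \<open>T\<^sup>n\<close> over the unit interval.
\<close>

lemma binomial_convolution_functional:
  fixes w :: "nat \<Rightarrow> rat"
  shows "(\<Sum>k\<le>n. \<Sum>j\<le>n. of_nat (n choose k) * of_nat (n choose j) * (-1) ^ j * w (k + j))
    = (\<Sum>i\<le>n. of_nat (n choose i) * (-1) ^ i * w (2 * i))"
proof -
  define \<Lambda> where "\<Lambda> g = (\<Sum>s\<le>2*n. poly.coeff g s * w s)" for g :: "rat poly"
  have \<Lambda>_sum: "\<Lambda> (\<Sum>x\<in>A. f x) = (\<Sum>x\<in>A. \<Lambda> (f x))" for f :: "nat \<Rightarrow> rat poly" and A
    unfolding \<Lambda>_def coeff_sum sum_distrib_right by (rule sum.swap)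
  have \<Lambda>_monom: "\<Lambda> (Polynomial.monom c s) = c * w s" if "s \<le> 2 * n" for c s
    unfolding \<Lambda>_def using that by (simp add: if_distrib[of "\<lambda>t. t * _"] sum.delta' cong: if_cong)
  have pow: "(Polynomial.monom c d + 1) ^ n = (\<Sum>k\<le>n. Polynomial.monom (of_nat (n choose k) * c ^ k) (d * k))"
    for c :: rat and d
    by (simp add: binomial_ring monom_power of_nat_poly smult_monom)
  have "(\<Sum>k\<le>n. \<Sum>j\<le>n. of_nat (n choose k) * of_nat (n choose j) * (-1) ^ j * w (k + j))
      = \<Lambda> (\<Sum>k\<le>n. \<Sum>j\<le>n. Polynomial.monom (of_nat (n choose k)) k * Polynomial.monom (of_nat (n choose j) * (-1) ^ j) j)"
    unfolding \<Lambda>_sum mult_monom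
  proof (intro sum.cong refl)
    fix k j assume "k \<in> {..n}" "j \<in> {..n}"
    hence "k + j \<le> 2 * n" by simp
    from \<Lambda>_monom[OF this] show "of_nat (n choose k) * of_nat (n choose j) * (-1) ^ j * w (k + j)
       = \<Lambda> (Polynomial.monom (of_nat (n choose k) * (of_nat (n choose j) * (-1) ^ j)) (k + j))"
      by (simp add: mult_ac)
  qed
  also have "(\<Sum>k\<le>n. \<Sum>j\<le>n. Polynomial.monom (rat_of_nat (n choose k)) k * Polynomial.monom (of_nat (n choose j) * (-1) ^ j) j)
      = (Polynomial.monom 1 1 + 1) ^ n * (Polynomial.monom (-1) 1 + 1) ^ n"
    unfolding pow sum_product by simp
  also have "\<dots> = ((Polynomial.monom 1 1 + 1) * (Polynomial.monom (-1) 1 + 1)) ^ n"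
    by (simp add: power_mult_distrib)
  also have "(Polynomial.monom (1::rat) 1 + 1) * (Polynomial.monom (-1) 1 + 1) = Polynomial.monom (-1) 2 + 1"
    by (simp add: algebra_simps mult_monom add_monom minus_monom flip: one_add_one)
  also have "\<Lambda> (\<dots> ^ n) = (\<Sum>i\<le>n. of_nat (n choose i) * (-1) ^ i * w (2 * i))"
    unfolding pow \<Lambda>_sum by (intro sum.cong refl \<Lambda>_monom) simp
  finally show ?thesis .
qed

lemma alternating_binomial_square_sum:
  "(\<Sum>k\<le>n. (-1) ^ k * of_nat (n choose k) ^ 2 :: rat)
     = (if even n then (-1) ^ (n div 2) * of_nat (n choose (n div 2)) else 0)"
proof -
  have "(\<Sum>k\<le>n. (-1) ^ k * of_nat (n choose k) ^ 2 :: rat)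
      = (\<Sum>j\<le>n. \<Sum>k\<le>n. of_nat (n choose k) * of_nat (n choose j) * (-1) ^ j * (if k + j = n then 1 else 0))"
  proof (rule sum.cong[OF refl])
    fix j assume "j \<in> {..n}"
    hence j: "j \<le> n" by simp
    have "(\<Sum>k\<le>n. of_nat (n choose k) * of_nat (n choose j) * (-1) ^ j * (if k + j = n then 1 else 0 :: rat))
        = (\<Sum>k\<le>n. if k = n - j then of_nat (n choose k) * of_nat (n choose j) * (-1) ^ j else 0)"
      using j by (intro sum.cong) auto
    also have "\<dots> = of_nat (n choose (n - j)) * of_nat (n choose j) * (-1) ^ j"
      by simp
    also have "\<dots> = (-1) ^ j * of_nat (n choose j) ^ 2"
      using j binomial_symmetric[of j n] by (simp add: power2_eq_square)
    finally show "(-1) ^ j * of_nat (n choose j) ^ 2 =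
        (\<Sum>k\<le>n. of_nat (n choose k) * of_nat (n choose j) * (-1) ^ j * (if k + j = n then 1 else 0 :: rat))" by simp
  qed
  also have "\<dots> = (\<Sum>i\<le>n. of_nat (n choose i) * (-1) ^ i * (if 2 * i = n then 1 else 0))"
    by (subst sum.swap) (rule binomial_convolution_functional[of n "\<lambda>s. if s = n then 1 else 0"])
  also have "\<dots> = (if even n then (-1) ^ (n div 2) * of_nat (n choose (n div 2)) else 0)"
  proof (cases "even n")
    case True
    have "(\<Sum>i\<le>n. of_nat (n choose i) * (-1) ^ i * (if 2 * i = n then 1 else 0 :: rat))
        = (\<Sum>i\<le>n. if i = n div 2 then of_nat (n choose i) * (-1) ^ i else 0)"
      using True by (intro sum.cong) auto
    thus ?thesis using True by simp
  next
    case False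
    hence "2 * i \<noteq> n" for i by auto
    thus ?thesis using False by simp
  qed
  finally show ?thesis .
qed

lemma legendre_sum_minus_half:
  "legendre_sum n (-1/2) = (if even n then (-1) ^ (n div 2) * of_nat (n choose (n div 2)) / 2 ^ n else 0)"
proof -
  have "legendre_sum n (-1/2) = (\<Sum>k\<le>n. (-1) ^ k * of_nat (n choose k) ^ 2 / 2 ^ n)"
    unfolding legendre_sum_alt
  proof (rule sum.cong[OF refl])
    fix k assume "k \<in> {..n}"
    hence "(2::rat) ^ n = 2 ^ k * 2 ^ (n - k)" by (simp flip: power_add)
    thus "of_nat (n choose k) ^ 2 * (-1/2) ^ k * (1 + -1/2) ^ (n - k) = (-1) ^ k * rat_of_nat (n choose k) ^ 2 / 2 ^ n"
      by (simp add: power_minus' power_divide)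
  qed
  also have "\<dots> = (\<Sum>k\<le>n. (-1) ^ k * of_nat (n choose k) ^ 2) / 2 ^ n"
    by (simp add: sum_divide_distrib)
  finally show ?thesis unfolding alternating_binomial_square_sum by simp
qed

lemma sum_binomial_Suc_alternating:
  fixes g :: "nat \<Rightarrow> rat"
  shows "(\<Sum>j\<le>Suc N. (-1) ^ j * of_nat (Suc N choose j) * g j) = (\<Sum>j\<le>N. (-1) ^ j * of_nat (N choose j) * (g j - g (Suc j)))"
proof -
  have "(\<Sum>j\<le>Suc N. (-1) ^ j * of_nat (Suc N choose j) * g j)
     = g 0 + (\<Sum>j\<le>N. (-1) ^ Suc j * of_nat (N choose Suc j) * g (Suc j)) - (\<Sum>j\<le>N. (-1) ^ j * of_nat (N choose j) * g (Suc j))"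
    unfolding sum.atMost_Suc_shift by (simp add: algebra_simps sum.distrib sum_negf sum_subtractf)
  also have "g 0 + (\<Sum>j\<le>N. (-1) ^ Suc j * of_nat (N choose Suc j) * g (Suc j)) = (\<Sum>j\<le>Suc N. (-1) ^ j * of_nat (N choose j) * g j)"
    unfolding sum.atMost_Suc_shift by simp
  also have "\<dots> = (\<Sum>j\<le>N. (-1) ^ j * of_nat (N choose j) * g j)" by (simp add: binomial_eq_0)
  finally show ?thesis by (simp add: right_diff_distrib sum_subtractf)
qed

lemma binomial_partial_fractions:
  fixes z :: rat
  assumes "z > 0"
  shows "(\<Sum>j\<le>N. (-1) ^ j * of_nat (N choose j) / (z + of_nat j)) = fact N / (\<Prod>i\<le>N. z + of_nat i)"
  using assms
proof (induction N arbitrary: z)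
  case (Suc N)
  let ?P = "\<lambda>z. \<Prod>i\<le>N. z + of_nat i :: rat"
  have pos: "?P z > 0" "?P (z + 1) > 0" using Suc.prems by (auto intro!: prod_pos add_pos_nonneg)
  have "(\<Sum>j\<le>Suc N. (-1) ^ j * of_nat (Suc N choose j) / (z + of_nat j))
     = (\<Sum>j\<le>N. (-1) ^ j * of_nat (N choose j) / (z + of_nat j)) - (\<Sum>j\<le>N. (-1) ^ j * of_nat (N choose j) / ((z + 1) + of_nat j))"
    using sum_binomial_Suc_alternating[of N "\<lambda>j. 1 / (z + of_nat j)"]
    by (simp add: right_diff_distrib sum_subtractf add_ac)
  also have "\<dots> = fact N / ?P z - fact N / ?P (z + 1)"
    using Suc.IH[of z] Suc.IH[of "z + 1"] Suc.prems by simp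
  also have "\<dots> = fact (Suc N) / (\<Prod>i\<le>Suc N. z + of_nat i)"
  proof -
    have a: "(\<Prod>i\<le>Suc N. z + of_nat i) = z * ?P (z + 1)"
      unfolding prod.atMost_Suc_shift by (simp add: add_ac)
    have b: "(\<Prod>i\<le>Suc N. z + of_nat i) = ?P z * (z + of_nat (Suc N))" by simp
    have "fact N / ?P z = fact N * (z + of_nat (Suc N)) / (\<Prod>i\<le>Suc N. z + of_nat i)"
      unfolding b using Suc.prems pos by (simp add: add_pos_nonneg less_imp_neq[symmetric])
    moreover have "fact N / ?P (z + 1) = fact N * z / (\<Prod>i\<le>Suc N. z + of_nat i)"
      unfolding a using Suc.prems by simp
    ultimately show ?thesis by (simp add: diff_divide_distrib[symmetric] algebra_simps)
  qed
  finally show ?case .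
qed simp

text \<open>
  Kummer's theorem for \<open>F(-n, n+1; 2n+2; -1)\<close>.  It is the beta integral of \<open>T\<^sup>n (1+T)\<^sup>n (1-T)\<^sup>n\<close> computed in two
  ways, with partial fractions playing the role of the integral.
\<close>

lemma kummer_sum_plus:
  "(\<Sum>k\<le>n. of_nat (n choose k) * (fact (n + k) * fact (2 * n + 1)) / (fact n * fact (2 * n + 1 + k)))
    = (fact (2 * n + 1) * 2 ^ n / (fact n * (\<Prod>i\<le>n. of_nat (n + 1 + 2 * i))) :: rat)"
proof -
  have shift: "(\<Prod>i\<le>n. of_nat (n + 1 + k) + of_nat i) = (fact (2 * n + 1 + k) / fact (n + k) :: rat)" for k
  proof -
    have "(\<Prod>i\<le>N. of_nat (M + 1) + of_nat i) = (fact (M + 1 + N) / fact M :: rat)" for M N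
    proof (induction N)
      case (Suc N)
      have "fact (M + 1 + Suc N) = (of_nat (M + 1) + of_nat (Suc N)) * (fact (M + 1 + N) :: rat)"
        by (simp add: add.assoc)
      thus ?case unfolding prod.atMost_Suc Suc.IH by (simp only: times_divide_eq_left times_divide_eq_right mult.commute)
    qed simp
    from this[of "n + k" n] show ?thesis
      by (simp only: mult_2 add.assoc add.commute add.left_commute)
  qed
  have summand: "of_nat (n choose k) * (fact (n + k) * fact (2 * n + 1)) / (fact n * fact (2 * n + 1 + k))
     = (fact (2 * n + 1) / fact n ^ 2 * (\<Sum>j\<le>n. of_nat (n choose k) * of_nat (n choose j) * (-1) ^ j * (1 / of_nat (n + 1 + (k + j)))) :: rat)" for k
  proof -
    define S :: rat where "S = (\<Sum>j\<le>n. (-1) ^ j * of_nat (n choose j) / (of_nat (n + 1 + k) + of_nat j))"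
    define A B M :: rat where "A = fact (n + k)" and "B = fact (2 * n + 1 + k)" and "M = fact (2 * n + 1)"
    have "S = fact n * A / B"
      unfolding S_def A_def B_def using binomial_partial_fractions[of "of_nat (n + 1 + k)" n] unfolding shift by simp
    hence "of_nat (n choose k) * (A * M) / (fact n * B) = of_nat (n choose k) * M / fact n ^ 2 * S"
      by (simp add: power2_eq_square)
    hence "of_nat (n choose k) * (fact (n + k) * fact (2 * n + 1)) / (fact n * fact (2 * n + 1 + k))
       = of_nat (n choose k) * M / fact n ^ 2 * S"
      unfolding A_def B_def M_def .
    also have "\<dots> = M / fact n ^ 2 * (\<Sum>j\<le>n. of_nat (n choose k) * of_nat (n choose j) * (-1) ^ j * (1 / of_nat (n + 1 + (k + j))))"
      unfolding S_def by (simp add: sum_distrib_left mult_ac add_ac)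
    finally show ?thesis unfolding M_def .
  qed
  have "(\<Sum>k\<le>n. of_nat (n choose k) * (fact (n + k) * fact (2 * n + 1)) / (fact n * fact (2 * n + 1 + k)))
     = (fact (2 * n + 1) / fact n ^ 2 * (\<Sum>k\<le>n. \<Sum>j\<le>n. of_nat (n choose k) * of_nat (n choose j) * (-1) ^ j * (1 / of_nat (n + 1 + (k + j)))) :: rat)"
    unfolding summand sum_distrib_left ..
  also have "(\<Sum>k\<le>n. \<Sum>j\<le>n. of_nat (n choose k) * of_nat (n choose j) * (-1) ^ j * (1 / of_nat (n + 1 + (k + j))) :: rat)
     = (\<Sum>i\<le>n. of_nat (n choose i) * (-1) ^ i * (1 / of_nat (n + 1 + 2 * i)))"
    by (rule binomial_convolution_functional)
  also have "\<dots> = (\<Sum>i\<le>n. (-1) ^ i * of_nat (n choose i) / (of_nat (n + 1) / 2 + of_nat i)) / 2"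
    unfolding sum_divide_distrib by (intro sum.cong) (simp_all add: field_simps)
  also have "\<dots> = fact n / (\<Prod>i\<le>n. of_nat (n + 1) / 2 + of_nat i) / 2"
    by (subst binomial_partial_fractions) auto
  also have "(\<Prod>i\<le>n. of_nat (n + 1) / 2 + of_nat i :: rat) = (\<Prod>i\<le>n. of_nat (n + 1 + 2 * i) / 2)"
    by (intro prod.cong) (simp_all add: field_simps)
  also have "\<dots> = (\<Prod>i\<le>n. of_nat (n + 1 + 2 * i)) / 2 ^ Suc n"
    by (simp add: prod_dividef)
  finally show ?thesis by (simp add: power2_eq_square)
qed

text \<open>
  Compare coefficients in \<open>(1+X)\<^bsup>-n-1\<^esup> (1-X)\<^bsup>-n-1\<^esup> = (1-X\<^sup>2)\<^bsup>-n-1\<^esup>\<close>.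
\<close>

lemma alternating_negative_binomial_convolution:
  "(\<Sum>k\<le>N. (-1) ^ k * of_nat ((n + k) choose n) * of_nat ((n + (N - k)) choose n) :: rat)
     = (if even N then of_nat ((n + N div 2) choose n) else 0)"
proof -
  define H where "H n = Abs_fps (\<lambda>k. if even k then of_nat ((n + k div 2) choose n) else 0 :: rat)" for n
  have H_nth: "fps_nth (H m) k = (if even k then of_nat ((m + k div 2) choose m) else 0)" for m k
    by (simp add: H_def)
  have H: "H n * (1 - fps_X ^ 2) ^ Suc n = 1" for n
  proof (induction n)
    case 0
    have "H 0 * (1 - fps_X ^ 2) = 1"
      by (rule fps_ext) (auto simp: H_def right_diff_distrib fps_X_power_mult_right_nth)
    thus ?case by simp
  next
    case (Suc n)
    have "H (Suc n) * (1 - fps_X ^ 2) = H n"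
    proof (rule fps_ext)
      fix k
      have nth: "fps_nth (H (Suc n) * (1 - fps_X ^ 2)) k
          = fps_nth (H (Suc n)) k - (if k < 2 then 0 else fps_nth (H (Suc n)) (k - 2))"
        by (simp add: right_diff_distrib fps_X_power_mult_right_nth)
      show "fps_nth (H (Suc n) * (1 - fps_X ^ 2)) k = fps_nth (H n) k"
      proof (cases "k < 2")
        case True
        hence "k = 0 \<or> k = 1" by auto
        thus ?thesis unfolding nth H_nth by auto
      next
        case False
        then obtain j where "k = j + 2" by (metis add.commute le_Suc_ex not_less)
        moreover have "(j + 2) div 2 = Suc (j div 2)" by simp
        ultimately show ?thesis unfolding nth H_nth by simp
      qed
    qed
    moreover have "H (Suc n) * (1 - fps_X ^ 2) ^ Suc (Suc n) = (H (Suc n) * (1 - fps_X ^ 2)) * (1 - fps_X ^ 2) ^ Suc n"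
      by (simp only: power_Suc mult_ac)
    ultimately show ?case using Suc.IH by (simp only:)
  qed
  define F where "F c = Abs_fps (\<lambda>k. of_nat ((n + k) choose n) * c ^ k)" for c :: rat
  have F: "(1 - fps_const c * fps_X) ^ Suc n * F c = 1" for c
  proof -
    have "F c = inverse ((1 - fps_const c * fps_X) ^ Suc n)"
      unfolding F_def by (subst one_minus_const_fps_X_neg_power') 
        (auto intro!: fps_ext simp: binomial_symmetric[of n "n + _"])
    thus ?thesis by (simp add: inverse_mult_eq_1' del: power_Suc)
  qed
  have "(1 - fps_const 1 * fps_X) * (1 - fps_const (-1) * fps_X) = (1 - fps_X ^ 2 :: rat fps)"
    by (simp add: algebra_simps power2_eq_square flip: fps_const_neg)
  note factor = this
  have "(1 - fps_X ^ 2) ^ Suc n * (F (-1) * F 1)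
      = ((1 - fps_const 1 * fps_X) ^ Suc n * F 1) * ((1 - fps_const (-1) * fps_X) ^ Suc n * F (-1))"
    unfolding factor[symmetric] power_mult_distrib by (simp only: mult_ac)
  also have "\<dots> = 1" unfolding F by simp
  finally have inv: "(1 - fps_X ^ 2) ^ Suc n * (F (-1) * F 1) = 1" .
  have "F (-1) * F 1 = (H n * (1 - fps_X ^ 2) ^ Suc n) * (F (-1) * F 1)" unfolding H by simp
  also have "\<dots> = H n" unfolding mult.assoc inv by simp
  finally have "F (-1) * F 1 = H n" .
  hence "fps_nth (F (-1) * F 1) N = fps_nth (H n) N" by simp
  thus ?thesis unfolding fps_mult_nth F_def H_nth by (simp add: mult_ac atMost_atLeast0)
qed

text \<open>
  Kummer's theorem for \<open>F(-n, n+1; -2n; -1)\<close>: up to the factor \<open>C(2n,n)\<close> the summands are the products of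
  binomial coefficients in the convolution above.
\<close>

lemma kummer_sum_minus:
  "(\<Sum>k\<le>n. of_nat (n choose k) * (-1) ^ k * (fact (n + k) * fact (2 * n - k)) / (fact n * fact (2 * n)))
    = (if even n then of_nat ((n + n div 2) choose n) / of_nat ((2 * n) choose n) else 0 :: rat)"
proof -
  have "(\<Sum>k\<le>n. of_nat (n choose k) * (-1) ^ k * (fact (n + k) * fact (2 * n - k)) / (fact n * fact (2 * n)))
     = (\<Sum>k\<le>n. (-1) ^ k * of_nat ((n + k) choose n) * of_nat ((n + (n - k)) choose n) / of_nat ((2 * n) choose n) :: rat)"
  proof (rule sum.cong[OF refl])
    fix k assume "k \<in> {..n}"
    hence k: "k \<le> n" by simp
    have e: "n + (n - k) = 2 * n - k" "2 * n - k - n = n - k" "2 * n - n = n" using k by auto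
    show "of_nat (n choose k) * (-1) ^ k * (fact (n + k) * fact (2 * n - k)) / (fact n * fact (2 * n))
     = ((-1) ^ k * of_nat ((n + k) choose n) * of_nat ((n + (n - k)) choose n) / of_nat ((2 * n) choose n) :: rat)"
      unfolding e(1) using k e by (simp add: binomial_fact field_simps)
  qed
  also have "\<dots> = (\<Sum>k\<le>n. (-1) ^ k * of_nat ((n + k) choose n) * of_nat ((n + (n - k)) choose n)) / of_nat ((2 * n) choose n)"
    by (simp add: sum_divide_distrib)
  finally show ?thesis unfolding alternating_negative_binomial_convolution by simp
qed

section \<open>From sums of Apery polynomials to squares of Legendre sums\<close>

text \<open>
  The certificate is found by Zeilberger's algorithm.  The factor \<open>(k - j) C(k+j, 2j)\<close>, which is an odd
  function of \<open>k\<close>, equals \<open>(k+j)\<dots>(k-j)/(2j)!\<close> and so is divisible by \<open>p\<close> at \<open>k = p\<close> when \<open>2j < p\<close>.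
\<close>

definition wz_cert :: "nat \<Rightarrow> nat \<Rightarrow> rat" where
  "wz_cert j k = - ((-1) ^ k * (of_nat k ^ 2 - of_nat (j + 1) * of_nat (3 * j + 2)) * (of_nat k - of_nat j) ^ 2
      * of_nat ((k + j) choose (2 * j)) ^ 2) / (of_nat (2 * j + 1) ^ 2 * of_nat (j + 1))"

lemma choose_step_j:
  "of_nat (2 * j + 1) * of_nat (2 * j + 2) * (of_nat ((k + Suc j) choose (2 * Suc j)) :: rat)
     = (of_nat k + of_nat j + 1) * (of_nat k - of_nat j) * of_nat ((k + j) choose (2 * j))"
proof (cases "j \<le> k")
  case True
  have "(2 * j + 2) * ((k + Suc j) choose (2 * Suc j)) = (k + j + 1) * ((k + j) choose (2 * j + 1))"
    using Suc_times_binomial[of "2 * j + 1" "k + j"] by simp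
  hence 1: "of_nat (2 * j + 2) * (of_nat ((k + Suc j) choose (2 * Suc j)) :: rat)
      = (of_nat k + of_nat j + 1) * of_nat ((k + j) choose (2 * j + 1))"
    by (metis of_nat_mult of_nat_add of_nat_1)
  have "(2 * j + 1) * ((k + j) choose (2 * j + 1)) = (k - j) * ((k + j) choose (2 * j))"
    using binomial_absorb_comp[of "k + j" "2 * j"] binomial_absorption[of "2 * j" "k + j"] by (simp add: mult.commute)
  hence 2: "of_nat (2 * j + 1) * (of_nat ((k + j) choose (2 * j + 1)) :: rat)
      = (of_nat k - of_nat j) * of_nat ((k + j) choose (2 * j))"
    using True by (metis of_nat_diff of_nat_mult)
  have "of_nat (2 * j + 1) * of_nat (2 * j + 2) * (of_nat ((k + Suc j) choose (2 * Suc j)) :: rat)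
     = of_nat (2 * j + 1) * (of_nat (2 * j + 2) * of_nat ((k + Suc j) choose (2 * Suc j)))" by (simp only: mult_ac)
  also have "\<dots> = (of_nat k + of_nat j + 1) * (of_nat (2 * j + 1) * of_nat ((k + j) choose (2 * j + 1)))"
    unfolding 1 by (simp only: mult_ac)
  also have "\<dots> = (of_nat k + of_nat j + 1) * (of_nat k - of_nat j) * of_nat ((k + j) choose (2 * j))"
    unfolding 2 by (simp only: mult_ac)
  finally show ?thesis .
qed (simp add: binomial_eq_0)

lemma choose_step_k:
  "(of_nat k + 1 - of_nat j) * (of_nat ((Suc k + j) choose (2 * j)) :: rat)
     = (of_nat k + of_nat j + 1) * of_nat ((k + j) choose (2 * j))"
proof (cases "j \<le> Suc k")
  case True
  have "(Suc k - j) * ((Suc k + j) choose (2 * j)) = (k + j + 1) * ((k + j) choose (2 * j))"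
    using binomial_absorb_comp[of "Suc k + j" "2 * j"] by simp
  hence "of_nat (Suc k - j) * (of_nat ((Suc k + j) choose (2 * j)) :: rat) = of_nat (k + j + 1) * of_nat ((k + j) choose (2 * j))"
    by (metis of_nat_mult)
  thus ?thesis using True by (simp add: of_nat_diff add_ac)
qed (simp add: binomial_eq_0)

lemma wz_step:
  "8 * of_nat (j + 1) * ((-1) ^ k * of_nat ((k + Suc j) choose (2 * Suc j)) ^ 2)
     - of_nat (2 * j + 1) * ((-1) ^ k * of_nat ((k + j) choose (2 * j)) ^ 2)
   = wz_cert j (Suc k) - wz_cert j k"
proof -
  define J K B B' B'' :: rat where d: "J = of_nat j" "K = of_nat k" "B = of_nat ((k + j) choose (2 * j))"
    "B' = of_nat ((k + Suc j) choose (2 * Suc j))" "B'' = of_nat ((Suc k + j) choose (2 * j))"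
  have pos: "2 * J + 1 \<noteq> 0" "J + 1 \<noteq> 0" using add_nonneg_eq_0_iff[of "2 * J" 1] add_nonneg_eq_0_iff[of J 1] by (auto simp: d)
  have 1: "2 * ((2 * J + 1) * (J + 1)) * B' = (K + J + 1) * (K - J) * B"
    using choose_step_j[of j k] by (simp add: d algebra_simps)
  have 2: "(K + 1 - J) * B'' = (K + J + 1) * B" using choose_step_k[of k j] by (simp add: d)
  have sq2: "(K + 1 - J) ^ 2 * B'' ^ 2 = (K + J + 1) ^ 2 * B ^ 2" using 2 by (metis power_mult_distrib)
  define D where "D = (2 * J + 1) ^ 2 * (J + 1)"
  have D: "D \<noteq> 0" using pos by (simp add: D_def)
  have "8 * (J + 1) * B' ^ 2 * D = 2 * ((K + J + 1) * (K - J)) ^ 2 * B ^ 2"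
  proof -
    have "8 * (J + 1) * B' ^ 2 * D = 2 * (2 * ((2 * J + 1) * (J + 1)) * B') ^ 2"
      unfolding D_def by (simp add: power2_eq_square)
    thus ?thesis unfolding 1 by (simp add: power_mult_distrib)
  qed
  hence m: "(8 * (J + 1) * B' ^ 2 - (2 * J + 1) * B ^ 2) * D
      = ((K + 1) ^ 2 - (J + 1) * (3 * J + 2)) * ((K + 1 - J) ^ 2 * B'' ^ 2)
        + (K ^ 2 - (J + 1) * (3 * J + 2)) * ((K - J) ^ 2 * B ^ 2)"
  proof -
    have "2 * ((K + J + 1) * (K - J)) ^ 2 - (2 * J + 1) * D
        = ((K + 1) ^ 2 - (J + 1) * (3 * J + 2)) * (K + J + 1) ^ 2 + (K ^ 2 - (J + 1) * (3 * J + 2)) * (K - J) ^ 2"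
      unfolding D_def by (simp add: power2_eq_square algebra_simps)
    note poly = arg_cong[OF this, of "\<lambda>t. t * B ^ 2"]
    have "(8 * (J + 1) * B' ^ 2 - (2 * J + 1) * B ^ 2) * D
        = 8 * (J + 1) * B' ^ 2 * D - (2 * J + 1) * D * B ^ 2" by (simp add: algebra_simps)
    also have "\<dots> = (2 * ((K + J + 1) * (K - J)) ^ 2 - (2 * J + 1) * D) * B ^ 2"
      unfolding \<open>8 * (J + 1) * B' ^ 2 * D = _\<close> by (simp add: algebra_simps)
    finally show ?thesis unfolding poly sq2 by (simp add: algebra_simps)
  qed
  have "8 * (J + 1) * B' ^ 2 - (2 * J + 1) * B ^ 2
      = (((K + 1) ^ 2 - (J + 1) * (3 * J + 2)) * ((K + 1 - J) ^ 2 * B'' ^ 2)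
        + (K ^ 2 - (J + 1) * (3 * J + 2)) * ((K - J) ^ 2 * B ^ 2)) / D"
    using m D by (simp add: eq_divide_eq)
  hence "8 * (J + 1) * ((-1) ^ k * B' ^ 2) - (2 * J + 1) * ((-1) ^ k * B ^ 2)
      = (-1) ^ k * ((((K + 1) ^ 2 - (J + 1) * (3 * J + 2)) * ((K + 1 - J) ^ 2 * B'' ^ 2)
        + (K ^ 2 - (J + 1) * (3 * J + 2)) * ((K - J) ^ 2 * B ^ 2)) / D)"
    by (metis (no_types, lifting) mult.left_commute right_diff_distrib)
  also have "\<dots> = wz_cert j (Suc k) - wz_cert j k"
    unfolding wz_cert_def D_def by (simp add: d diff_divide_distrib add_divide_distrib algebra_simps)
  finally show ?thesis by (simp add: d algebra_simps)
qed

definition alt_choose_sum :: "nat \<Rightarrow> nat \<Rightarrow> rat" where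
  "alt_choose_sum N j = (\<Sum>k<N. (-1) ^ k * of_nat ((k + j) choose (2 * j)) ^ 2)"

lemma alt_choose_sum_step:
  "8 * of_nat (j + 1) * alt_choose_sum N (Suc j) - of_nat (2 * j + 1) * alt_choose_sum N j = wz_cert j N"
proof -
  have "8 * of_nat (j + 1) * alt_choose_sum N (Suc j) - of_nat (2 * j + 1) * alt_choose_sum N j
      = (\<Sum>k<N. wz_cert j (Suc k) - wz_cert j k)"
    unfolding alt_choose_sum_def sum_distrib_left sum_subtractf[symmetric] wz_step ..
  also have "\<dots> = wz_cert j N - wz_cert j 0" by (rule sum_lessThan_telescope)
  also have "wz_cert j 0 = 0" by (cases j) (simp_all add: wz_cert_def binomial_eq_0)
  finally show ?thesis by simp
qed

context odd_prime_modulus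
begin

lemma prime_dvd_choose_shift:
  assumes "j < 2 * j" "2 * j < p"
  shows "p dvd ((p + j) choose (2 * j))"
proof -
  have "fact (2 * j) * ((p + j) choose (2 * j)) * fact (p - j) = (fact (p + j) :: nat)"
    using binomial_fact_lemma[of "2 * j" "p + j"] assms by (simp add: mult_ac)
  moreover have "fact (p + j) = (\<Prod>i\<in>{p - j + 1..p + j}. i) * (fact (p - j) :: nat)"
  proof -
    have "{1..p + j} = {1..p - j} \<union> {p - j + 1..p + j}" by auto
    thus ?thesis unfolding fact_prod of_nat_id using assms
      by (subst \<open>{1..p + j} = _\<close>, subst prod.union_disjoint) auto
  qed
  ultimately have "fact (2 * j) * ((p + j) choose (2 * j)) = (\<Prod>i\<in>{p - j + 1..p + j}. i)" by simp
  moreover have "p dvd (\<Prod>i\<in>{p - j + 1..p + j}. i)" using assms by (intro dvd_prodI) auto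
  ultimately have "p dvd fact (2 * j) * ((p + j) choose (2 * j))" by simp
  thus ?thesis using assms prime_p by (simp add: prime_dvd_mult_iff prime_dvd_fact_iff)
qed

text \<open>
  The recurrence for the sums over \<open>k < p\<close> has the inhomogeneous term \<open>wz_cert j p\<close>, which is divisible by
  \<open>p\<^sup>2\<close>.  Its coefficients are units as long as \<open>j < n\<close>.
\<close>

lemma alt_choose_sum_cong:
  "j \<le> n \<Longrightarrow> rat_cong p 2 (alt_choose_sum p j) (of_nat ((2 * j) choose j) / 16 ^ j)"
proof (induction j)
  case 0
  have "(\<Sum>k<2 * N + 1. (-1 :: rat) ^ k) = 1" for N by (induction N) auto
  from this[of n] have "(\<Sum>k<p. (-1 :: rat) ^ k) = 1" by (simp only: p_eq)
  hence "alt_choose_sum p 0 = 1" by (simp add: alt_choose_sum_def)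
  thus ?case by simp
next
  case (Suc j)
  have "p_unit (of_nat i)" if "0 < i" "i \<le> 2 * j + 1" for i
    using that Suc.prems by (intro p_unit_of_nat_less less_pI) auto
  from this[of "2 * j + 1"] this[of "j + 1"]
  have u: "p_unit (of_nat (2 * j + 1))" "p_unit (of_nat (j + 1))" by simp_all
  have u8: "p_unit (8 * of_nat (j + 1))"
    using p_unit_mult[OF p_unit_power[OF p_unit_2, of 3] u(2)] by simp
  have IH: "rat_cong p 2 (alt_choose_sum p j) (of_nat ((2 * j) choose j) / 16 ^ j)"
    using Suc by simp
  \<comment> \<open>For j = 0 the factor p comes from p - j, otherwise from the binomial coefficient.\<close>
  have wz: "rat_cong p 2 (wz_cert j p) 0"
  proof -
    obtain c where c: "p_integral c" "(of_nat p - of_nat j) * of_nat ((p + j) choose (2 * j)) = of_nat p * c"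
    proof (cases "j = 0")
      case True
      show ?thesis by (rule that[of 1]) (simp_all add: True)
    next
      case False
      then obtain d where "(p + j) choose (2 * j) = p * d"
        using prime_dvd_choose_shift[of j] less_pI[of "2 * j"] Suc.prems by (auto elim: dvdE)
      thus ?thesis by (intro that[of "(of_nat p - of_nat j) * of_nat d"]) (auto simp: algebra_simps)
    qed
    have "wz_cert j p = of_nat p ^ 2 * (- ((-1) ^ p * (of_nat p ^ 2 - of_nat (j + 1) * of_nat (3 * j + 2)) * c ^ 2
        / (of_nat (2 * j + 1) ^ 2 * of_nat (j + 1))))"
      unfolding wz_cert_def using arg_cong[OF c(2), of "\<lambda>t. t ^ 2"] by (simp add: power_mult_distrib mult_ac)
    moreover have "p_integral (- ((-1) ^ p * (of_nat p ^ 2 - of_nat (j + 1) * of_nat (3 * j + 2)) * c ^ 2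
        / (of_nat (2 * j + 1) ^ 2 * of_nat (j + 1))))"
      by (intro p_integral_uminus p_integral_divide p_integral_mult p_integral_power p_integral_diff
          p_integral_of_nat c p_unit_mult p_unit_power u) auto
    ultimately show ?thesis using rat_cong_0I by metis
  qed
  have "rat_cong p 2 (8 * of_nat (j + 1) * alt_choose_sum p (Suc j)) (of_nat (2 * j + 1) * (of_nat ((2 * j) choose j) / 16 ^ j) + 0)"
  proof -
    have eq: "8 * of_nat (j + 1) * alt_choose_sum p (Suc j) = of_nat (2 * j + 1) * alt_choose_sum p j + wz_cert j p"
      using alt_choose_sum_step[of j p] by simp
    show ?thesis unfolding eq by (intro rat_cong_add rat_cong_scale IH wz p_integral_of_nat)
  qed
  also have "of_nat (2 * j + 1) * (of_nat ((2 * j) choose j) / 16 ^ j) + 0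
      = 8 * of_nat (j + 1) * (rat_of_nat ((2 * Suc j) choose Suc j) / 16 ^ Suc j)"
  proof -
    have step: "8 * of_nat (j + 1) * (X / 16 ^ Suc j) = of_nat (Suc j) * X / (2 * 16 ^ j)" for X :: rat
      by (simp add: field_simps)
    show ?thesis unfolding step central_binomial_Suc by (simp add: field_simps)
  qed
  finally show ?case by (rule rat_cong_cancel[OF u8])
qed

lemma central_binomial_divisible:
  assumes "n < j" "j < p" shows "p dvd ((2 * j) choose j)"
proof -
  have "fact j * fact j * ((2 * j) choose j) = (fact (2 * j) :: nat)"
    using binomial_fact_lemma[of j "2 * j"] by simp
  moreover have "p dvd (fact (2 * j) :: nat)" using assms p_eq prime_p by (simp add: prime_dvd_fact_iff)
  ultimately have "p dvd fact j * fact j * ((2 * j) choose j)" by simp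
  thus ?thesis using assms prime_p by (simp add: prime_dvd_mult_iff prime_dvd_fact_iff)
qed

text \<open>
  The ratio of consecutive values of \<open>C(n,k) C(n+k,k)\<close> is \<open>(p\<^sup>2 - (2k+1)\<^sup>2)/(4(k+1)\<^sup>2)\<close>, which is even in \<open>p\<close>;
  dropping \<open>p\<^sup>2\<close> leaves the ratio for \<open>C(2k,k)\<^sup>2/(-16)\<^sup>k\<close>.
\<close>

lemma legendre_coeff_cong:
  "k \<le> n \<Longrightarrow> rat_cong p 2 (legendre_coeff n k) ((-1) ^ k * of_nat ((2 * k) choose k) ^ 2 / 16 ^ k)"
proof (induction k)
  case 0 show ?case by (simp add: legendre_coeff_def)
next
  case (Suc k)
  have u: "p_unit (4 * of_nat (Suc k) ^ 2)"
    using Suc.prems less_pI[of "Suc k"] p_unit_mult[OF p_unit_power[OF p_unit_2, of 2] p_unit_power[OF p_unit_of_nat_less[of "Suc k"], of 2]]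
    by simp
  let ?v = "\<lambda>k. (-1) ^ k * rat_of_nat ((2 * k) choose k) ^ 2 / 16 ^ k"
  have "4 * of_nat (Suc k) ^ 2 * legendre_coeff n (Suc k)
      = (of_nat p ^ 2 - of_nat (2 * k + 1) ^ 2) * legendre_coeff n k"
    using legendre_coeff_Suc[of k n] by (simp add: p_eq power2_eq_square algebra_simps)
  also have "\<dots> = of_nat p ^ 2 * legendre_coeff n k + (- (of_nat (2 * k + 1) ^ 2)) * legendre_coeff n k"
    by (simp add: algebra_simps)
  also have "rat_cong p 2 \<dots> (0 + (- (of_nat (2 * k + 1) ^ 2)) * ?v k)"
    using Suc by (intro rat_cong_add rat_cong_0I rat_cong_scale p_integral_uminus p_integral_power p_integral_of_nat)
      (auto simp: legendre_coeff_def)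
  also have "0 + (- (of_nat (2 * k + 1) ^ 2)) * ?v k = 4 * of_nat (Suc k) ^ 2 * ?v (Suc k)"
  proof -
    have "4 * of_nat (Suc k) ^ 2 * ?v (Suc k)
       = - ((-1) ^ k * (of_nat (Suc k) * of_nat ((2 * Suc k) choose Suc k)) ^ 2 / (4 * 16 ^ k))"
      by (simp add: power_mult_distrib)
    moreover have "0 + (- (r ^ 2)) * (s * c ^ 2 / t) = - (s * (2 * r * c) ^ 2 / (4 * t))" for r s c t :: rat
      by (simp add: power_mult_distrib)
    ultimately show ?thesis unfolding central_binomial_Suc by (simp only:)
  qed
  finally show ?case by (rule rat_cong_cancel[OF u])
qed

lemma apery_poly_alt:
  "apery_poly k x = (\<Sum>j\<le>k. of_nat ((2 * j) choose j) ^ 2 * x ^ j * of_nat ((k + j) choose (2 * j)) ^ 2)"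
proof -
  have "(k choose j) * ((k + j) choose j) = ((2 * j) choose j) * ((k + j) choose (2 * j))" if "j \<le> k" for j
    using choose_mult[of j "2 * j" "k + j"] that by (simp add: mult.commute)
  hence "rat_of_nat (k choose j) ^ 2 * of_nat ((k + j) choose j) ^ 2 = of_nat ((2 * j) choose j) ^ 2 * of_nat ((k + j) choose (2 * j)) ^ 2"
    if "j \<le> k" for j
    using that by (metis of_nat_mult power_mult_distrib)
  thus ?thesis unfolding apery_poly_def atLeast0AtMost by (intro sum.cong) (auto simp: mult_ac)
qed

lemma alternating_apery_sum:
  "(\<Sum>k=0..N-1. (-1) ^ k * apery_poly k x) = (\<Sum>j<N. of_nat ((2 * j) choose j) ^ 2 * x ^ j * alt_choose_sum N j)"
  if "N > 0"
proof -
  have "{0..N-1} = {..<N}" using that by auto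
  hence "(\<Sum>k=0..N-1. (-1) ^ k * apery_poly k x)
      = (\<Sum>k<N. \<Sum>j\<le>k. (-1) ^ k * (of_nat ((2 * j) choose j) ^ 2 * x ^ j * of_nat ((k + j) choose (2 * j)) ^ 2))"
    unfolding apery_poly_alt sum_distrib_left by simp
  also have "\<dots> = (\<Sum>k<N. \<Sum>j<N. (-1) ^ k * (of_nat ((2 * j) choose j) ^ 2 * x ^ j * of_nat ((k + j) choose (2 * j)) ^ 2))"
    by (intro sum.cong refl sum.mono_neutral_left) (auto simp: binomial_eq_0)
  also have "\<dots> = (\<Sum>j<N. of_nat ((2 * j) choose j) ^ 2 * x ^ j * alt_choose_sum N j)"
    by (subst sum.swap) (simp add: alt_choose_sum_def sum_distrib_left mult_ac)
  finally show ?thesis .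
qed

text \<open>
  The terms with \<open>j > n\<close> vanish because \<open>p\<close> divides \<open>C(2j,j)\<close>; the others are transformed one by one into
  those of Clausen's formula.
\<close>

lemma alternating_apery_sum_cong:
  assumes x: "p_integral x" and z: "z * (1 + z) = - x"
  shows "rat_cong p 2 (\<Sum>k=0..p-1. (-1) ^ k * apery_poly k x) (legendre_sum n z ^ 2)"
proof -
  let ?c = "\<lambda>j. rat_of_nat ((2 * j) choose j)"
  have split: "{..<p} = {..n} \<union> {n<..<p}" using p_eq by auto
  have "(\<Sum>k=0..p-1. (-1) ^ k * apery_poly k x)
    = (\<Sum>j\<le>n. ?c j ^ 2 * x ^ j * alt_choose_sum p j) + (\<Sum>j\<in>{n<..<p}. ?c j ^ 2 * (x ^ j * alt_choose_sum p j))"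
    unfolding alternating_apery_sum[OF p_pos] split by (subst sum.union_disjoint) (auto simp: mult_ac)
  also have "rat_cong p 2 \<dots> ((\<Sum>j\<le>n. legendre_coeff n j * ?c j * (z * (1 + z)) ^ j) + (\<Sum>j\<in>{n<..<p}. 0))"
  proof (intro rat_cong_add rat_cong_sum)
    fix j assume "j \<in> {..n}"
    hence j: "j \<le> n" by simp
    have "rat_cong p 2 (?c j ^ 2 * x ^ j * alt_choose_sum p j) (?c j ^ 2 * x ^ j * (?c j / 16 ^ j))"
      using x by (intro rat_cong_scale alt_choose_sum_cong j p_integral_mult p_integral_power) auto
    also have "?c j ^ 2 * x ^ j * (?c j / 16 ^ j) = ?c j * (z * (1 + z)) ^ j * ((-1) ^ j * ?c j ^ 2 / 16 ^ j)"
      unfolding z by (simp add: power_minus' power2_eq_square)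
    also have "rat_cong p 2 \<dots> (?c j * (z * (1 + z)) ^ j * legendre_coeff n j)"
      unfolding z using x by (intro rat_cong_scale rat_cong_sym[OF legendre_coeff_cong] j p_integral_mult p_integral_power p_integral_uminus) auto
    finally show "rat_cong p 2 (?c j ^ 2 * x ^ j * alt_choose_sum p j) (legendre_coeff n j * ?c j * (z * (1 + z)) ^ j)"
      by (simp add: mult_ac)
  next
    fix j assume "j \<in> {n<..<p}"
    then obtain d where "(2 * j) choose j = p * d"
      using central_binomial_divisible[of j] by (auto elim: dvdE)
    hence "?c j ^ 2 * (x ^ j * alt_choose_sum p j) = of_nat p ^ 2 * (of_nat d ^ 2 * (x ^ j * alt_choose_sum p j))"
      by (simp add: power_mult_distrib)
    moreover have "p_integral (of_nat d ^ 2 * (x ^ j * alt_choose_sum p j))"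
      unfolding alt_choose_sum_def using x by (intro p_integral_mult p_integral_power p_integral_sum) (auto simp: p_integral_uminus)
    ultimately show "rat_cong p 2 (?c j ^ 2 * (x ^ j * alt_choose_sum p j)) 0"
      using rat_cong_0I by metis
  qed
  finally show ?thesis unfolding clausen_legendre by (simp add: mult_ac)
qed

end

section \<open>The two Legendre sums modulo the square of the prime\<close>

definition rat_harm :: "nat \<Rightarrow> rat" where
  "rat_harm k = (\<Sum>i\<in>{1..k}. 1 / of_nat i)"

definition quarter_harm :: "nat \<Rightarrow> rat" where
  "quarter_harm m = (\<Sum>k\<in>{m+1..2*m}. 1 / of_nat k)"

context prime_modulus
begin

lemma p_unit_one_plus_p:
  assumes "p_integral x" shows "p_unit (1 + of_nat p * x)"
proof -
  obtain a b where ab: "\<not> int p dvd b" "x = of_int a / of_int b"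
    using assms unfolding p_integral_def by blast
  have b0: "b \<noteq> 0" using ab by auto
  have "\<not> int p dvd b + int p * a" using ab(1) by (simp add: dvd_add_left_iff)
  hence "p_unit (of_int (b + int p * a))" by (rule p_unit_of_int)
  hence "p_unit (of_int (b + int p * a) * (1 / of_int b))"
    by (rule p_unit_mult[OF _ p_unit_inverse[OF p_unit_of_int[OF ab(1)]]])
  moreover have "of_int (b + int p * a) * (1 / of_int b) = 1 + of_nat p * x"
    using b0 ab(2) by (simp add: field_simps)
  ultimately show ?thesis by simp
qed

lemma rat_cong_prod:
  "(\<And>i. i \<in> A \<Longrightarrow> rat_cong p m (f i) (g i)) \<Longrightarrow> (\<And>i. i \<in> A \<Longrightarrow> p_integral (f i)) \<Longrightarrow>
    rat_cong p m (prod f A) (prod g A)"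
proof (induction A rule: infinite_finite_induct)
  case (insert x A)
  have "p_integral (prod f A)" using insert by (intro p_integral_prod) auto
  hence "p_integral (prod g A)" using insert rat_cong_integral[of m "prod f A" "prod g A"] by auto
  thus ?case using insert by (simp add: rat_cong_mult)
qed simp_all

lemma rat_cong_inverse:
  assumes "rat_cong p m a b" "p_unit a" "p_unit b"
  shows "rat_cong p m (1 / a) (1 / b)"
proof -
  have "rat_cong p m (b / (a * b)) (a / (a * b))"
    using assms by (intro rat_cong_divide p_unit_mult rat_cong_sym[OF assms(1)])
  thus ?thesis using assms(2,3) by (simp add: p_unit_def)
qed

lemma one_plus_p_mult:
  assumes "p_integral x" "p_integral y"
  shows "rat_cong p 2 ((1 + of_nat p * x) * (1 + of_nat p * y)) (1 + of_nat p * (x + y))"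
proof -
  have "(1 + of_nat p * x) * (1 + of_nat p * y) = 1 + of_nat p * (x + y) + of_nat p ^ 2 * (x * y)"
    by (simp add: algebra_simps power2_eq_square)
  also have "rat_cong p 2 \<dots> (1 + of_nat p * (x + y) + 0)"
    using assms by (intro rat_cong_add rat_cong_refl rat_cong_0I) auto
  finally show ?thesis by simp
qed

lemma inverse_one_plus_p:
  assumes "p_integral x" "rat_cong p 2 a (1 + of_nat p * x)" "p_unit a"
  shows "rat_cong p 2 (1 / a) (1 - of_nat p * x)"
proof -
  have "rat_cong p 2 (a * (1 - of_nat p * x)) ((1 + of_nat p * x) * (1 - of_nat p * x))"
    using assms by (intro rat_cong_mult) (auto simp: p_unit_imp_integral)
  also have "rat_cong p 2 \<dots> 1"
    using one_plus_p_mult[of x "- x"] assms(1) by auto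
  finally have "rat_cong p 2 (a * (1 - of_nat p * x) / a) (1 / a)"
    by (intro rat_cong_divide assms)
  thus ?thesis using assms(3) rat_cong_sym by (simp add: p_unit_def)
qed

lemma p_integral_inverse_less: "0 < i \<Longrightarrow> i < p \<Longrightarrow> p_integral (1 / of_nat i)"
  using p_unit_of_nat_less by (simp add: p_unit_def)

lemma p_integral_harm: "k < p \<Longrightarrow> p_integral (rat_harm k)"
  unfolding rat_harm_def by (intro p_integral_sum p_integral_inverse_less) auto

text \<open>
  Applied with \<open>c = 1\<close> and \<open>c = -1\<close> to the two perturbed hypergeometric sums, and with
  \<open>c = -1/2\<close> to a product formula for \<open>2\<^bsup>p-1\<^esup>\<close>.
\<close>

lemma inverse_prod_harm:
  assumes "k < p" "p_integral c"
  shows "rat_cong p 2 (1 / (\<Prod>i\<in>{1..k}. 1 + of_nat p * (c / of_nat i))) (1 - of_nat p * (c * rat_harm k))"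
proof (rule inverse_one_plus_p)
  have int: "p_integral (c / of_nat i)" if "i \<in> {1..k}" for i
    using assms that by (intro p_integral_divide p_unit_of_nat_less) auto
  show "p_integral (c * rat_harm k)" using assms p_integral_harm by blast
  have "c * rat_harm k = (\<Sum>i\<in>{1..k}. c / of_nat i)" by (simp add: rat_harm_def sum_distrib_left)
  thus "rat_cong p 2 (\<Prod>i\<in>{1..k}. 1 + of_nat p * (c / of_nat i)) (1 + of_nat p * (c * rat_harm k))"
    using prod_one_plus_p[of "{1..k}" "\<lambda>i. c / of_nat i"] int by simp
  show "p_unit (\<Prod>i\<in>{1..k}. 1 + of_nat p * (c / of_nat i))"
    using int by (intro p_unit_prod p_unit_one_plus_p)
qed

end

lemma rat_harm_Suc: "rat_harm (Suc k) = rat_harm k + 1 / of_nat (Suc k)"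
  by (simp add: rat_harm_def)

lemma odd_harmonic_sum:
  "(\<Sum>j\<in>{1..m}. - 1 / rat_of_nat (2 * j - 1)) = rat_harm m / 2 - rat_harm (2 * m)"
proof (induction m)
  case 0 show ?case by (simp add: rat_harm_def)
next
  case (Suc m)
  define x y where "x = 1 / rat_of_nat (Suc (2 * m))" and "y = 1 / rat_of_nat (Suc m)"
  have "(\<Sum>j\<in>{1..Suc m}. - 1 / rat_of_nat (2 * j - 1)) = (\<Sum>j\<in>{1..m}. - 1 / rat_of_nat (2 * j - 1)) - x"
    by (simp add: x_def)
  also have "\<dots> = (rat_harm m + y) / 2 - (rat_harm (2 * m) + x + y / 2)"
    unfolding Suc.IH by (simp add: field_simps)
  also have "rat_harm m + y = rat_harm (Suc m)"
    by (simp only: rat_harm_Suc y_def)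
  also have "y / 2 = 1 / of_nat (Suc (Suc (2 * m)))"
    by (simp add: y_def field_simps)
  also have "rat_harm (2 * m) + x + 1 / of_nat (Suc (Suc (2 * m))) = rat_harm (2 * Suc m)"
    by (simp only: rat_harm_Suc x_def mult_Suc_right add_2_eq_Suc)
  finally show ?case .
qed

text \<open>
  The factor by which replacing \<open>c = 1\<close> by \<open>c = 1 + N\<close> changes the \<open>k\<close>-th term of a hypergeometric sum; the
  next lemma is the same for \<open>c = 1 - (N + 1)\<close>.
\<close>

lemma fact_ratio_plus:
  "(fact k * fact N / fact (N + k) :: rat) = 1 / (\<Prod>i\<in>{1..k}. 1 + of_nat N * (1 / of_nat i))"
proof (induction k)
  case (Suc k)
  have "fact (Suc k) * fact N / fact (N + Suc k)
      = (fact k * fact N / fact (N + k)) * (of_nat (Suc k) / of_nat (N + Suc k) :: rat)"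
    by (simp add: mult_ac)
  also have "of_nat (Suc k) / of_nat (N + Suc k) = (1 / (1 + of_nat N * (1 / of_nat (Suc k))) :: rat)"
    by (simp add: field_simps)
  finally show ?case unfolding Suc.IH by (simp add: prod.nat_ivl_Suc')
qed simp

lemma fact_ratio_minus:
  "k \<le> N \<Longrightarrow> ((-1) ^ k * fact k * fact (N - k) / fact N :: rat) = 1 / (\<Prod>i\<in>{1..k}. 1 + of_nat (N + 1) * (- 1 / of_nat i))"
proof (induction k)
  case (Suc k)
  have "fact (N - k) = of_nat (N - k) * (fact (N - Suc k) :: rat)"
    using Suc.prems by (metis Suc_diff_Suc Suc_le_lessD fact_Suc of_nat_fact of_nat_mult)
  hence "(-1) ^ Suc k * fact (Suc k) * fact (N - Suc k) / fact N
      = ((-1) ^ k * fact k * fact (N - k) / fact N) * (- (of_nat (Suc k) / of_nat (N - k)) :: rat)"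
    using Suc.prems by simp
  also have "- (of_nat (Suc k) / of_nat (N - k)) = (1 / (1 + of_nat (N + 1) * (- 1 / of_nat (Suc k))) :: rat)"
    using Suc.prems by (simp add: of_nat_diff field_simps)
  finally show ?case using Suc by (simp add: prod.nat_ivl_Suc')
qed simp

lemma symmetric_progression_prod:
  fixes a :: rat
  shows "(\<Prod>i\<le>2*m. a - of_nat (2 * m) + of_nat (2 * i)) = a * (\<Prod>i\<in>{1..m}. a ^ 2 - of_nat (2 * i) ^ 2)"
proof (induction m)
  case (Suc m)
  have "(\<Prod>i\<le>2 * Suc m. a - of_nat (2 * Suc m) + of_nat (2 * i))
     = (\<Prod>i\<le>Suc (Suc (2 * m)). a - of_nat (2 * Suc m) + of_nat (2 * i))" by simp
  also have "\<dots> = (a - of_nat (2 * Suc m)) * (\<Prod>i\<le>2*m. a - of_nat (2 * Suc m) + of_nat (2 * Suc i)) * (a + of_nat (2 * Suc m))"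
  proof -
    have "a - of_nat (2 * Suc m) + of_nat (2 * Suc (Suc (2 * m))) = a + of_nat (2 * Suc m)"
      by (simp add: algebra_simps)
    thus ?thesis unfolding prod.atMost_Suc[of _ "Suc (2 * m)"] unfolding prod.atMost_Suc_shift by simp
  qed
  also have "(\<Prod>i\<le>2*m. a - of_nat (2 * Suc m) + of_nat (2 * Suc i)) = (\<Prod>i\<le>2*m. a - of_nat (2 * m) + of_nat (2 * i))"
    by (intro prod.cong) auto
  finally show ?case unfolding Suc.IH by (simp add: prod.nat_ivl_Suc' power2_eq_square algebra_simps)
qed simp

context odd_prime_modulus
begin

text \<open>
  Perturbing the lower parameter from \<open>1\<close> to \<open>1 + p\<close> divides the \<open>k\<close>-th term by \<open>\<Prod>\<^bsub>i\<le>k\<^esub> (1 + p/i)\<close>, hence changes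
  the sum by a first-order term with harmonic numbers.
\<close>

lemma kummer_plus_cong:
  "rat_cong p 2 (fact (2 * n + 1) * 2 ^ n / (fact n * (\<Prod>i\<le>n. of_nat (n + 1 + 2 * i))))
     (legendre_sum n 1 - of_nat p * (\<Sum>k\<le>n. legendre_coeff n k * rat_harm k))"
proof -
  have summand: "of_nat (n choose k) * (fact (n + k) * fact (2 * n + 1)) / (fact n * fact (2 * n + 1 + k))
     = legendre_coeff n k * (1 / (\<Prod>i\<in>{1..k}. 1 + of_nat p * (1 / of_nat i)))" for k
  proof -
    have "of_nat ((n + k) choose k) = (fact (n + k) / (fact k * fact n) :: rat)"
      by (simp add: binomial_fact)
    hence "of_nat (n choose k) * (fact (n + k) * A) / (fact n * B) = legendre_coeff n k * (fact k * A / B)" for A B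
      by (simp add: legendre_coeff_def)
    from this[of "fact (2 * n + 1)" "fact (2 * n + 1 + k)"] show ?thesis
      using fact_ratio_plus[of k "2 * n + 1"] by (simp only: p_eq)
  qed
  have "rat_cong p 2 (\<Sum>k\<le>n. legendre_coeff n k * (1 / (\<Prod>i\<in>{1..k}. 1 + of_nat p * (1 / of_nat i))))
      (\<Sum>k\<le>n. legendre_coeff n k * (1 - of_nat p * (1 * rat_harm k)))"
    by (intro rat_cong_sum rat_cong_scale inverse_prod_harm less_pI) (auto simp: legendre_coeff_def)
  thus ?thesis unfolding kummer_sum_plus[symmetric] summand
    by (simp add: legendre_sum_def sum_distrib_left right_diff_distrib sum_subtractf mult_ac)
qed

text \<open>
  The perturbation to \<open>1 - p\<close> has the opposite first-order term.
\<close>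

lemma kummer_minus_cong:
  "rat_cong p 2 (if even n then of_nat ((n + n div 2) choose n) / of_nat ((2 * n) choose n) else 0)
     (legendre_sum n 1 + of_nat p * (\<Sum>k\<le>n. legendre_coeff n k * rat_harm k))"
proof -
  have summand: "of_nat (n choose k) * (-1) ^ k * (fact (n + k) * fact (2 * n - k)) / (fact n * fact (2 * n))
     = legendre_coeff n k * (1 / (\<Prod>i\<in>{1..k}. 1 + of_nat p * (- 1 / of_nat i)))" if "k \<le> n" for k
  proof -
    have "of_nat ((n + k) choose k) = (fact (n + k) / (fact k * fact n) :: rat)"
      by (simp add: binomial_fact)
    hence "of_nat (n choose k) * (-1) ^ k * (fact (n + k) * A) / (fact n * B) = legendre_coeff n k * ((-1) ^ k * fact k * A / B)" for A B
      by (simp add: legendre_coeff_def)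
    moreover have "k \<le> 2 * n" using that by simp
    ultimately show ?thesis using fact_ratio_minus[of k "2 * n"] by (simp only: p_eq)
  qed
  have "rat_cong p 2 (\<Sum>k\<le>n. legendre_coeff n k * (1 / (\<Prod>i\<in>{1..k}. 1 + of_nat p * (- 1 / of_nat i))))
      (\<Sum>k\<le>n. legendre_coeff n k * (1 - of_nat p * (- 1 * rat_harm k)))"
    by (intro rat_cong_sum rat_cong_scale inverse_prod_harm less_pI) (auto simp: legendre_coeff_def)
  also have "(\<Sum>k\<le>n. legendre_coeff n k * (1 / (\<Prod>i\<in>{1..k}. 1 + of_nat p * (- 1 / of_nat i))))
      = (\<Sum>k\<le>n. of_nat (n choose k) * (-1) ^ k * (fact (n + k) * fact (2 * n - k)) / (fact n * fact (2 * n)))"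
    using summand by (intro sum.cong) auto
  finally show ?thesis unfolding kummer_sum_minus
    by (simp add: legendre_sum_def sum_distrib_left distrib_left sum.distrib mult_ac)
qed

lemma p_integral_legendre_sum_1: "p_integral (legendre_sum n 1)"
  unfolding legendre_sum_def legendre_coeff_def by (intro p_integral_sum) auto

text \<open>
  \<open>(D - p V)(D + p V)\<close> and \<open>D\<^sup>2\<close> agree modulo \<open>p\<^sup>2\<close>, so \<open>V\<close> need not be evaluated.
\<close>

lemma legendre_sum_1_square_cong:
  "rat_cong p 2 (legendre_sum n 1 ^ 2)
    (fact (2 * n + 1) * 2 ^ n / (fact n * (\<Prod>i\<le>n. of_nat (n + 1 + 2 * i))) *
     (if even n then of_nat ((n + n div 2) choose n) / of_nat ((2 * n) choose n) else 0))"
proof -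
  define V where "V = (\<Sum>k\<le>n. legendre_coeff n k * rat_harm k)"
  have V: "p_integral V" unfolding V_def
    by (intro p_integral_sum p_integral_mult p_integral_harm less_pI) (auto simp: legendre_coeff_def)
  let ?D = "legendre_sum n 1"
  note D = p_integral_legendre_sum_1
  have "?D ^ 2 = (?D - of_nat p * V) * (?D + of_nat p * V) + of_nat p ^ 2 * (V ^ 2)"
    by (simp add: algebra_simps power2_eq_square)
  also have "rat_cong p 2 \<dots> ((?D - of_nat p * V) * (?D + of_nat p * V) + 0)"
    using V by (intro rat_cong_add rat_cong_0I rat_cong_refl) auto
  also have "(?D - of_nat p * V) * (?D + of_nat p * V) + 0 = (?D - of_nat p * V) * (?D + of_nat p * V)" by simp
  also have "rat_cong p 2 \<dots> (fact (2 * n + 1) * 2 ^ n / (fact n * (\<Prod>i\<le>n. of_nat (n + 1 + 2 * i))) *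
     (if even n then of_nat ((n + n div 2) choose n) / of_nat ((2 * n) choose n) else 0))"
  proof (rule rat_cong_mult)
    have int: "p_integral (?D + of_nat p * V)" using D V by blast
    show "rat_cong p 2 (?D - of_nat p * V) (fact (2 * n + 1) * 2 ^ n / (fact n * (\<Prod>i\<le>n. of_nat (n + 1 + 2 * i))))"
      using rat_cong_sym[OF kummer_plus_cong] unfolding V_def .
    show *: "rat_cong p 2 (?D + of_nat p * V) (if even n then of_nat ((n + n div 2) choose n) / of_nat ((2 * n) choose n) else 0)"
      using rat_cong_sym[OF kummer_minus_cong] unfolding V_def .
    show "p_integral (?D - of_nat p * V)" using D V by blast
    show "p_integral (if even n then of_nat ((n + n div 2) choose n) / of_nat ((2 * n) choose n) else 0)"
      by (rule rat_cong_integral[OF * int])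
  qed
  finally show ?thesis .
qed

text \<open>
  For \<open>p = 4m + 1 = x\<^sup>2 + y\<^sup>2\<close> with \<open>x\<close> odd this is the residue class of both sums of Apery polynomials, and of
  the square of the \<open>p\<close>-adic unit root of \<open>T\<^sup>2 - 2x T + p\<close>.
\<close>

definition common_residue :: "nat \<Rightarrow> rat" where
  "common_residue m = of_nat ((2 * m) choose m) ^ 2 * (1 - of_nat p * quarter_harm m)"

lemma p_integral_quarter_harm: "n = 2 * m \<Longrightarrow> p_integral (quarter_harm m)"
  unfolding quarter_harm_def by (intro p_integral_sum p_integral_inverse_less less_pI) auto

text \<open>
  The last \<open>m\<close> factors of \<open>(3m)!\<close> are \<open>p - k\<close> for \<open>m < k \<le> 2m\<close>.
\<close>

lemma fact_3m_cong:
  assumes n: "n = 2 * m"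
  shows "rat_cong p 2 (fact (3 * m)) ((-1) ^ m * (fact (2 * m) ^ 2 / fact m) * (1 - of_nat p * quarter_harm m))"
proof -
  have lt: "k < p" if "k \<le> 4 * m" for k using that n p_eq by simp
  have split: "fact (N + m) = fact N * (\<Prod>k\<in>{N+1..N+m}. of_nat k :: rat)" for N
    by (induction m) (simp_all add: prod.nat_ivl_Suc')
  have a: "fact (3 * m) = fact (2 * m) * (\<Prod>k\<in>{2*m+1..2*m+m}. of_nat k :: rat)"
    using split[of "2 * m"] by (simp add: mult.commute)
  have b: "fact (2 * m) = fact m * (\<Prod>k\<in>{m+1..2*m}. of_nat k :: rat)"
    using split[of m] by (simp add: mult_2)
  have "(\<Prod>k\<in>{2*m+1..2*m+m}. of_nat k :: rat) = (\<Prod>k\<in>{m+1..2*m}. - of_nat k * (1 + of_nat p * (- 1 / of_nat k)))"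
    by (rule prod.reindex_bij_witness[of _ "\<lambda>k. p - k" "\<lambda>k. p - k"]) (auto simp: p_eq n of_nat_diff field_simps)
  also have "\<dots> = (-1) ^ m * (\<Prod>k\<in>{m+1..2*m}. of_nat k) * (\<Prod>k\<in>{m+1..2*m}. 1 + of_nat p * (- 1 / of_nat k))"
    by (simp add: prod.distrib prod_uminus)
  finally have eq: "fact (3 * m) = (-1) ^ m * (fact (2 * m) ^ 2 / fact m) * (\<Prod>k\<in>{m+1..2*m}. 1 + of_nat p * (- 1 / of_nat k) :: rat)"
    unfolding a using b by (simp add: power2_eq_square)
  have cong: "rat_cong p 2 (\<Prod>k\<in>{m+1..2*m}. 1 + of_nat p * (- 1 / of_nat k)) (1 + of_nat p * (\<Sum>k\<in>{m+1..2*m}. - 1 / of_nat k))"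
    by (intro prod_one_plus_p) (auto simp: minus_divide_left[symmetric] intro!: p_integral_uminus p_integral_inverse_less lt)
  have one: "1 + of_nat p * (\<Sum>k\<in>{m+1..2*m}. - 1 / of_nat k) = 1 - of_nat p * quarter_harm m"
    by (simp add: quarter_harm_def sum_negf)
  have int: "p_integral ((-1) ^ m * (fact (2 * m) ^ 2 / fact m))"
    by (intro p_integral_mult p_integral_power p_integral_divide p_integral_uminus p_unit_fact p_unit_imp_integral[OF p_unit_fact] lt) auto
  show ?thesis unfolding eq by (rule rat_cong_scale[OF int cong[unfolded one]])
qed

text \<open>
  The product of the two Kummer sums is \<open>(3m)! 4\<^sup>m / (m! Q)\<close>, where \<open>Q = \<Prod>\<^bsub>i\<le>m\<^esub> (p\<^sup>2 - (2i)\<^sup>2)\<close> comes from the odd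
  numbers symmetric about \<open>p\<close>; the factor \<open>p\<close> itself cancels.
\<close>

lemma legendre_sum_1_common_residue:
  assumes n: "n = 2 * m"
  shows "rat_cong p 2 (legendre_sum n 1 ^ 2) (common_residue m)"
proof -
  have lt: "k < p" if "k \<le> 4 * m" for k using that n p_eq by simp
  define Q where "Q = (\<Prod>i\<in>{1..m}. rat_of_nat p ^ 2 - of_nat (2 * i) ^ 2)"
  define R where "R = (\<Prod>i\<in>{1..m}. - (rat_of_nat (2 * i) ^ 2))"
  have R: "R = (-1) ^ m * 2 ^ n * fact m ^ 2"
    unfolding R_def n by (induction m) (simp_all add: prod.nat_ivl_Suc' power2_eq_square algebra_simps)
  have R_unit: "p_unit R"
    unfolding R_def
  proof (rule p_unit_prod)
    fix i assume "i \<in> {1..m}"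
    hence "p_unit (of_nat (2 * i))" by (intro p_unit_of_nat_less lt) auto
    hence "p_unit (of_int (-1) * of_nat (2 * i) ^ 2)"
      using p_gt_1 by (intro p_unit_mult p_unit_power p_unit_of_int) (auto simp: zdvd1_eq)
    thus "p_unit (- (rat_of_nat (2 * i) ^ 2))" by simp
  qed
  have QR: "rat_cong p 2 Q R"
    unfolding Q_def R_def
  proof (intro rat_cong_prod)
    fix i
    have "rat_cong p 2 (of_nat p ^ 2 * 1 - of_nat (2 * i) ^ 2) (0 - of_nat (2 * i) ^ 2)"
      by (intro rat_cong_diff rat_cong_0I rat_cong_refl) auto
    thus "rat_cong p 2 (of_nat p ^ 2 - of_nat (2 * i) ^ 2) (- (of_nat (2 * i) ^ 2))" by simp
  qed auto
  obtain c where c: "p_integral c" "Q = R + of_nat p ^ 2 * c" using rat_cong_D[OF QR] .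
  have Q_unit: "p_unit Q"
  proof -
    have "Q = R * (1 + of_nat p * (of_nat p * c / R))"
      using c R_unit by (simp add: p_unit_def field_simps power2_eq_square)
    moreover have "p_unit (1 + of_nat p * (of_nat p * c / R))"
      using c R_unit by (intro p_unit_one_plus_p) auto
    ultimately show ?thesis using R_unit by (metis p_unit_mult)
  qed
  have prod: "(\<Prod>i\<le>n. rat_of_nat (n + 1 + 2 * i)) = of_nat p * Q"
    using symmetric_progression_prod[of "of_nat p" m] unfolding Q_def
    by (simp add: n p_eq add_ac)
  have nz: "Q \<noteq> 0" "rat_of_nat p \<noteq> 0" using Q_unit p_pos by (auto simp: p_unit_def)
  have f: "(fact (2 * n + 1) :: rat) = of_nat p * fact (2 * n)" by (simp add: p_eq)
  have ch: "rat_of_nat ((n + n div 2) choose n) / of_nat ((2 * n) choose n) = fact (3 * m) * fact n / (fact m * fact (2 * n))"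
    using n by (simp add: binomial_fact field_simps)
  have "fact (2 * n + 1) * 2 ^ n / (fact n * (of_nat p * Q)) * (fact (3 * m) * fact n / (fact m * fact (2 * n)))
      = fact (3 * m) * (2 ^ n / fact m) * (1 / Q)"
    unfolding f using nz by (simp add: mult_ac)
  hence "fact (2 * n + 1) * 2 ^ n / (fact n * (\<Prod>i\<le>n. of_nat (n + 1 + 2 * i))) *
     (if even n then of_nat ((n + n div 2) choose n) / of_nat ((2 * n) choose n) else 0)
      = fact (3 * m) * (2 ^ n / fact m) * (1 / Q)"
    unfolding prod ch using n by simp
  hence "rat_cong p 2 (legendre_sum n 1 ^ 2) (fact (3 * m) * (2 ^ n / fact m) * (1 / Q))"
    using legendre_sum_1_square_cong by simp
  also have "rat_cong p 2 \<dots> ((-1) ^ m * (fact (2 * m) ^ 2 / fact m) * (1 - of_nat p * quarter_harm m) * (2 ^ n / fact m) * (1 / R))"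
  proof -
    have u: "p_unit (fact m)" "p_unit (fact (3 * m))" by (auto intro!: p_unit_fact lt)
    have i: "p_integral (2 ^ n / fact m)" using u by auto
    show ?thesis
      by (rule rat_cong_mult[OF rat_cong_scale_right[OF i fact_3m_cong[OF n]] rat_cong_inverse[OF QR Q_unit R_unit]])
        (intro p_integral_mult i p_unit_imp_integral[OF u(2)], rule p_unit_imp_integral[OF p_unit_inverse[OF R_unit]])
  qed
  also have "\<dots> = common_residue m"
  proof -
    have C: "rat_of_nat ((2 * m) choose m) = fact (2 * m) / fact m ^ 2"
      by (simp add: binomial_fact power2_eq_square)
    have gen: "(-1) ^ m * (F ^ 2 / f) * X * (T / f) * (1 / ((-1) ^ m * T * f ^ 2)) = (F / f ^ 2) ^ 2 * X"
      if "f \<noteq> 0" "T \<noteq> 0" for F f X T :: rat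
      using that by (simp add: field_simps power2_eq_square)
    show ?thesis unfolding R common_residue_def C by (rule gen) simp_all
  qed
  finally show ?thesis .
qed

text \<open>
  Evaluate \<open>(p-1)!\<close> twice: as the product of the \<open>j\<close> and the \<open>p - j\<close> for \<open>j \<le> n\<close>, and as the product of the even
  numbers \<open>2j\<close> and the odd numbers \<open>p - 2j\<close>.
\<close>

lemma two_power_prod:
  "(2::rat) ^ (2 * n) * (\<Prod>j\<in>{1..n}. 1 + of_nat p * (- 1 / of_nat (2 * j))) = (\<Prod>j\<in>{1..n}. 1 + of_nat p * (- 1 / of_nat j))"
proof -
  have fp: "(\<Prod>j\<in>{1..n}. rat_of_nat j) = fact n" by (simp add: fact_prod)
  have 1: "fact n * (\<Prod>j\<in>{1..n}. of_nat p - of_nat j) = (fact (2 * n) :: rat)"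
  proof -
    have "(\<Prod>j\<in>{1..n}. rat_of_nat p - of_nat j) = (\<Prod>j\<in>{1..n}. of_nat (n + j))"
      by (subst prod.atLeastAtMost_rev) (intro prod.cong, auto simp: p_eq of_nat_diff)
    moreover have "fact n * (\<Prod>j\<in>{1..N}. of_nat (n + j)) = (fact (n + N) :: rat)" for N
    proof (induction N)
      case (Suc N)
      have "fact n * (\<Prod>j\<in>{1..Suc N}. of_nat (n + j)) = (fact n * (\<Prod>j\<in>{1..N}. of_nat (n + j))) * rat_of_nat (n + Suc N)"
        by (simp add: prod.nat_ivl_Suc' mult_ac)
      thus ?case unfolding Suc.IH by (simp add: algebra_simps)
    qed simp
    ultimately show ?thesis by (simp add: mult_2)
  qed
  have 2: "2 ^ n * fact n * (\<Prod>j\<in>{1..n}. of_nat p - of_nat (2 * j)) = (fact (2 * n) :: rat)"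
  proof -
    have "(\<Prod>j\<in>{1..n}. rat_of_nat p - of_nat (2 * j)) = (\<Prod>j\<in>{1..n}. of_nat (2 * j) - 1)"
      by (subst prod.atLeastAtMost_rev) (intro prod.cong, auto simp: p_eq of_nat_diff)
    moreover have "2 ^ N * fact N * (\<Prod>j\<in>{1..N}. of_nat (2 * j) - 1) = (fact (2 * N) :: rat)" for N
    proof (induction N)
      case (Suc N)
      have "2 ^ Suc N * fact (Suc N) * (\<Prod>j\<in>{1..Suc N}. rat_of_nat (2 * j) - 1)
        = (2 ^ N * fact N * (\<Prod>j\<in>{1..N}. of_nat (2 * j) - 1)) * (2 * of_nat (Suc N) * (of_nat (2 * Suc N) - 1))"
        by (simp add: prod.nat_ivl_Suc')
      thus ?case unfolding Suc.IH by (simp add: algebra_simps)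
    qed simp
    ultimately show ?thesis by simp
  qed
  have 3: "(\<Prod>j\<in>{1..n}. rat_of_nat p - of_nat j) = (-1) ^ n * fact n * (\<Prod>j\<in>{1..n}. 1 + of_nat p * (- 1 / of_nat j))"
  proof -
    have "(\<Prod>j\<in>{1..n}. rat_of_nat p - of_nat j) = (\<Prod>j\<in>{1..n}. - of_nat j * (1 + of_nat p * (- 1 / of_nat j)))"
      by (intro prod.cong) (auto simp: field_simps)
    thus ?thesis unfolding prod.distrib prod_uminus fp by simp
  qed
  have 4: "(\<Prod>j\<in>{1..n}. rat_of_nat p - of_nat (2 * j)) = (-1) ^ n * (2 ^ n * fact n) * (\<Prod>j\<in>{1..n}. 1 + of_nat p * (- 1 / of_nat (2 * j)))"
  proof -
    have "(\<Prod>j\<in>{1..n}. rat_of_nat p - of_nat (2 * j)) = (\<Prod>j\<in>{1..n}. - (2 * of_nat j) * (1 + of_nat p * (- 1 / of_nat (2 * j))))"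
      by (intro prod.cong) (auto simp: field_simps)
    thus ?thesis unfolding prod.distrib prod_uminus fp by simp
  qed
  define A where "A = (\<Prod>j\<in>{1..n}. 1 + of_nat p * (- 1 / rat_of_nat (2 * j)))"
  define B where "B = (\<Prod>j\<in>{1..n}. 1 + of_nat p * (- 1 / rat_of_nat j))"
  have "2 ^ n * fact n * ((-1) ^ n * (2 ^ n * fact n) * A) = fact n * ((-1) ^ n * fact n * B)"
    using 1 2 unfolding 3 4 A_def B_def by (simp only:)
  hence "(2 ^ n * 2 ^ n) * A = B" by simp
  moreover have "(2::rat) ^ (2 * n) = 2 ^ n * 2 ^ n" by (simp only: mult_2 power_add)
  ultimately show ?thesis unfolding A_def B_def by (simp only:)
qed

text \<open>
  Gauss's lemma for the residue 2, keeping the terms of order \<open>p\<close>: the product of \<open>2, 4, \<dots>, 2n\<close> contains, besides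
  the even numbers up to \<open>n\<close>, the numbers \<open>p - o\<close> for odd \<open>o < n\<close>.
\<close>

lemma two_power_prod_quarter:
  assumes n: "n = 2 * m"
  shows "(2::rat) ^ n = (-1) ^ m * (\<Prod>j\<in>{1..m}. 1 + of_nat p * (- 1 / of_nat (2 * j - 1)))"
proof -
  have "fact N * (2::rat) ^ N = (\<Prod>k\<in>{1..N}. of_nat (2 * k))" for N
    by (induction N) (simp_all add: prod.nat_ivl_Suc' algebra_simps)
  hence "fact n * (2::rat) ^ n = (\<Prod>k\<in>{1..n}. of_nat (2 * k))" .
  also have "{1..n} = {1..m} \<union> {m+1..2*m}" using n by auto
  also have "(\<Prod>k\<in>\<dots>. rat_of_nat (2 * k)) = (\<Prod>k\<in>{1..m}. of_nat (2 * k)) * (\<Prod>k\<in>{m+1..2*m}. of_nat (2 * k))"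
    by (intro prod.union_disjoint) auto
  also have "(\<Prod>k\<in>{m+1..2*m}. rat_of_nat (2 * k)) = (\<Prod>j\<in>{1..m}. - of_nat (2 * j - 1) * (1 + of_nat p * (- 1 / of_nat (2 * j - 1))))"
    by (rule prod.reindex_bij_witness[of _ "\<lambda>j. 2 * m + 1 - j" "\<lambda>k. 2 * m + 1 - k"])
      (auto simp: p_eq n of_nat_diff field_simps)
  also have "\<dots> = (-1) ^ m * (\<Prod>j\<in>{1..m}. of_nat (2 * j - 1)) * (\<Prod>j\<in>{1..m}. 1 + of_nat p * (- 1 / of_nat (2 * j - 1)))"
    unfolding prod.distrib prod_uminus by simp
  also have "(\<Prod>k\<in>{1..m}. of_nat (2 * k)) * \<dots> = ((\<Prod>k\<in>{1..m}. of_nat (2 * k)) * (\<Prod>j\<in>{1..m}. of_nat (2 * j - 1)))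
      * ((-1) ^ m * (\<Prod>j\<in>{1..m}. 1 + of_nat p * (- 1 / of_nat (2 * j - 1))))"
    by (simp only: mult_ac)
  also have "(\<Prod>k\<in>{1..m}. of_nat (2 * k)) * (\<Prod>j\<in>{1..m}. rat_of_nat (2 * j - 1)) = fact (2 * m)"
    by (induction m) (simp_all add: prod.nat_ivl_Suc' algebra_simps)
  finally show ?thesis using n by simp
qed

text \<open>
  The two product formulas give \<open>2\<^bsup>p-1\<^esup> \<equiv> 1 - p h\<^sub>2/2\<close> and \<open>2\<^bsup>p-1\<^esup> \<equiv> 1 + p (h\<^sub>1 - 2 h\<^sub>2)\<close>, where \<open>h\<^sub>1\<close> and \<open>h\<^sub>2\<close> are the
  harmonic numbers of \<open>m\<close> and \<open>2m\<close>.  Twice the first minus the second has the linear term \<open>p (h\<^sub>2 - h\<^sub>1)\<close>.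
\<close>

lemma two_power_quarter_harm:
  assumes n: "n = 2 * m"
  shows "rat_cong p 2 (1 / 2 ^ (2 * n)) (1 - of_nat p * quarter_harm m)"
proof -
  have lt: "k < p" if "k \<le> 4 * m" for k using that n p_eq by simp
  let ?h1 = "rat_harm m" and ?h2 = "rat_harm n"
  have h: "p_integral ?h1" "p_integral ?h2" by (auto intro!: p_integral_harm lt simp: n)
  have half: "p_integral (?h2 / 2)" using h p_unit_2 by blast
  have even: "rat_cong p 2 (2 ^ (2 * n)) (1 - of_nat p * (?h2 / 2))"
  proof -
    define A where "A = (\<Prod>j\<in>{1..n}. 1 + rat_of_nat p * (- (1/2) / of_nat j))"
    define B where "B = (\<Prod>j\<in>{1..n}. 1 + rat_of_nat p * (- 1 / of_nat j))"
    have i: "p_integral (- (1/2) / of_nat j)" "p_integral (-1 / of_nat j)" if "j \<in> {1..n}" for j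
    proof -
      have "p_unit (of_nat j)" using that by (intro p_unit_of_nat_less less_pI) auto
      thus "p_integral (- (1/2) / of_nat j)" "p_integral (-1 / of_nat j)"
        by (intro p_integral_divide p_integral_uminus p_unit_2 p_integral_numeral; assumption)+
    qed
    have AB: "2 ^ (2 * n) * A = B"
      using two_power_prod unfolding A_def B_def by (simp add: field_simps)
    have A: "p_unit A" unfolding A_def using i by (intro p_unit_prod p_unit_one_plus_p)
    have cA: "rat_cong p 2 (1 / A) (1 - of_nat p * (- (1/2) * ?h2))"
      unfolding A_def by (intro inverse_prod_harm less_pI p_integral_uminus p_integral_divide p_unit_2) auto
    have cB: "rat_cong p 2 B (1 + of_nat p * (- ?h2))"
      using prod_one_plus_p[of "{1..n}" "\<lambda>j. - 1 / of_nat j"] i unfolding B_def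
      by (simp add: rat_harm_def sum_negf)
    have "rat_cong p 2 (B * (1 / A)) ((1 + of_nat p * (- ?h2)) * (1 - of_nat p * (- (1/2) * ?h2)))"
    proof (rule rat_cong_mult[OF cB cA])
      show "p_integral B" unfolding B_def
        by (intro p_integral_prod p_integral_add p_integral_mult p_integral_numeral p_integral_of_nat i)
      show "p_integral (1 - of_nat p * (- (1/2) * ?h2))"
        by (intro p_integral_diff p_integral_mult p_integral_uminus p_integral_divide p_unit_2 h p_integral_numeral p_integral_of_nat)
    qed
    also have "(1 + of_nat p * (- ?h2)) * (1 - of_nat p * (- (1/2) * ?h2)) = (1 + of_nat p * (- ?h2)) * (1 + of_nat p * (?h2 / 2))"
      by simp
    also have "rat_cong p 2 \<dots> (1 + of_nat p * (- ?h2 + ?h2 / 2))"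
      using h half by (intro one_plus_p_mult) auto
    also have "\<dots> = 1 - of_nat p * (?h2 / 2)" by (simp add: field_simps)
    finally have "rat_cong p 2 (B * (1 / A)) (1 - of_nat p * (?h2 / 2))" .
    moreover have "B * (1 / A) = 2 ^ (2 * n)"
      unfolding AB[symmetric] using p_unit_nonzero[OF A] by simp
    ultimately show ?thesis by (simp only:)
  qed
  define S where "S = (\<Sum>j\<in>{1..m}. - 1 / rat_of_nat (2 * j - 1))"
  have S: "S = ?h1 / 2 - ?h2"
    unfolding S_def n by (rule odd_harmonic_sum)
  have odd: "rat_cong p 2 (2 ^ (2 * n)) (1 + of_nat p * (S + S))"
  proof -
    have i: "p_integral (- 1 / of_nat (2 * j - 1))" if "j \<in> {1..m}" for j
      using that by (intro p_integral_divide p_integral_uminus p_unit_of_nat_less lt) auto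
    have Oi: "p_integral S" unfolding S_def using i by blast
    define B where "B = (\<Prod>j\<in>{1..m}. 1 + rat_of_nat p * (- 1 / of_nat (2 * j - 1)))"
    have B: "rat_cong p 2 B (1 + of_nat p * S)" unfolding B_def S_def using i by (intro prod_one_plus_p)
    have Bi: "p_integral B" unfolding B_def using i by blast
    have "(2::rat) ^ (2 * n) = B * B"
    proof -
      have "(2::rat) ^ (2 * n) = 2 ^ n * 2 ^ n" by (simp only: mult_2 power_add)
      also have "\<dots> = ((-1) ^ m * B) * ((-1) ^ m * B)"
        using two_power_prod_quarter[OF n] unfolding B_def by (simp only:)
      finally show ?thesis by simp
    qed
    also have "rat_cong p 2 \<dots> ((1 + of_nat p * S) * (1 + of_nat p * S))"
      using B Bi Oi by (intro rat_cong_mult) auto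
    also have "rat_cong p 2 \<dots> (1 + of_nat p * (S + S))" using Oi by (intro one_plus_p_mult)
    finally show ?thesis .
  qed
  have qh: "quarter_harm m = ?h2 - ?h1"
  proof -
    have "{1..2*m} = {1..m} \<union> {m+1..2*m}" by auto
    thus ?thesis unfolding quarter_harm_def rat_harm_def n by (simp add: sum.union_disjoint)
  qed
  have "rat_cong p 2 (2 * 2 ^ (2 * n) - 2 ^ (2 * n)) (2 * (1 - of_nat p * (?h2 / 2)) - (1 + of_nat p * (S + S)))"
    using even odd by (intro rat_cong_diff rat_cong_scale) auto
  also have "2 * (1 - of_nat p * (?h2 / 2)) - (1 + of_nat p * (S + S)) = 1 + of_nat p * quarter_harm m"
    unfolding S qh by (simp add: field_simps)
  finally have "rat_cong p 2 (2 ^ (2 * n)) (1 + of_nat p * quarter_harm m)" by simp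
  thus ?thesis using p_integral_quarter_harm[OF n] p_unit_2 by (intro inverse_one_plus_p) auto
qed

lemma legendre_sum_half_common_residue:
  assumes n: "n = 2 * m"
  shows "rat_cong p 2 (legendre_sum n (-1/2) ^ 2) (common_residue m)"
proof -
  have "legendre_sum n (-1/2) ^ 2 = of_nat ((2 * m) choose m) ^ 2 * (1 / 2 ^ (2 * n))"
    unfolding legendre_sum_minus_half n
    by (simp add: power_mult_distrib power_divide mult.commute flip: power_mult)
  also have "rat_cong p 2 \<dots> (common_residue m)"
    unfolding common_residue_def by (intro rat_cong_scale two_power_quarter_harm n) auto
  finally show ?thesis .
qed

end

section \<open>Jacobsthal sums and sums of two squares\<close>

context odd_prime_modulus
begin

abbreviation residues_p :: "int set" where "residues_p \<equiv> {0..<int p}"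

definition periodic :: "(int \<Rightarrow> int) \<Rightarrow> bool" where
  "periodic f \<longleftrightarrow> (\<forall>a b. [a = b] (mod int p) \<longrightarrow> f a = f b)"

lemma p_gt_2: "p > 2" using n_pos p_eq by simp

lemma sum_affine_reindex:
  assumes f: "periodic f" and c: "\<not> int p dvd c"
  shows "(\<Sum>t\<in>residues_p. f (c * t + d)) = (\<Sum>t\<in>residues_p. f t)"
proof -
  define h where "h t = (c * t + d) mod int p" for t
  have inj: "inj_on h residues_p"
  proof (rule inj_onI)
    fix s t assume st: "s \<in> residues_p" "t \<in> residues_p" "h s = h t"
    hence "[c * s + d = c * t + d] (mod int p)" by (simp add: h_def cong_def)
    hence "[c * s = c * t] (mod int p)" by (simp add: cong_add_rcancel)
    hence "[s = t] (mod int p)"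
      using c prime_int_p cong_mult_lcancel prime_imp_coprime coprime_commute by blast
    thus "s = t" using st by (auto simp: cong_def)
  qed
  have "h ` residues_p = residues_p"
    using p_pos by (intro endo_inj_surj inj) (auto simp: h_def)
  hence "(\<Sum>t\<in>residues_p. f t) = (\<Sum>t\<in>residues_p. f (h t))"
    using sum.reindex[OF inj, of f] by (simp add: o_def)
  also have "\<dots> = (\<Sum>t\<in>residues_p. f (c * t + d))"
  proof (rule sum.cong[OF refl])
    fix t
    have "[h t = c * t + d] (mod int p)" by (simp add: h_def cong_def)
    thus "f (h t) = f (c * t + d)" using f unfolding periodic_def by blast
  qed
  finally show ?thesis ..
qed

definition leg :: "int \<Rightarrow> int" where "leg a = Legendre a (int p)"

lemma leg_cases: "leg a = 0 \<or> leg a = 1 \<or> leg a = -1"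
  by (simp add: leg_def Legendre_def)

lemma leg_eq_0_iff: "leg a = 0 \<longleftrightarrow> int p dvd a"
  by (simp add: leg_def Legendre_def cong_0_iff)

lemma leg_euler: "[leg a = a ^ n] (mod int p)"
proof -
  have "(p - 1) div 2 = n" by (simp add: p_eq)
  thus ?thesis using euler_criterion[OF prime_p p_gt_2, of a] by (simp only: leg_def)
qed

lemma leg_eqI:
  assumes "[leg a = z] (mod int p)" "z = 0 \<or> z = 1 \<or> z = -1"
  shows "leg a = z"
proof -
  have "int p dvd leg a - z" using assms by (simp add: cong_iff_dvd_diff)
  moreover have "\<bar>leg a - z\<bar> < int p" using assms(2) leg_cases[of a] p_gt_2 by auto
  moreover have "leg a - z \<noteq> 0 \<Longrightarrow> int p dvd leg a - z \<Longrightarrow> int p \<le> \<bar>leg a - z\<bar>"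
    using dvd_imp_le_int[of "leg a - z" "int p"] by simp
  ultimately show ?thesis by linarith
qed

lemma leg_mult: "leg (a * b) = leg a * leg b"
proof (rule leg_eqI)
  have "[leg (a * b) = a ^ n * b ^ n] (mod int p)" using leg_euler[of "a * b"] by (simp add: power_mult_distrib)
  also have "[a ^ n * b ^ n = leg a * leg b] (mod int p)"
    by (intro cong_mult cong_sym[OF leg_euler])
  finally show "[leg (a * b) = leg a * leg b] (mod int p)" .
  show "leg a * leg b = 0 \<or> leg a * leg b = 1 \<or> leg a * leg b = -1"
    using leg_cases[of a] leg_cases[of b] by auto
qed

lemma leg_cong: "[a = b] (mod int p) \<Longrightarrow> leg a = leg b"
proof (rule leg_eqI)
  assume "[a = b] (mod int p)"
  hence "[a ^ n = b ^ n] (mod int p)" by (rule cong_pow)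
  thus "[leg a = leg b] (mod int p)"
    using cong_trans[OF leg_euler[of a] cong_trans[OF _ cong_sym[OF leg_euler[of b]]]] by simp
qed (rule leg_cases)

lemma periodic_leg_comp: "(\<And>a b. [a = b] (mod int p) \<Longrightarrow> [g a = g b] (mod int p)) \<Longrightarrow> periodic (\<lambda>t. leg (g t))"
  unfolding periodic_def using leg_cong by blast

lemma leg_square: "\<not> int p dvd a \<Longrightarrow> leg a * leg a = 1"
  using leg_cases[of a] leg_eq_0_iff[of a] by auto

lemma leg_sq: "\<not> int p dvd a \<Longrightarrow> leg (a ^ 2) = 1"
  using leg_square leg_mult by (simp add: power2_eq_square)

lemma leg_eq_1D: assumes "leg a = 1" obtains c where "[c ^ 2 = a] (mod int p)" "\<not> int p dvd c"
proof -
  from assms have "QuadRes (int p) a"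
  proof (rule contrapos_pp)
    assume "\<not> QuadRes (int p) a"
    hence "leg a = 0 \<or> leg a = -1" by (simp add: leg_def Legendre_def)
    thus "leg a \<noteq> 1" by auto
  qed
  then obtain c where c: "[c ^ 2 = a] (mod int p)" unfolding QuadRes_def ..
  moreover have "\<not> int p dvd c"
  proof
    assume "int p dvd c"
    hence "int p dvd a" using cong_dvd_iff[OF c] by (simp add: power2_eq_square)
    thus False using assms leg_eq_0_iff[of a] by simp
  qed
  ultimately show ?thesis using that by blast
qed

lemma primitive_root_exists: obtains g :: int where "\<And>e. [g ^ e = 1] (mod int p) \<longleftrightarrow> (p - 1) dvd e"
proof -
  obtain g where "residue_primroot p g"
    using residue_primroot_odd_prime_power_exists[OF prime_p odd_p] by (metis power_one_right zero_less_one)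
  hence "ord p g = p - 1" using prime_p by (simp add: residue_primroot_def totient_prime)
  hence "[g ^ e = 1] (mod p) \<longleftrightarrow> (p - 1) dvd e" for e by (simp add: ord_divides')
  hence "[int g ^ e = 1] (mod int p) \<longleftrightarrow> (p - 1) dvd e" for e
    using cong_int_iff[of "g ^ e" 1 p] by simp
  thus ?thesis using that by blast
qed

lemma nonresidue_exists: obtains g where "leg g = -1"
proof -
  obtain g :: int where g: "\<And>e. [g ^ e = 1] (mod int p) \<longleftrightarrow> (p - 1) dvd e"
    using primitive_root_exists by blast
  have "leg g \<noteq> 1"
  proof
    assume "leg g = 1"
    hence "[g ^ n = 1] (mod int p)" using leg_euler[of g] by (simp add: cong_sym)
    hence "(p - 1) dvd n" using g[of n] by simp
    thus False using n_pos p_eq by (auto dest: dvd_imp_le)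
  qed
  moreover have "leg g \<noteq> 0"
  proof
    assume "leg g = 0"
    hence "int p dvd g ^ (p - 1)" using p_gt_1 by (simp add: leg_eq_0_iff prime_dvd_power_iff[OF prime_int_p])
    moreover have "[g ^ (p - 1) = 1] (mod int p)" using g[of "p - 1"] by simp
    ultimately have "int p dvd 1" using cong_dvd_iff[of "g ^ (p - 1)" 1 "int p"] by simp
    thus False using p_gt_1 by simp
  qed
  ultimately have "leg g = -1" using leg_cases[of g] by simp
  thus ?thesis by (rule that)
qed

lemma sum_leg: "(\<Sum>t\<in>residues_p. leg t) = 0"
proof -
  obtain g where g: "leg g = -1" using nonresidue_exists .
  hence "\<not> int p dvd g" using leg_eq_0_iff[of g] by auto
  hence "(\<Sum>t\<in>residues_p. leg (g * t + 0)) = (\<Sum>t\<in>residues_p. leg t)"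
    by (intro sum_affine_reindex periodic_leg_comp)
  thus ?thesis using g by (simp add: leg_mult sum_negf)
qed

lemma sum_leg_square: "(\<Sum>t\<in>residues_p. leg t * leg t) = int p - 1"
proof -
  have "residues_p = insert 0 {1..<int p}" using p_pos by auto
  hence "(\<Sum>t\<in>residues_p. leg t * leg t) = leg 0 * leg 0 + (\<Sum>t\<in>{1..<int p}. leg t * leg t)" by simp
  also have "(\<Sum>t\<in>{1..<int p}. leg t * leg t) = (\<Sum>t\<in>{1..<int p}. 1)"
    by (intro sum.cong leg_square) (auto dest: zdvd_imp_le)
  finally show ?thesis using leg_eq_0_iff[of 0] p_pos by (simp add: of_nat_diff)
qed

definition quad_sum :: "int \<Rightarrow> int" where
  "quad_sum d = (\<Sum>a\<in>residues_p. leg (a * (a + d)))"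

lemma quad_sum_cong: "[c = d] (mod int p) \<Longrightarrow> quad_sum c = quad_sum d"
  unfolding quad_sum_def by (intro sum.cong refl leg_cong cong_mult cong_add) auto

lemma quad_sum_0: "int p dvd d \<Longrightarrow> quad_sum d = int p - 1"
  using quad_sum_cong[of d 0] sum_leg_square by (simp add: quad_sum_def leg_mult cong_0_iff)

lemma quad_sum_scale:
  assumes "\<not> int p dvd d" shows "quad_sum d = quad_sum 1"
proof -
  have "quad_sum d = (\<Sum>a\<in>residues_p. leg ((d * a + 0) * ((d * a + 0) + d)))"
    unfolding quad_sum_def
    by (rule sum_affine_reindex[symmetric, OF periodic_leg_comp assms]) (intro cong_refl cong_mult cong_add cong_diff cong_pow; assumption)
  also have "\<dots> = (\<Sum>a\<in>residues_p. leg (d ^ 2 * (a * (a + 1))))"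
    by (intro sum.cong arg_cong[of _ _ leg]) (auto simp: algebra_simps power2_eq_square)
  also have "\<dots> = quad_sum 1" using leg_sq[OF assms] by (simp add: leg_mult[of "d ^ 2"] quad_sum_def)
  finally show ?thesis .
qed

text \<open>
  The values at all \<open>d\<close> prime to \<open>p\<close> agree, by scaling, the value at \<open>0\<close> is \<open>p - 1\<close>, and all
  values add up to \<open>0\<close>.
\<close>

lemma quad_sum_1: "quad_sum 1 = -1"
proof -
  have "(\<Sum>d\<in>residues_p. quad_sum d) = (\<Sum>a\<in>residues_p. leg a * (\<Sum>d\<in>residues_p. leg (1 * d + a)))"
    unfolding quad_sum_def sum_distrib_left by (subst sum.swap) (simp add: leg_mult add.commute)
  also have "\<dots> = 0"
    using p_gt_1 sum_leg by (subst sum_affine_reindex) (auto intro: periodic_leg_comp[of "\<lambda>t. t"])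
  finally have "(\<Sum>d\<in>residues_p. quad_sum d) = 0" .
  moreover have "residues_p = insert 0 {1..<int p}" using p_pos by auto
  ultimately have "quad_sum 0 + (\<Sum>d\<in>{1..<int p}. quad_sum d) = 0" by simp
  also have "(\<Sum>d\<in>{1..<int p}. quad_sum d) = (\<Sum>d\<in>{1..<int p}. quad_sum 1)"
    by (intro sum.cong quad_sum_scale) (auto dest: zdvd_imp_le)
  finally have "(int p - 1) * (1 + quad_sum 1) = 0"
    using p_pos by (simp add: quad_sum_0 of_nat_diff algebra_simps)
  thus ?thesis using p_gt_1 by auto
qed

lemma quad_sum_eq: "quad_sum d = -1 + int p * (if int p dvd d then 1 else 0)"
  using quad_sum_0 quad_sum_scale quad_sum_1 by simp

text \<open>
  Substitute \<open>w = 1 - a u\<close>, then scale by \<open>v\<close>; the factors \<open>u\<close> and \<open>v\<close> do not change the symbol.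
\<close>

lemma product_sum:
  assumes u: "leg u = 1" and v: "leg v = 1"
  shows "(\<Sum>a\<in>residues_p. leg ((1 - a * u) * (1 - a * v))) = quad_sum (u - v)"
proof -
  have nu: "\<not> int p dvd - u" and nv: "\<not> int p dvd v" using u v leg_eq_0_iff[of u] leg_eq_0_iff[of v] by auto
  have "(\<Sum>a\<in>residues_p. leg ((1 - a * u) * (1 - a * v)))
      = (\<Sum>a\<in>residues_p. leg ((-u * a + 1) * (v * (-u * a + 1) + (u - v))))"
  proof (rule sum.cong[OF refl])
    fix a
    have "(-u * a + 1) * (v * (-u * a + 1) + (u - v)) = u * ((1 - a * u) * (1 - a * v))"
      by (simp add: algebra_simps)
    thus "leg ((1 - a * u) * (1 - a * v)) = leg ((-u * a + 1) * (v * (-u * a + 1) + (u - v)))"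
      using u by (simp add: leg_mult[of u])
  qed
  also have "\<dots> = (\<Sum>w\<in>residues_p. leg (w * (v * w + (u - v))))"
    by (rule sum_affine_reindex[of "\<lambda>w. leg (w * (v * w + (u - v)))", OF periodic_leg_comp nu]) (intro cong_refl cong_mult cong_add cong_diff cong_pow; assumption)
  also have "\<dots> = (\<Sum>w\<in>residues_p. leg ((v * w + 0) * ((v * w + 0) + (u - v))))"
    using v by (simp add: leg_mult[of v] mult.assoc)
  also have "\<dots> = quad_sum (u - v)"
    unfolding quad_sum_def
    by (rule sum_affine_reindex[of "\<lambda>w. leg (w * (w + (u - v)))", OF periodic_leg_comp nv]) (intro cong_refl cong_mult cong_add cong_diff cong_pow; assumption)
  finally show ?thesis .
qed

text \<open>
  Up to sign, the traces of Frobenius of the curves \<open>y\<^sup>2 = t - a t\<^sup>3\<close>, which have complex multiplication by the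
  Gaussian integers.
\<close>

definition jacobsthal :: "int \<Rightarrow> int" where
  "jacobsthal a = (\<Sum>t\<in>residues_p. leg (t * (1 - a * t ^ 2)))"

lemma jacobsthal_cong: "[a = b] (mod int p) \<Longrightarrow> jacobsthal a = jacobsthal b"
  unfolding jacobsthal_def by (intro sum.cong refl leg_cong cong_mult cong_diff) auto

lemma jacobsthal_scale:
  assumes "\<not> int p dvd c" shows "jacobsthal (a * c ^ 2) ^ 2 = jacobsthal a ^ 2"
proof -
  have "jacobsthal a = (\<Sum>t\<in>residues_p. leg ((c * t + 0) * (1 - a * (c * t + 0) ^ 2)))"
    unfolding jacobsthal_def
    by (rule sum_affine_reindex[symmetric, OF periodic_leg_comp assms]) (intro cong_refl cong_mult cong_add cong_diff cong_pow; assumption)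
  also have "\<dots> = leg c * jacobsthal (a * c ^ 2)"
    unfolding jacobsthal_def sum_distrib_left
    by (intro sum.cong refl) (simp add: leg_mult[of c, symmetric] power_mult_distrib mult.assoc mult.left_commute mult.commute[of "c ^ 2"])
  finally show ?thesis using leg_square[OF assms] by (simp add: power2_eq_square)
qed

lemma jacobsthal_0: "jacobsthal 0 = 0"
  using sum_leg by (simp add: jacobsthal_def)

text \<open>
  Up to sign \<open>jacobsthal a\<close> depends only on the quadratic character of \<open>a\<close>; the formula interpolates the two
  cases so that it can be summed over \<open>a\<close>.
\<close>

lemma jacobsthal_square:
  assumes g: "leg g = -1" and a: "\<not> int p dvd a"
  shows "2 * jacobsthal a ^ 2 = (jacobsthal 1 ^ 2 + jacobsthal g ^ 2) + leg a * (jacobsthal 1 ^ 2 - jacobsthal g ^ 2)"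
proof -
  consider "leg a = 1" | "leg a = -1" using leg_cases[of a] leg_eq_0_iff[of a] a by blast
  thus ?thesis
  proof cases
    case 1
    then obtain c where c: "[c ^ 2 = a] (mod int p)" "\<not> int p dvd c" by (rule leg_eq_1D)
    thus ?thesis using jacobsthal_cong[OF c(1)] jacobsthal_scale[OF c(2), of 1] 1 by simp
  next
    case 2
    hence "leg (a * g) = 1" using g by (simp add: leg_mult)
    then obtain c where c: "[c ^ 2 = a * g] (mod int p)" "\<not> int p dvd c" by (rule leg_eq_1D)
    have ng: "\<not> int p dvd g" using g leg_eq_0_iff[of g] by auto
    have "[g * c ^ 2 = g * (a * g)] (mod int p)" by (intro cong_mult c(1)) simp
    hence "jacobsthal (g * c ^ 2) = jacobsthal (a * g ^ 2)"
      by (intro jacobsthal_cong) (simp add: power2_eq_square mult_ac)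
    thus ?thesis using jacobsthal_scale[OF c(2), of g] jacobsthal_scale[OF ng, of a] 2 by simp
  qed
qed

end

locale prime_1_mod_4 = odd_prime_modulus +
  fixes m :: nat
  assumes n_eq: "n = 2 * m"
begin

lemma p_eq_m: "p = 4 * m + 1" by (simp add: p_eq n_eq)

lemma m_pos: "m > 0" using n_pos n_eq by simp

lemma leg_minus: "leg (- a) = leg a"
proof -
  have "leg (-1) = 1"
    using leg_eqI[of "-1" 1] leg_euler[of "-1"] by (simp add: n_eq power_mult)
  thus ?thesis using leg_mult[of "-1" a] by simp
qed

text \<open>
  Expand the square and sum over \<open>a\<close> first.  For \<open>s, t\<close> prime to \<open>p\<close> the inner sum is \<open>-1\<close>, plus \<open>p\<close> when \<open>t = \<plusminus>s\<close>;
  the part with \<open>-1\<close> is minus a product of two vanishing sums.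
\<close>

lemma sum_jacobsthal_squares: "(\<Sum>a\<in>residues_p. jacobsthal a ^ 2) = 2 * int p * (int p - 1)"
proof -
  have "(\<Sum>a\<in>residues_p. jacobsthal a ^ 2)
      = (\<Sum>a\<in>residues_p. \<Sum>s\<in>residues_p. \<Sum>t\<in>residues_p. leg s * leg t * leg ((1 - a * s ^ 2) * (1 - a * t ^ 2)))"
    unfolding jacobsthal_def power2_eq_square[of "sum _ _"] sum_product by (simp add: leg_mult mult_ac)
  also have "\<dots> = (\<Sum>s\<in>residues_p. \<Sum>t\<in>residues_p. leg s * leg t * (\<Sum>a\<in>residues_p. leg ((1 - a * s ^ 2) * (1 - a * t ^ 2))))"
    unfolding sum_distrib_left by (subst sum.swap, rule sum.cong[OF refl], rule sum.swap)
  also have "\<dots> = (\<Sum>s\<in>residues_p. \<Sum>t\<in>residues_p. leg s * leg t * (-1 + int p * (if int p dvd s ^ 2 - t ^ 2 then 1 else 0)))"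
  proof (intro sum.cong refl)
    fix s t
    show "leg s * leg t * (\<Sum>a\<in>residues_p. leg ((1 - a * s ^ 2) * (1 - a * t ^ 2)))
        = leg s * leg t * (-1 + int p * (if int p dvd s ^ 2 - t ^ 2 then 1 else 0))"
    proof (cases "int p dvd s \<or> int p dvd t")
      case True thus ?thesis using leg_eq_0_iff by auto
    next
      case False
      thus ?thesis using product_sum[of "s ^ 2" "t ^ 2"] leg_sq[of s] leg_sq[of t] quad_sum_eq by simp
    qed
  qed
  also have "\<dots> = (\<Sum>s\<in>residues_p. \<Sum>t\<in>residues_p. - (leg s * leg t) + int p * (leg s * (if int p dvd s ^ 2 - t ^ 2 then leg t else 0)))"
    by (intro sum.cong refl) (simp add: algebra_simps)
  also have "\<dots> = - ((\<Sum>s\<in>residues_p. leg s) * (\<Sum>t\<in>residues_p. leg t))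
      + int p * (\<Sum>s\<in>residues_p. leg s * (\<Sum>t\<in>residues_p. if int p dvd s ^ 2 - t ^ 2 then leg t else 0))"
    unfolding sum.distrib sum_negf sum_product unfolding sum_distrib_left ..
  also have "(\<Sum>s\<in>residues_p. leg s * (\<Sum>t\<in>residues_p. if int p dvd s ^ 2 - t ^ 2 then leg t else 0))
      = (\<Sum>s\<in>residues_p. 2 * (leg s * leg s))"
  proof (intro sum.cong refl)
    fix s assume s: "s \<in> residues_p"
    show "leg s * (\<Sum>t\<in>residues_p. if int p dvd s ^ 2 - t ^ 2 then leg t else 0) = 2 * (leg s * leg s)"
    proof (cases "s = 0")
      case True thus ?thesis using leg_eq_0_iff[of 0] by simp
    next
      case False
      have "(\<Sum>t\<in>residues_p. if int p dvd s ^ 2 - t ^ 2 then leg t else 0)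
          = (\<Sum>t\<in>{t \<in> residues_p. int p dvd s ^ 2 - t ^ 2}. leg t)"
        by (rule sum.inter_filter[symmetric]) simp
      also have "{t \<in> residues_p. int p dvd s ^ 2 - t ^ 2} = {s, int p - s}"
      proof -
        have *: "int p dvd s ^ 2 - t ^ 2 \<longleftrightarrow> t = s \<or> t = int p - s" if t: "t \<in> residues_p" for t
        proof -
          have "s ^ 2 - t ^ 2 = (s - t) * (s + t)" by (simp add: power2_eq_square algebra_simps)
          hence "int p dvd s ^ 2 - t ^ 2 \<longleftrightarrow> int p dvd s - t \<or> int p dvd s + t"
            using prime_int_p by (simp add: prime_dvd_mult_iff)
          also have "int p dvd s - t \<longleftrightarrow> t = s"
            using s t zdvd_imp_le[of "int p" "s - t"] zdvd_imp_le[of "int p" "t - s"] dvd_minus_iff[of "int p" "s - t"]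
            by (cases s t rule: linorder_cases) auto
          also have "int p dvd s + t \<longleftrightarrow> t = int p - s"
          proof
            assume "int p dvd s + t"
            then obtain k where k: "s + t = int p * k" by (auto elim: dvdE)
            have "0 < s + t" "s + t < 2 * int p" using s t False by auto
            hence "0 < k" "k < 2" using k p_pos by (auto simp: zero_less_mult_iff)
            hence "k = 1" by simp
            thus "t = int p - s" using k by simp
          qed auto
          finally show ?thesis .
        qed
        thus ?thesis using s False by auto
      qed
      also have "(\<Sum>t\<in>{s, int p - s}. leg t) = leg s + leg (int p - s)"
        using odd_p by (subst sum.insert) (auto, presburger)
      also have "leg (int p - s) = leg s"
        using leg_cong[of "int p - s" "- s"] leg_minus[of s] by (simp add: cong_iff_dvd_diff)
      finally show ?thesis by (simp add: algebra_simps)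
    qed
  qed
  also have "\<dots> = 2 * (int p - 1)" unfolding sum_distrib_left[symmetric] sum_leg_square ..
  finally show ?thesis using sum_leg by simp
qed

text \<open>
  Sum the preceding interpolation over \<open>a\<close>: the part with the factor \<open>leg a\<close> cancels.
\<close>

lemma jacobsthal_sum_of_squares:
  assumes g: "leg g = -1"
  shows "jacobsthal 1 ^ 2 + jacobsthal g ^ 2 = 4 * int p"
proof -
  let ?P = "jacobsthal 1 ^ 2 + jacobsthal g ^ 2" and ?M = "jacobsthal 1 ^ 2 - jacobsthal g ^ 2"
  have split: "residues_p = insert 0 {1..<int p}" using p_pos by auto
  have "2 * (2 * int p * (int p - 1)) = (\<Sum>a\<in>{1..<int p}. 2 * jacobsthal a ^ 2)"
    unfolding sum_jacobsthal_squares[symmetric] split by (simp add: jacobsthal_0 sum_distrib_left)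
  also have "\<dots> = (\<Sum>a\<in>{1..<int p}. ?P + leg a * ?M)"
    by (intro sum.cong refl jacobsthal_square[OF g]) (auto dest: zdvd_imp_le)
  also have "\<dots> = (int p - 1) * ?P + (\<Sum>a\<in>{1..<int p}. leg a) * ?M"
    using p_pos by (simp add: sum.distrib sum_distrib_right of_nat_diff)
  also have "(\<Sum>a\<in>{1..<int p}. leg a) = 0"
    using sum_leg leg_eq_0_iff[of 0] unfolding split by simp
  finally have "(int p - 1) * ?P = (int p - 1) * (4 * int p)" by (simp add: mult_ac)
  thus ?thesis using p_gt_1 by simp
qed

definition half_jacobsthal :: "int \<Rightarrow> int" where
  "half_jacobsthal a = (\<Sum>t\<in>{1..int n}. leg (t * (1 - a * t ^ 2)))"

lemma jacobsthal_half: "jacobsthal a = 2 * half_jacobsthal a"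
proof -
  let ?f = "\<lambda>t. leg (t * (1 - a * t ^ 2))"
  have "residues_p = insert 0 ({1..int n} \<union> {int n + 1..2 * int n})" using p_eq by auto
  hence "jacobsthal a = ?f 0 + (sum ?f {1..int n} + sum ?f {int n + 1..2 * int n})"
    unfolding jacobsthal_def by (simp add: sum.union_disjoint)
  also have "sum ?f {int n + 1..2 * int n} = sum ?f {1..int n}"
  proof (rule sum.reindex_bij_witness[of _ "\<lambda>t. int p - t" "\<lambda>t. int p - t"])
    fix t
    have "[(int p - t) * (1 - a * (int p - t) ^ 2) = (- t) * (1 - a * (- t) ^ 2)] (mod int p)"
      by (intro cong_mult cong_diff cong_pow cong_refl) (auto simp: cong_iff_dvd_diff)
    hence "?f (int p - t) = leg (- (t * (1 - a * t ^ 2)))" by (simp add: leg_cong)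
    thus "?f (int p - t) = ?f t" by (simp only: leg_minus)
  qed (auto simp: p_eq)
  finally show ?thesis using leg_eq_0_iff[of 0] by (simp add: half_jacobsthal_def)
qed

lemma parity_sum:
  "finite A \<Longrightarrow> (\<And>t. t \<in> A \<Longrightarrow> odd (f t :: int)) \<Longrightarrow> even (sum f A) \<longleftrightarrow> even (card A)"
  by (induction A rule: finite_induct) auto

lemma odd_leg: "\<not> int p dvd a \<Longrightarrow> odd (leg a)"
  using leg_cases[of a] leg_eq_0_iff[of a] by auto

text \<open>
  All summands except the vanishing one at \<open>t = 1\<close> are \<open>\<plusminus>1\<close>, and there are \<open>n - 1 = 2m - 1\<close> of them.
\<close>

lemma odd_half_jacobsthal_1: "odd (half_jacobsthal 1)"
proof -
  let ?f = "\<lambda>t. leg (t * (1 - 1 * t ^ 2))"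
  have "{1..int n} = insert 1 {2..int n}" using n_pos by auto
  hence "half_jacobsthal 1 = ?f 1 + sum ?f {2..int n}" unfolding half_jacobsthal_def by simp
  also have "?f 1 = 0" using leg_eq_0_iff[of 0] by simp
  finally have *: "half_jacobsthal 1 = sum ?f {2..int n}" by simp
  have "odd (?f t)" if t: "t \<in> {2..int n}" for t
  proof (rule odd_leg)
    have "\<not> int p dvd t" "\<not> int p dvd t - 1" "\<not> int p dvd t + 1"
      using t p_eq zdvd_imp_le[of "int p"] by fastforce+
    moreover have "t * (1 - 1 * t ^ 2) = - (t * ((t - 1) * (t + 1)))" by (simp add: power2_eq_square algebra_simps)
    ultimately show "\<not> int p dvd t * (1 - 1 * t ^ 2)" using prime_int_p by (simp add: prime_dvd_mult_iff)
  qed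
  hence "even (half_jacobsthal 1) \<longleftrightarrow> even (card {2..int n})" unfolding * by (intro parity_sum) auto
  also have "card {2..int n} = n - 1" by simp
  finally show ?thesis using n_eq m_pos by simp
qed

text \<open>
  Uniqueness of the representation of a prime as a sum of two squares, by Brahmagupta's identity.  After a
  change of sign of \<open>b\<close>, \<open>p\<close> divides \<open>x a - y b\<close>; this is not \<open>0\<close> by parity, so the other term of the identity is.
\<close>

lemma sum_of_squares_unique:
  fixes x y a b :: int
  assumes xy: "int p = x ^ 2 + y ^ 2" and ab: "int p = a ^ 2 + b ^ 2" and x: "odd x" and a: "odd a"
  shows "x ^ 2 = a ^ 2"
proof -
  have ev: "even b" "even y" using assms odd_p by (metis even_add even_of_nat_iff even_power pos2)+
  have "(x * a - y * b) * (x * a + y * b) = x ^ 2 * a ^ 2 - y ^ 2 * b ^ 2"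
    by (simp add: power2_eq_square algebra_simps)
  also have "\<dots> = int p * (x ^ 2 + a ^ 2 - int p)"
  proof -
    have "y ^ 2 = int p - x ^ 2" "b ^ 2 = int p - a ^ 2" using xy ab by auto
    thus ?thesis by (simp only:) (simp add: algebra_simps power2_eq_square)
  qed
  finally have "int p dvd (x * a - y * b) * (x * a + y * b)" by simp
  hence "int p dvd x * a - y * b \<or> int p dvd x * a + y * b" using prime_int_p by (simp add: prime_dvd_mult_iff)
  hence "int p dvd x * a - y * b \<or> int p dvd x * a - y * (- b)" by simp
  then obtain c where c: "c = b \<or> c = - b" "int p dvd x * a - y * c" by blast
  have ac: "int p = a ^ 2 + c ^ 2" "even c" using ab c ev by auto
  have id: "(x * a - y * c) ^ 2 + (x * c + y * a) ^ 2 = int p ^ 2"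
  proof -
    have "(x * a - y * c) ^ 2 + (x * c + y * a) ^ 2 = (x ^ 2 + y ^ 2) * (a ^ 2 + c ^ 2)"
      by (simp add: power2_eq_square algebra_simps)
    thus ?thesis using xy ac by (simp add: power2_eq_square)
  qed
  obtain k where k: "x * a - y * c = int p * k" using c by (auto elim: dvdE)
  have "k \<noteq> 0"
  proof
    assume "k = 0"
    hence "x * a = y * c" using k by simp
    thus False using x a ev by (metis even_mult_iff)
  qed
  hence "k ^ 2 \<ge> 1" by (simp add: int_one_le_iff_zero_less)
  hence "int p ^ 2 * 1 \<le> int p ^ 2 * k ^ 2" by (intro mult_left_mono) auto
  moreover have "(x * a - y * c) ^ 2 = int p ^ 2 * k ^ 2" unfolding k by (rule power_mult_distrib)
  ultimately have "(x * c + y * a) ^ 2 \<le> 0" using id by linarith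
  hence "x * c = - (y * a)" by simp
  hence "x ^ 2 * c ^ 2 = y ^ 2 * a ^ 2" by (metis power2_minus power_mult_distrib)
  moreover have "c ^ 2 = int p - a ^ 2" "y ^ 2 = int p - x ^ 2" using ac(1) xy by simp_all
  ultimately have "x ^ 2 * (int p - a ^ 2) = (int p - x ^ 2) * a ^ 2" by (simp only:)
  hence "int p * x ^ 2 = int p * a ^ 2" by (simp add: algebra_simps)
  thus ?thesis using p_pos by simp
qed

lemma jacobsthal_1_square:
  fixes x y :: int
  assumes "int p = x ^ 2 + y ^ 2" "odd x"
  shows "jacobsthal 1 ^ 2 = 4 * x ^ 2"
proof -
  obtain g where g: "leg g = -1" using nonresidue_exists .
  have "int p = half_jacobsthal 1 ^ 2 + half_jacobsthal g ^ 2"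
    using jacobsthal_sum_of_squares[OF g] unfolding jacobsthal_half by (simp add: power_mult_distrib)
  from sum_of_squares_unique[OF assms(1) this assms(2) odd_half_jacobsthal_1]
  show ?thesis unfolding jacobsthal_half by (simp add: power_mult_distrib)
qed

end

section \<open>Jacobsthal sums modulo the square of the prime\<close>

context prime_modulus
begin

lemma prime_dvd_choose_multiple:
  assumes "\<not> p dvd k" shows "p dvd ((p * M) choose k)"
proof -
  have k: "k > 0" using assms by (cases k) auto
  hence "k * ((p * M) choose k) = p * (M * ((p * M - 1) choose (k - 1)))"
    using binomial_absorption[of "k - 1" "p * M"] by simp
  hence "p dvd k * ((p * M) choose k)" by (metis dvd_triv_left)
  thus ?thesis using assms prime_dvd_mult_iff[OF prime_p] by blast
qed

end

context odd_prime_modulus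
begin

text \<open>
  The cofactor of \<open>a - b\<close> in \<open>a\<^sup>p - b\<^sup>p\<close> is congruent to \<open>p b\<^bsup>p-1\<^esup>\<close> modulo \<open>p\<close>.
\<close>

lemma cong_power_p:
  fixes a b :: int
  assumes "[a = b] (mod int p)"
  shows "[a ^ p = b ^ p] (mod int p ^ 2)"
proof -
  have "a ^ p - b ^ p = (a - b) * (\<Sum>i<p. b ^ (p - Suc i) * a ^ i)"
    by (rule power_diff_sumr2)
  moreover have "int p dvd a - b" using assms by (simp add: cong_iff_dvd_diff)
  moreover have "int p dvd (\<Sum>i<p. b ^ (p - Suc i) * a ^ i)"
  proof -
    have "[(\<Sum>i<p. b ^ (p - Suc i) * a ^ i) = (\<Sum>i<p. b ^ (p - 1))] (mod int p)"
    proof (rule cong_sum)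
      fix i assume "i \<in> {..<p}"
      hence "b ^ (p - Suc i) * b ^ i = b ^ (p - 1)" by (simp flip: power_add)
      moreover have "[b ^ (p - Suc i) * a ^ i = b ^ (p - Suc i) * b ^ i] (mod int p)"
        by (intro cong_mult cong_refl cong_pow assms)
      ultimately show "[b ^ (p - Suc i) * a ^ i = b ^ (p - 1)] (mod int p)" by simp
    qed
    from cong_dvd_iff[OF this] show ?thesis by simp
  qed
  ultimately have "int p ^ 2 dvd a ^ p - b ^ p" by (simp add: power2_eq_square mult_dvd_mono)
  thus ?thesis by (simp add: cong_iff_dvd_diff)
qed

lemma leg_power_p: "leg a ^ p = leg a"
  using leg_cases[of a] odd_p p_pos by auto

text \<open>
  Euler's criterion raised to the power \<open>p\<close>.
\<close>

lemma leg_cong_square: "[leg a = a ^ (p * n)] (mod int p ^ 2)"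
  using cong_power_p[OF leg_euler[of a]] leg_power_p[of a]
  by (simp add: power_mult[symmetric] mult.commute)

lemma fermat_int: "[a ^ p = a] (mod int p)" for a :: int
proof (cases "int p dvd a")
  case True
  hence "int p dvd a ^ p" using p_pos by (simp add: prime_dvd_power_iff[OF prime_int_p])
  thus ?thesis using True by (simp add: cong_iff_dvd_diff)
next
  case False
  have "[a ^ n * a ^ n * a = leg a * leg a * a] (mod int p)"
    by (intro cong_mult cong_refl cong_sym[OF leg_euler])
  moreover have "a ^ n * a ^ n * a = a ^ p" by (simp add: p_eq mult_2 power_add)
  ultimately show ?thesis using leg_square[OF False] by simp
qed

text \<open>
  Modulo \<open>p\<^sup>2\<close> the powers \<open>t\<^sup>p\<close> depend only on \<open>t\<close> modulo \<open>p\<close> and are roots of unity of order dividing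
  \<open>p - 1\<close>, so their power sums satisfy the usual orthogonality relation.
\<close>

lemma teichmueller_power_sum:
  assumes e: "e > 0"
  shows "[(\<Sum>t\<in>residues_p. (t ^ p) ^ e) = (if (p - 1) dvd e then int p - 1 else 0)] (mod int p ^ 2)"
proof (cases "(p - 1) dvd e")
  case True
  then obtain f where f: "e = (p - 1) * f" by (auto elim: dvdE)
  have one: "[(t ^ p) ^ e = 1] (mod int p ^ 2)" if t: "\<not> int p dvd t" for t
  proof -
    have "[t ^ n * t ^ n = leg t * leg t] (mod int p)" by (intro cong_mult cong_sym[OF leg_euler])
    moreover have "t ^ n * t ^ n = t ^ (p - 1)" by (simp add: p_eq mult_2 power_add)
    ultimately have "[t ^ (p - 1) = 1] (mod int p)" using leg_square[OF t] by (simp only:)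
    hence "[((t ^ (p - 1)) ^ p) ^ f = (1 ^ p) ^ f] (mod int p ^ 2)" by (intro cong_pow cong_power_p)
    moreover have "((t ^ (p - 1)) ^ p) ^ f = (t ^ p) ^ e" by (simp only: f power_mult[symmetric] mult_ac)
    ultimately show ?thesis by simp
  qed
  have "residues_p = insert 0 {1..<int p}" using p_pos by auto
  hence "(\<Sum>t\<in>residues_p. (t ^ p) ^ e) = (\<Sum>t\<in>{1..<int p}. (t ^ p) ^ e)"
    using e p_pos by (simp add: power_0_left)
  also have "[(\<Sum>t\<in>{1..<int p}. (t ^ p) ^ e) = (\<Sum>t\<in>{1..<int p}. 1)] (mod int p ^ 2)"
    by (intro cong_sum one) (auto dest: zdvd_imp_le)
  finally show ?thesis using True p_pos by (simp add: of_nat_diff)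
next
  case False
  obtain c :: int where c: "\<And>e. [c ^ e = 1] (mod int p) \<longleftrightarrow> (p - 1) dvd e"
    using primitive_root_exists by blast
  have nc: "\<not> int p dvd c"
  proof
    assume "int p dvd c"
    moreover have "[c ^ (p - 1) = 1] (mod int p)" using c[of "p - 1"] by simp
    moreover have "int p dvd c ^ (p - 1)" using \<open>int p dvd c\<close> p_gt_1 by (simp add: prime_dvd_power_iff[OF prime_int_p])
    ultimately have "int p dvd 1" using cong_dvd_iff[of "c ^ (p - 1)" 1 "int p"] by simp
    thus False using p_gt_1 by simp
  qed
  define f where "f t = (t ^ p) ^ e mod int p ^ 2" for t :: int
  define S where "S = (\<Sum>t\<in>residues_p. (t ^ p) ^ e)"
  have f: "[f t = (t ^ p) ^ e] (mod int p ^ 2)" for t by (simp add: f_def cong_def)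
  have per: "periodic f"
    unfolding periodic_def
  proof (intro allI impI)
    fix a b assume "[a = b] (mod int p)"
    hence "[(a ^ p) ^ e = (b ^ p) ^ e] (mod int p ^ 2)" by (intro cong_pow cong_power_p)
    thus "f a = f b" unfolding f_def cong_def .
  qed
  have "[S = (\<Sum>t\<in>residues_p. f t)] (mod int p ^ 2)"
    unfolding S_def by (intro cong_sum cong_sym[OF f])
  also have "(\<Sum>t\<in>residues_p. f t) = (\<Sum>t\<in>residues_p. f (c * t + 0))"
    by (rule sum_affine_reindex[OF per nc, symmetric])
  also have "[\<dots> = (\<Sum>t\<in>residues_p. ((c * t + 0) ^ p) ^ e)] (mod int p ^ 2)"
    by (intro cong_sum f)
  also have "(\<Sum>t\<in>residues_p. ((c * t + 0) ^ p) ^ e) = (c ^ p) ^ e * S"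
    unfolding S_def sum_distrib_left by (simp add: power_mult_distrib)
  finally have "int p ^ 2 dvd ((c ^ p) ^ e - 1) * S"
    by (simp add: cong_iff_dvd_diff dvd_diff_commute algebra_simps)
  moreover have "coprime (int p ^ 2) ((c ^ p) ^ e - 1)"
  proof -
    have "[(c ^ p) ^ e = c ^ e] (mod int p)" by (intro cong_pow fermat_int)
    moreover have "\<not> [c ^ e = 1] (mod int p)" using c[of e] False by simp
    ultimately have "\<not> [(c ^ p) ^ e = 1] (mod int p)" using cong_trans[OF cong_sym] by blast
    hence "\<not> int p dvd (c ^ p) ^ e - 1" by (simp add: cong_iff_dvd_diff)
    thus ?thesis using prime_int_p by (simp add: prime_imp_coprime)
  qed
  ultimately have "int p ^ 2 dvd S" by (simp add: coprime_dvd_mult_right_iff)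
  thus ?thesis using False by (simp add: S_def cong_0_iff)
qed

end

context prime_1_mod_4
begin

text \<open>
  The indices \<open>m(2s+1)\<close> are the exponents \<open>j\<close> for which \<open>2j + pn\<close> is a multiple of \<open>p - 1\<close>.
\<close>

definition quarter_binomial :: "nat \<Rightarrow> int" where
  "quarter_binomial s = int ((2 * p * m) choose (m * (2 * s + 1)))"

text \<open>
  Write the symbol as a power, replace \<open>t\<close> by \<open>t\<^sup>p\<close> and \<open>g\<close> by \<open>g\<^sup>p\<close>, expand by the binomial theorem, and apply
  orthogonality.
\<close>

lemma jacobsthal_cong_binomial_sum:
  "[jacobsthal g = (int p - 1) * (\<Sum>s<p. quarter_binomial s * (- (g ^ p)) ^ (m * (2 * s + 1)))] (mod int p ^ 2)"
proof -
  define N where "N = p * n"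
  define \<gamma> where "\<gamma> = - (g ^ p)"
  have N: "N = 2 * p * m" by (simp add: N_def n_eq)
  have Npos: "N > 0" using p_pos m_pos by (simp add: N)
  have summand: "[leg (t * (1 - g * t ^ 2)) = (\<Sum>j\<le>N. int (N choose j) * \<gamma> ^ j * (t ^ p) ^ (2 * j + N))] (mod int p ^ 2)" for t
  proof -
    define \<tau> where "\<tau> = t ^ p"
    have "[\<tau> * (1 + \<gamma> * \<tau> ^ 2) = t * (1 + - g * t ^ 2)] (mod int p)"
      unfolding \<tau>_def \<gamma>_def by (intro cong_mult cong_add cong_refl cong_pow fermat_int) (simp add: cong_minus_minus_iff fermat_int)
    hence "leg (t * (1 - g * t ^ 2)) = leg (\<tau> * (1 + \<gamma> * \<tau> ^ 2))" by (intro leg_cong) (simp add: cong_sym)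
    also have "[\<dots> = (\<tau> * (1 + \<gamma> * \<tau> ^ 2)) ^ N] (mod int p ^ 2)" unfolding N_def by (rule leg_cong_square)
    also have "(\<tau> * (1 + \<gamma> * \<tau> ^ 2)) ^ N = \<tau> ^ N * (\<gamma> * \<tau> ^ 2 + 1) ^ N" by (simp add: power_mult_distrib add.commute)
    also have "(\<gamma> * \<tau> ^ 2 + 1) ^ N = (\<Sum>j\<le>N. int (N choose j) * (\<gamma> * \<tau> ^ 2) ^ j)"
      by (simp add: binomial_ring)
    also have "\<tau> ^ N * \<dots> = (\<Sum>j\<le>N. int (N choose j) * \<gamma> ^ j * \<tau> ^ (2 * j + N))"
      unfolding sum_distrib_left
    proof (intro sum.cong refl)
      fix j
      have "(\<gamma> * \<tau> ^ 2) ^ j = \<gamma> ^ j * \<tau> ^ (2 * j)" by (simp only: power_mult_distrib power_mult)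
      thus "\<tau> ^ N * (int (N choose j) * (\<gamma> * \<tau> ^ 2) ^ j) = int (N choose j) * \<gamma> ^ j * \<tau> ^ (2 * j + N)"
        by (simp only: power_add mult_ac)
    qed
    finally show ?thesis unfolding \<tau>_def .
  qed
  have "[jacobsthal g = (\<Sum>t\<in>residues_p. \<Sum>j\<le>N. int (N choose j) * \<gamma> ^ j * (t ^ p) ^ (2 * j + N))] (mod int p ^ 2)"
    unfolding jacobsthal_def by (intro cong_sum summand)
  also have "(\<Sum>t\<in>residues_p. \<Sum>j\<le>N. int (N choose j) * \<gamma> ^ j * (t ^ p) ^ (2 * j + N))
      = (\<Sum>j\<le>N. int (N choose j) * \<gamma> ^ j * (\<Sum>t\<in>residues_p. (t ^ p) ^ (2 * j + N)))"
    by (subst sum.swap) (simp add: sum_distrib_left)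
  also have "[\<dots> = (\<Sum>j\<le>N. int (N choose j) * \<gamma> ^ j * (if (p - 1) dvd 2 * j + N then int p - 1 else 0))] (mod int p ^ 2)"
    using Npos by (intro cong_sum cong_mult cong_refl teichmueller_power_sum) auto
  also have "(\<Sum>j\<le>N. int (N choose j) * \<gamma> ^ j * (if (p - 1) dvd 2 * j + N then int p - 1 else 0))
      = (\<Sum>j\<in>{j \<in> {..N}. (p - 1) dvd 2 * j + N}. (int p - 1) * (int (N choose j) * \<gamma> ^ j))"
    by (subst sum.inter_filter) (auto intro!: sum.cong)
  also have "\<dots> = (\<Sum>s<p. (int p - 1) * (int (N choose (m * (2 * s + 1))) * \<gamma> ^ (m * (2 * s + 1))))"
  proof (rule sum.reindex_bij_betw[symmetric])
    show "bij_betw (\<lambda>s. m * (2 * s + 1)) {..<p} {j \<in> {..N}. (p - 1) dvd 2 * j + N}"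
      unfolding bij_betw_def
    proof
      show "inj_on (\<lambda>s. m * (2 * s + 1)) {..<p}" using m_pos by (auto simp: inj_on_def)
      have "(p - 1) dvd 2 * j + N \<longleftrightarrow> (\<exists>s. j = m * (2 * s + 1))" for j
      proof -
        have "2 * j + N = 2 * (j + m) + (4 * m) * (2 * m)" by (simp add: N p_eq_m algebra_simps)
        hence "(p - 1) dvd 2 * j + N \<longleftrightarrow> 4 * m dvd 2 * (j + m)"
          using dvd_add_left_iff[of "4 * m" "4 * m * (2 * m)" "2 * (j + m)"] by (simp add: p_eq_m add.assoc)
        also have "\<dots> \<longleftrightarrow> 2 * m dvd j + m"
          using dvd_mult_cancel1[of 2] nat_mult_dvd_cancel1[of 2 "2 * m" "j + m"] by simp
        also have "\<dots> \<longleftrightarrow> (\<exists>s. j = m * (2 * s + 1))"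
        proof
          assume "2 * m dvd j + m"
          then obtain k where k: "j + m = 2 * m * k" by (auto elim: dvdE)
          then obtain s where "k = Suc s" using m_pos by (cases k) auto
          thus "\<exists>s. j = m * (2 * s + 1)" using k by (intro exI[of _ s]) (simp add: algebra_simps)
        next
          assume "\<exists>s. j = m * (2 * s + 1)"
          then obtain s where "j = m * (2 * s + 1)" by blast
          hence "j + m = 2 * m * (s + 1)" by (simp add: algebra_simps)
          thus "2 * m dvd j + m" by simp
        qed
        finally show ?thesis .
      qed
      moreover have "m * (2 * s + 1) \<le> N \<longleftrightarrow> s < p" for s
      proof -
        have "m * (2 * s + 1) \<le> m * (2 * p) \<longleftrightarrow> s < p"
          unfolding nat_mult_le_cancel1[OF m_pos] by arith
        moreover have "m * (2 * p) = N" by (simp add: N)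
        ultimately show ?thesis by (simp only:)
      qed
      ultimately show "(\<lambda>s. m * (2 * s + 1)) ` {..<p} = {j \<in> {..N}. (p - 1) dvd 2 * j + N}" by auto
    qed
  qed
  finally show ?thesis unfolding quarter_binomial_def sum_distrib_left N \<gamma>_def .
qed

lemma jacobsthal_1_cong:
  "[jacobsthal 1 = (int p - 1) * (-1) ^ m * (\<Sum>s<p. quarter_binomial s)] (mod int p ^ 2)"
proof -
  have "(- 1 :: int) ^ (m * (2 * s + 1)) = (-1) ^ m" for s
    by (simp add: minus_one_power_iff)
  thus ?thesis using jacobsthal_cong_binomial_sum[of 1]
    by (simp add: sum_distrib_left mult_ac)
qed

text \<open>
  For a nonresidue, \<open>\<iota> = (-g\<^sup>p)\<^sup>m\<close> is a square root of \<open>-1\<close> modulo \<open>p\<^sup>2\<close>, so the terms of the binomial sum acquire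
  alternating signs and a common factor \<open>\<iota>\<close>.
\<close>

lemma jacobsthal_nonresidue_cong:
  assumes g: "leg g = -1"
  shows "[jacobsthal g ^ 2 = - ((int p - 1) ^ 2 * (\<Sum>s<p. (-1) ^ s * quarter_binomial s) ^ 2)] (mod int p ^ 2)"
proof -
  define \<iota> where "\<iota> = (- (g ^ p)) ^ m"
  define B where "B = (\<Sum>s<p. (-1) ^ s * quarter_binomial s)"
  have sq: "[\<iota> ^ 2 = -1] (mod int p ^ 2)"
  proof -
    have "\<iota> ^ 2 = ((- (g ^ p)) ^ 2) ^ m"
      unfolding \<iota>_def by (simp only: power_mult[symmetric] mult.commute)
    also have "\<dots> = (g ^ p) ^ n"
      unfolding power2_minus by (simp only: power_mult[symmetric] n_eq mult.assoc)
    also have "\<dots> = g ^ (p * n)" by (simp add: power_mult)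
    also have "[\<dots> = -1] (mod int p ^ 2)" using cong_sym[OF leg_cong_square[of g]] g by simp
    finally show ?thesis .
  qed
  have "[(\<Sum>s<p. quarter_binomial s * (- (g ^ p)) ^ (m * (2 * s + 1))) = (\<Sum>s<p. quarter_binomial s * ((-1) ^ s * \<iota>))] (mod int p ^ 2)"
  proof (intro cong_sum cong_mult cong_refl)
    fix s
    have "(- (g ^ p)) ^ (m * (2 * s + 1)) = (\<iota> ^ 2) ^ s * \<iota>"
    proof -
      have "(- (g ^ p)) ^ (m * (2 * s + 1)) = \<iota> ^ (2 * s + 1)" unfolding \<iota>_def by (simp only: power_mult)
      thus ?thesis by (simp only: power_add power_mult power_one_right)
    qed
    also have "[\<dots> = (-1) ^ s * \<iota>] (mod int p ^ 2)" by (intro cong_mult cong_pow sq cong_refl)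
    finally show "[(- (g ^ p)) ^ (m * (2 * s + 1)) = (-1) ^ s * \<iota>] (mod int p ^ 2)" .
  qed
  also have "(\<Sum>s<p. quarter_binomial s * ((-1) ^ s * \<iota>)) = \<iota> * B"
    by (simp add: B_def sum_distrib_left mult_ac)
  finally have "[(int p - 1) * (\<Sum>s<p. quarter_binomial s * (- (g ^ p)) ^ (m * (2 * s + 1))) = (int p - 1) * (\<iota> * B)] (mod int p ^ 2)"
    by (intro cong_mult cong_refl)
  hence "[jacobsthal g = (int p - 1) * (\<iota> * B)] (mod int p ^ 2)"
    using cong_trans[OF jacobsthal_cong_binomial_sum[of g]] by blast
  hence "[jacobsthal g ^ 2 = ((int p - 1) * (\<iota> * B)) ^ 2] (mod int p ^ 2)" by (rule cong_pow)
  also have "((int p - 1) * (\<iota> * B)) ^ 2 = \<iota> ^ 2 * ((int p - 1) ^ 2 * B ^ 2)" by (simp add: power_mult_distrib)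
  also have "[\<dots> = -1 * ((int p - 1) ^ 2 * B ^ 2)] (mod int p ^ 2)" by (intro cong_mult sq cong_refl)
  finally show ?thesis unfolding B_def by simp
qed

lemma prime_dvd_quarter_binomial:
  assumes "odd s" "s < p" shows "int p dvd quarter_binomial s"
proof -
  have np: "\<not> p dvd m * (2 * s + 1)"
  proof
    assume "p dvd m * (2 * s + 1)"
    moreover have "\<not> p dvd m" using m_pos p_eq_m by (auto dest: dvd_imp_le)
    ultimately have "p dvd 2 * s + 1" using prime_dvd_mult_iff[OF prime_p] by blast
    then obtain k where k: "2 * s + 1 = p * k" by (auto elim: dvdE)
    have "k < 2"
    proof (rule ccontr)
      assume "\<not> k < 2"
      hence "p * 2 \<le> p * k" by simp
      thus False using k assms(2) by linarith
    qed
    hence "k = 1" using k by (cases k) auto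
    hence "s = 2 * m" using k p_eq_m by simp
    thus False using assms by simp
  qed
  hence "p dvd ((p * (2 * m)) choose (m * (2 * s + 1)))" by (rule prime_dvd_choose_multiple)
  moreover have "p * (2 * m) = 2 * p * m" by simp
  ultimately show ?thesis unfolding quarter_binomial_def by (simp only: of_nat_dvd_iff)
qed

text \<open>
  Split the binomial sum into \<open>E\<close> (even \<open>s\<close>) and \<open>F\<close> (odd \<open>s\<close>).  The identity \<open>J(1)\<^sup>2 + J(g)\<^sup>2 = 4p\<close> becomes
  \<open>p \<equiv> (p-1)\<^sup>2 E F\<close>, which removes the mixed term from \<open>J(1)\<^sup>2 - 2p\<close>, and \<open>F\<^sup>2\<close> vanishes because \<open>p\<close> divides
  \<open>F\<close>.
\<close>

theorem sum_of_squares_cong: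
  fixes x y :: int
  assumes "int p = x ^ 2 + y ^ 2" "odd x"
  shows "[4 * x ^ 2 - 2 * int p = (int p - 1) ^ 2 * (\<Sum>a\<le>2*m. quarter_binomial (2 * a)) ^ 2] (mod int p ^ 2)"
proof -
  define P where "P = (int p - 1) ^ 2"
  define E where "E = (\<Sum>a\<le>2*m. quarter_binomial (2 * a))"
  define F where "F = (\<Sum>a<2*m. quarter_binomial (2 * a + 1))"
  obtain g where g: "leg g = -1" using nonresidue_exists .
  have split: "(\<Sum>s<2 * N + 1. h s) = (\<Sum>a\<le>N. h (2 * a)) + (\<Sum>a<N. h (2 * a + 1))" for N and h :: "nat \<Rightarrow> int"
    by (induction N) (simp_all add: algebra_simps)
  have p': "p = 2 * (2 * m) + 1" by (simp add: p_eq_m)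
  have EF: "(\<Sum>s<p. quarter_binomial s) = E + F" "(\<Sum>s<p. (-1) ^ s * quarter_binomial s) = E - F"
    unfolding E_def F_def using split[of "quarter_binomial" "2 * m"] split[of "\<lambda>s. (-1) ^ s * quarter_binomial s" "2 * m"]
    by (simp_all only: p' [symmetric]) (simp add: sum_negf)
  have F: "int p dvd F"
    unfolding F_def by (intro dvd_sum prime_dvd_quarter_binomial) (auto simp: p_eq_m)
  hence F2: "int p ^ 2 dvd F ^ 2" by simp
  have one: "[jacobsthal 1 ^ 2 = P * (E + F) ^ 2] (mod int p ^ 2)"
  proof -
    have "[jacobsthal 1 ^ 2 = ((int p - 1) * (-1) ^ m * (E + F)) ^ 2] (mod int p ^ 2)"
      using cong_pow[OF jacobsthal_1_cong, of 2] unfolding EF .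
    thus ?thesis by (simp add: power_mult_distrib P_def flip: power_mult)
  qed
  have two: "[jacobsthal g ^ 2 = - (P * (E - F) ^ 2)] (mod int p ^ 2)"
    using jacobsthal_nonresidue_cong[OF g] unfolding EF P_def .
  have "[4 * int p = P * (E + F) ^ 2 + - (P * (E - F) ^ 2)] (mod int p ^ 2)"
    using cong_add[OF one two] unfolding jacobsthal_sum_of_squares[OF g] .
  also have "P * (E + F) ^ 2 + - (P * (E - F) ^ 2) = 2 * (2 * (P * (E * F)))"
    by (simp add: power2_eq_square algebra_simps)
  finally have "[2 * (2 * int p) = 2 * (2 * (P * (E * F)))] (mod int p ^ 2)" by simp
  moreover have "coprime 2 (int p ^ 2)" using odd_p by simp
  ultimately have "[2 * int p = 2 * (P * (E * F))] (mod int p ^ 2)"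
    using cong_mult_lcancel by blast
  hence "[jacobsthal 1 ^ 2 - 2 * int p = P * (E + F) ^ 2 - 2 * (P * (E * F))] (mod int p ^ 2)"
    by (rule cong_diff[OF one])
  also have "P * (E + F) ^ 2 - 2 * (P * (E * F)) = P * E ^ 2 + P * F ^ 2"
    by (simp add: power2_eq_square algebra_simps)
  also have "[\<dots> = P * E ^ 2 + 0] (mod int p ^ 2)"
    using F2 by (intro cong_add cong_refl) (simp add: cong_0_iff)
  finally show ?thesis using jacobsthal_1_square[OF assms] by (simp add: P_def E_def)
qed

end

section \<open>Alternating sums of binomial coefficients about the centre\<close>

text \<open>
  \<open>C(2m, m-b) / C(2m, m)\<close> for \<open>b \<le> m\<close>.
\<close>

definition central_ratio :: "nat \<Rightarrow> nat \<Rightarrow> rat" where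
  "central_ratio m b = fact m ^ 2 / (fact (m - b) * fact (m + b))"

lemma central_ratio_0: "central_ratio m 0 = 1"
  by (simp add: central_ratio_def power2_eq_square)

lemma choose_central_ratio:
  assumes "b \<le> m"
  shows "rat_of_nat ((2 * m) choose (m - b)) = of_nat ((2 * m) choose m) * central_ratio m b"
proof -
  have "2 * m - (m - b) = m + b" using assms by simp
  thus ?thesis using assms by (simp add: binomial_fact central_ratio_def power2_eq_square mult_ac)
qed

lemma central_ratio_step_b:
  assumes "b < m"
  shows "(of_nat m + of_nat b + 1) * central_ratio m (Suc b) = (of_nat m - of_nat b) * central_ratio m b"
proof -
  have "fact (m - b) = (of_nat m - of_nat b) * (fact (m - Suc b) :: rat)"
    using assms by (metis Suc_diff_Suc fact_Suc less_imp_le of_nat_diff of_nat_fact of_nat_mult)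
  moreover have "fact (m + Suc b) = (of_nat m + of_nat b + 1) * (fact (m + b) :: rat)"
    by (simp add: algebra_simps)
  moreover have "of_nat m - of_nat b \<noteq> (0::rat)" "of_nat m + of_nat b + 1 \<noteq> (0::rat)"
    using assms by (simp, metis add.commute of_nat_Suc of_nat_add of_nat_eq_0_iff add_Suc_right nat.distinct(1))
  moreover have "Y * (T / (A * (Y * B))) = X * (T / ((X * A) * B))" if "X \<noteq> 0" "Y \<noteq> 0" for X Y T A B :: rat
    using that by simp
  ultimately show ?thesis unfolding central_ratio_def by (simp only: not_False_eq_True)
qed

lemma central_ratio_step_m:
  assumes "b \<le> m"
  shows "(of_nat (Suc m) ^ 2 - of_nat b ^ 2) * central_ratio (Suc m) b = of_nat (Suc m) ^ 2 * central_ratio m b"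
proof -
  have 1: "fact (Suc m - b) = (of_nat (Suc m) - of_nat b) * (fact (m - b) :: rat)"
    using assms by (simp add: Suc_diff_le of_nat_diff algebra_simps)
  have 2: "fact (Suc m + b) = (of_nat (Suc m) + of_nat b) * (fact (m + b) :: rat)"
    by (simp add: algebra_simps)
  have 3: "of_nat (Suc m) ^ 2 - of_nat b ^ 2 = (of_nat (Suc m) - of_nat b) * (of_nat (Suc m) + of_nat b :: rat)"
    by (simp add: power2_eq_square algebra_simps)
  have 4: "of_nat (Suc m) - of_nat b \<noteq> (0::rat)" "of_nat (Suc m) + of_nat b \<noteq> (0::rat)"
    using assms of_nat_eq_iff[of "Suc m" b, where 'a = rat] of_nat_eq_0_iff[of "Suc m + b", where 'a = rat]
    by (auto simp del: of_nat_eq_0_iff of_nat_eq_iff simp flip: of_nat_add)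
  have 5: "fact (Suc m) ^ 2 = of_nat (Suc m) ^ 2 * (fact m ^ 2 :: rat)"
    by (simp add: power_mult_distrib)
  have "(X * Y) * (T * F / ((X * A) * (Y * B))) = T * (F / (A * B))" if "X \<noteq> 0" "Y \<noteq> 0" for X Y T F A B :: rat
    using that by simp
  thus ?thesis unfolding central_ratio_def 1 2 3 5 using 4 by blast
qed

text \<open>
  Summation in closed form for every upper bound \<open>B\<close>; the boundary term vanishes at \<open>B = m\<close>.
\<close>

lemma alternating_central_partial:
  assumes "m > 0" "B \<le> m"
  shows "(\<Sum>b\<in>{1..B}. (-1) ^ (b + 1) * central_ratio m b)
    = 1 / 2 + (-1) ^ (B + 1) * (of_nat m - of_nat B) / (2 * of_nat m) * central_ratio m B"
  using assms(2)
proof (induction B)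
  case 0 show ?case using assms(1) by (simp add: central_ratio_0)
next
  case (Suc B)
  define r r' M K s where d: "r = central_ratio m B" "r' = central_ratio m (Suc B)" "M = rat_of_nat m" "K = rat_of_nat B"
    "s = (-1 :: rat) ^ B"
  have M: "M \<noteq> 0" using assms(1) by (simp add: d)
  have step: "(M + K + 1) * r' = (M - K) * r" using central_ratio_step_b[of B m] Suc.prems by (simp add: d)
  have IH: "(\<Sum>b\<in>{1..B}. (-1) ^ (b + 1) * central_ratio m b) = 1 / 2 - s * ((M - K) * r) / (2 * M)"
    using Suc by (simp add: d)
  have "(\<Sum>b\<in>{1..Suc B}. (-1) ^ (b + 1) * central_ratio m b) = 1 / 2 - s * ((M + K + 1) * r') / (2 * M) + s * r'"
    using IH unfolding step by (simp add: d)
  also have "\<dots> = 1 / 2 + s * (M - (K + 1)) / (2 * M) * r'"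
    using M by (simp add: field_simps)
  finally show ?case by (simp add: d algebra_simps)
qed

text \<open>
  The antidifference is found by Gosper's algorithm; again its boundary term vanishes at \<open>B = m\<close>.
\<close>

lemma alternating_weighted_central_partial:
  assumes "m > 0" "B \<le> m"
  shows "(\<Sum>b\<in>{1..B}. (-1) ^ (b + 1) * of_nat b * central_ratio m b)
    = of_nat m / (2 * (2 * of_nat m - 1)) + (-1) ^ (B + 1) * (of_nat m - of_nat B) * (2 * of_nat B + 1) / (2 * (2 * of_nat m - 1)) * central_ratio m B"
  using assms(2)
proof (induction B)
  case 0 show ?case by (simp add: central_ratio_0)
next
  case (Suc B)
  define r r' M K s D where d: "r = central_ratio m B" "r' = central_ratio m (Suc B)" "M = rat_of_nat m" "K = rat_of_nat B"
    "s = (-1 :: rat) ^ B" "D = 2 * (2 * M - 1)"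
  have D: "D \<noteq> 0"
  proof -
    have "2 * M - 1 = of_nat (2 * m - 1)" using assms(1) by (simp add: d of_nat_diff)
    moreover have "2 * m - 1 \<noteq> 0" using assms(1) by simp
    ultimately have "2 * M - 1 \<noteq> 0" by (simp only: of_nat_eq_0_iff not_False_eq_True)
    thus ?thesis by (simp add: d(6))
  qed
  have step: "(M + K + 1) * r' = (M - K) * r" using central_ratio_step_b[of B m] Suc.prems by (simp add: d)
  have IH: "(\<Sum>b\<in>{1..B}. (-1) ^ (b + 1) * of_nat b * central_ratio m b) = M / D - s * (2 * K + 1) * ((M - K) * r) / D"
    using Suc by (simp add: d mult_ac)
  have "(\<Sum>b\<in>{1..Suc B}. (-1) ^ (b + 1) * of_nat b * central_ratio m b)
      = M / D - s * (2 * K + 1) * ((M + K + 1) * r') / D + s * (K + 1) * r'"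
    using IH unfolding step by (simp add: d algebra_simps)
  also have "s * (K + 1) * r' = s * (K + 1) * r' * D / D" using D by simp
  also have "M / D - s * (2 * K + 1) * ((M + K + 1) * r') / D + s * (K + 1) * r' * D / D
      = M / D + s * (M - (K + 1)) * (2 * (K + 1) + 1) / D * r'"
    unfolding diff_divide_distrib[symmetric] add_divide_distrib[symmetric] times_divide_eq_left
    by (rule arg_cong[of _ _ "\<lambda>t. t / D"]) (simp add: d(6) algebra_simps)
  finally show ?case by (simp add: d algebra_simps)
qed

lemma quarter_harm_Suc:
  "quarter_harm (Suc m) = quarter_harm m + 1 / (2 * of_nat (Suc m) * (2 * of_nat (Suc m) - 1))"
proof -
  define x :: rat where "x = of_nat m"
  have x: "x \<ge> 0" by (simp add: x_def)
  have "{Suc m + 1..2 * Suc m} \<union> {m + 1} = {m + 1..2 * m} \<union> {2 * m + 1, 2 * m + 2}" by auto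
  hence "(\<Sum>k\<in>{Suc m + 1..2 * Suc m} \<union> {m + 1}. 1 / rat_of_nat k) = (\<Sum>k\<in>{m + 1..2 * m} \<union> {2 * m + 1, 2 * m + 2}. 1 / rat_of_nat k)"
    by simp
  hence "quarter_harm (Suc m) + 1 / (x + 1) = quarter_harm m + (1 / (2 * x + 1) + 1 / (2 * x + 2))"
    unfolding quarter_harm_def x_def by (subst (asm) (1 2) sum.union_disjoint) (auto simp: add_ac)
  hence "quarter_harm (Suc m) = quarter_harm m + (1 / (2 * x + 1) + 1 / (2 * x + 2) - 1 / (x + 1))" by simp
  also have "1 / (2 * x + 1) + 1 / (2 * x + 2) - 1 / (x + 1) = 1 / (2 * (x + 1) * (2 * (x + 1) - 1))"
  proof -
    define u v where "u = 2 * x + 1" and "v = x + 1"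
    have nz: "u \<noteq> 0" "v \<noteq> 0" using x by (auto simp: u_def v_def)
    have "1 / u + 1 / (2 * v) - 1 / v = (2 * v - u) / (2 * v * u)" using nz by (simp add: divide_simps)
    also have "2 * v - u = 1" by (simp add: u_def v_def)
    finally show ?thesis by (simp add: u_def v_def algebra_simps)
  qed
  finally show ?thesis by (simp add: x_def add_ac)
qed

text \<open>
  Induction on \<open>m\<close>.  Since \<open>central_ratio m b = (1 - b\<^sup>2/(m+1)\<^sup>2) central_ratio (m+1) b\<close>, also for \<open>b = m + 1\<close> when the
  left side is read as \<open>0\<close>, the difference of consecutive sums is a weighted sum of the kind just evaluated.
\<close>

lemma alternating_central_harm:
  "(\<Sum>b\<in>{1..m}. (-1) ^ (b + 1) / of_nat b * central_ratio m b) = quarter_harm m"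
proof (induction m)
  case 0 show ?case by (simp add: quarter_harm_def)
next
  case (Suc m)
  let ?M = "rat_of_nat (Suc m)"
  have M: "?M \<noteq> 0" by simp
  have "(\<Sum>b\<in>{1..m}. (-1) ^ (b + 1) / of_nat b * central_ratio m b)
      = (\<Sum>b\<in>{1..m}. (-1) ^ (b + 1) / of_nat b * ((?M ^ 2 - of_nat b ^ 2) * central_ratio (Suc m) b / ?M ^ 2))"
  proof (intro sum.cong refl)
    fix b assume "b \<in> {1..m}"
    thus "(-1) ^ (b + 1) / of_nat b * central_ratio m b
        = (-1) ^ (b + 1) / of_nat b * ((?M ^ 2 - of_nat b ^ 2) * central_ratio (Suc m) b / ?M ^ 2)"
      using central_ratio_step_m[of b m] by (simp del: of_nat_Suc)
  qed
  also have "\<dots> = (\<Sum>b\<in>{1..Suc m}. (-1) ^ (b + 1) / of_nat b * ((?M ^ 2 - of_nat b ^ 2) * central_ratio (Suc m) b / ?M ^ 2))"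
    by simp
  also have "\<dots> = (\<Sum>b\<in>{1..Suc m}. (-1) ^ (b + 1) / of_nat b * central_ratio (Suc m) b
      - (-1) ^ (b + 1) * of_nat b * central_ratio (Suc m) b / ?M ^ 2)"
  proof (intro sum.cong refl)
    fix b assume "b \<in> {1..Suc m}"
    hence "rat_of_nat b \<noteq> 0" by simp
    thus "(-1) ^ (b + 1) / of_nat b * ((?M ^ 2 - of_nat b ^ 2) * central_ratio (Suc m) b / ?M ^ 2)
      = (-1) ^ (b + 1) / of_nat b * central_ratio (Suc m) b - (-1) ^ (b + 1) * of_nat b * central_ratio (Suc m) b / ?M ^ 2"
      using M by (simp add: divide_simps del: of_nat_Suc) (simp add: power2_eq_square algebra_simps del: of_nat_Suc)
  qed
  also have "\<dots> = (\<Sum>b\<in>{1..Suc m}. (-1) ^ (b + 1) / of_nat b * central_ratio (Suc m) b)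
      - (\<Sum>b\<in>{1..Suc m}. (-1) ^ (b + 1) * of_nat b * central_ratio (Suc m) b) / ?M ^ 2"
    unfolding sum_subtractf sum_divide_distrib ..
  also have "(\<Sum>b\<in>{1..Suc m}. (-1) ^ (b + 1) * of_nat b * central_ratio (Suc m) b) = ?M / (2 * (2 * ?M - 1))"
    by (subst alternating_weighted_central_partial) simp_all
  finally have "(\<Sum>b\<in>{1..Suc m}. (-1) ^ (b + 1) / of_nat b * central_ratio (Suc m) b)
      = quarter_harm m + ?M / (2 * (2 * ?M - 1)) / ?M ^ 2" unfolding Suc.IH by (simp only: eq_diff_eq)
  also have "?M / (2 * (2 * ?M - 1)) / ?M ^ 2 = 1 / (2 * ?M * (2 * ?M - 1))"
    using M by (simp add: power2_eq_square mult_ac del: of_nat_Suc)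
  finally show ?case unfolding quarter_harm_Suc .
qed

lemma alternating_central_sum:
  assumes "m > 0"
  shows "(\<Sum>b\<in>{1..m}. (-1) ^ (b + 1) * of_nat ((2 * m) choose (m - b)) * ((of_nat m + of_nat b) / of_nat b))
    = of_nat ((2 * m) choose m) * (1 / 2 + of_nat m * quarter_harm m)"
proof -
  let ?C = "rat_of_nat ((2 * m) choose m)"
  have "(\<Sum>b\<in>{1..m}. (-1) ^ (b + 1) * of_nat ((2 * m) choose (m - b)) * ((of_nat m + of_nat b) / of_nat b))
    = (\<Sum>b\<in>{1..m}. ?C * ((-1) ^ (b + 1) * central_ratio m b + of_nat m * ((-1) ^ (b + 1) / of_nat b * central_ratio m b)))"
  proof (intro sum.cong refl)
    fix b assume b: "b \<in> {1..m}"
    hence "(rat_of_nat m + of_nat b) / of_nat b = 1 + of_nat m / of_nat b" by (simp add: add_divide_distrib)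
    thus "(-1) ^ (b + 1) * of_nat ((2 * m) choose (m - b)) * ((of_nat m + of_nat b) / of_nat b)
      = ?C * ((-1) ^ (b + 1) * central_ratio m b + of_nat m * ((-1) ^ (b + 1) / of_nat b * central_ratio m b))"
      using b by (simp add: choose_central_ratio) (simp add: algebra_simps)
  qed
  also have "\<dots> = ?C * ((\<Sum>b\<in>{1..m}. (-1) ^ (b + 1) * central_ratio m b)
      + of_nat m * (\<Sum>b\<in>{1..m}. (-1) ^ (b + 1) / of_nat b * central_ratio m b))"
    unfolding sum_distrib_left[symmetric] sum.distrib ..
  also have "(\<Sum>b\<in>{1..m}. (-1) ^ (b + 1) * central_ratio m b) = 1 / 2"
    by (subst alternating_central_partial[OF assms]) simp_all
  finally show ?thesis unfolding alternating_central_harm .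
qed

section \<open>Binomial coefficients near multiples of the prime\<close>

context prime_modulus
begin

text \<open>
  Vandermonde's convolution for \<open>p + pM\<close>: apart from the two ends, both factors of each summand are divisible
  by \<open>p\<close>.
\<close>

lemma choose_multiples_cong:
  "[(p * M) choose (p * a) = M choose a] (mod p ^ 2)"
proof (induction M arbitrary: a)
  case 0
  show ?case using p_pos by (cases a) (simp_all add: binomial_eq_0)
next
  case (Suc M)
  show ?case
  proof (cases a)
    case (Suc a')
    have le: "p \<le> p * a" using Suc by simp
    let ?f = "\<lambda>j. (p choose j) * ((p * M) choose (p * a - j))"
    have "(p * Suc M) choose (p * a) = (\<Sum>j\<le>p * a. ?f j)"
      using vandermonde[of p "p * M" "p * a"] by simp
    also have "{..p * a} = {0, p} \<union> ({..p * a} - {0, p})" using le by auto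
    also have "sum ?f \<dots> = sum ?f {0, p} + sum ?f ({..p * a} - {0, p})"
      by (rule sum.union_disjoint) auto
    also have "[\<dots> = ((M choose a) + (M choose a')) + 0] (mod p ^ 2)"
    proof (rule cong_add)
      have "sum ?f {0, p} = ((p * M) choose (p * a)) + ((p * M) choose (p * a'))"
        using p_pos Suc by simp
      thus "[sum ?f {0, p} = (M choose a) + (M choose a')] (mod p ^ 2)"
        using cong_add[OF Suc.IH Suc.IH] by simp
      have "p ^ 2 dvd sum ?f ({..p * a} - {0, p})"
      proof (rule dvd_sum)
        fix j assume j: "j \<in> {..p * a} - {0, p}"
        show "p ^ 2 dvd ?f j"
        proof (cases "j < p")
          case True
          hence nj: "\<not> p dvd j" using j by (auto dest: dvd_imp_le)
          hence "\<not> p dvd p * a - j" using j dvd_diffD1[of p "p * a" j] by auto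
          hence "p dvd ((p * M) choose (p * a - j))" by (rule prime_dvd_choose_multiple)
          moreover have "p dvd (p choose j)" using prime_dvd_choose_multiple[OF nj, of 1] by simp
          ultimately show ?thesis unfolding power2_eq_square by (rule mult_dvd_mono[rotated])
        next
          case False
          hence "p < j" using j by auto
          thus ?thesis by (simp add: binomial_eq_0)
        qed
      qed
      thus "[sum ?f ({..p * a} - {0, p}) = 0] (mod p ^ 2)" by (simp add: cong_0_iff)
    qed
    finally show ?thesis using Suc by (simp add: add.commute)
  qed simp
qed

lemma choose_multiples_rat_cong:
  "rat_cong p 2 (of_nat ((p * M) choose (p * a))) (of_nat (M choose a))"
proof -
  have "[int ((p * M) choose (p * a)) = int (M choose a)] (mod int p ^ 2)"
    using choose_multiples_cong[of M a] cong_int_iff[of "(p * M) choose (p * a)" "M choose a" "p ^ 2"] by simp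
  thus ?thesis using rat_cong_of_int_iff[of 2 "int ((p * M) choose (p * a))" "int (M choose a)"] by simp
qed

text \<open>
  A term that already carries a factor \<open>p\<close> is needed only to first order in its other factors.
\<close>

lemma rat_cong_drop_p:
  assumes "p_integral y" "p_integral z"
  shows "rat_cong p 2 (of_nat p * z * (of_nat p * y + c)) (of_nat p * z * c)"
proof -
  have "of_nat p * z * (of_nat p * y + c) = of_nat p ^ 2 * (z * y) + of_nat p * z * c"
    by (simp add: power2_eq_square algebra_simps)
  also have "rat_cong p 2 \<dots> (0 + of_nat p * z * c)"
    using assms by (intro rat_cong_add rat_cong_0I rat_cong_refl) auto
  finally show ?thesis by simp
qed

text \<open>
  Going from \<open>pa + b\<close> to \<open>pa + b + 1\<close> multiplies the binomial coefficient by \<open>(p(M-a) - b)/(pa + b + 1)\<close>.  The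
  first step contributes the factor \<open>p\<close>; in the later ones the multiples of \<open>p\<close> can therefore be dropped.
\<close>

lemma choose_near_multiple:
  assumes "a < M"
  shows "Suc b < p \<Longrightarrow> rat_cong p 2 (of_nat ((p * M) choose (p * a + Suc b)))
     (of_nat p * ((-1) ^ b * (of_nat M - of_nat a) * of_nat (M choose a)) * (1 / of_nat (Suc b)))"
proof (induction b)
  case 0
  let ?u = "of_nat p * of_nat a + 1 :: rat"
  have u: "p_unit ?u" using p_unit_one_plus_p[of "of_nat a"] by (simp add: add.commute)
  have "(p * a + 1) * ((p * M) choose (p * a + 1)) = (p * M - p * a) * ((p * M) choose (p * a))"
    by (metis Suc_eq_plus1 binomial_absorb_comp binomial_absorption)
  hence "of_nat (p * a + 1) * rat_of_nat ((p * M) choose (p * a + 1)) = of_nat (p * M - p * a) * of_nat ((p * M) choose (p * a))"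
    by (metis of_nat_mult)
  also have "rat_of_nat (p * M - p * a) = of_nat p * (of_nat M - of_nat a)"
    using assms by (simp add: of_nat_diff algebra_simps)
  finally have "?u * rat_of_nat ((p * M) choose (p * a + 1)) = of_nat p * (of_nat M - of_nat a) * of_nat ((p * M) choose (p * a))"
    by (simp add: add.commute)
  also have "rat_cong p 2 \<dots> (of_nat p * (of_nat M - of_nat a) * of_nat (M choose a))"
    by (intro rat_cong_scale choose_multiples_rat_cong) auto
  also have "rat_of_nat p * (of_nat M - of_nat a) * of_nat (M choose a) = of_nat p * ((of_nat M - of_nat a) * of_nat (M choose a)) * 1"
    by simp
  also have "rat_cong p 2 \<dots> (of_nat p * ((of_nat M - of_nat a) * of_nat (M choose a)) * (of_nat p * of_nat a + 1))"
    by (rule rat_cong_sym, rule rat_cong_drop_p) auto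
  also have "\<dots> = ?u * (of_nat p * ((of_nat M - of_nat a) * of_nat (M choose a)))" by (simp only: mult_ac)
  finally show ?case using rat_cong_cancel[OF u] by simp
next
  case (Suc b)
  define z where "z = (-1) ^ b * (of_nat M - of_nat a) * rat_of_nat (M choose a)"
  have z: "p_integral z" unfolding z_def by (intro p_integral_mult p_integral_power p_integral_uminus p_integral_diff) auto
  let ?P = "of_nat p :: rat"
  let ?u = "?P * of_nat a + of_nat (Suc (Suc b)) :: rat"
  have u1: "p_unit (of_nat (Suc b))" and u2: "p_unit (of_nat (Suc (Suc b)))"
    using Suc.prems by (auto intro!: p_unit_of_nat_less simp del: of_nat_Suc)
  have u: "p_unit ?u"
  proof -
    have "p_unit (of_nat (Suc (Suc b)) * (1 + ?P * (of_nat a / of_nat (Suc (Suc b)))))"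
      using u2 by (intro p_unit_mult p_unit_one_plus_p p_integral_divide) auto
    moreover have "of_nat (Suc (Suc b)) * (1 + ?P * (of_nat a / of_nat (Suc (Suc b)))) = ?u"
      using p_unit_nonzero[OF u2] by (simp add: field_simps del: of_nat_Suc)
    ultimately show ?thesis by simp
  qed
  have IH: "rat_cong p 2 (of_nat ((p * M) choose (p * a + Suc b))) (?P * z * (1 / of_nat (Suc b)))"
    using Suc unfolding z_def by simp
  have le: "p * a + Suc b \<le> p * M"
  proof -
    have "p * Suc a \<le> p * M" using assms by (intro mult_le_mono2) simp
    thus ?thesis using Suc.prems by simp
  qed
  have "(p * a + Suc (Suc b)) * ((p * M) choose (p * a + Suc (Suc b)))
      = (p * M - (p * a + Suc b)) * ((p * M) choose (p * a + Suc b))"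
    by (metis add_Suc_right binomial_absorb_comp binomial_absorption)
  hence "of_nat (p * a + Suc (Suc b)) * rat_of_nat ((p * M) choose (p * a + Suc (Suc b)))
      = of_nat (p * M - (p * a + Suc b)) * of_nat ((p * M) choose (p * a + Suc b))"
    by (metis of_nat_mult)
  also have "rat_of_nat (p * M - (p * a + Suc b)) = ?P * (of_nat M - of_nat a) + (- of_nat (Suc b))"
    using le by (simp add: of_nat_diff algebra_simps)
  finally have "?u * rat_of_nat ((p * M) choose (p * a + Suc (Suc b)))
      = (?P * (of_nat M - of_nat a) + (- of_nat (Suc b))) * of_nat ((p * M) choose (p * a + Suc b))"
    by (simp only: of_nat_add of_nat_mult)
  also have "rat_cong p 2 \<dots> ((?P * (of_nat M - of_nat a) + (- of_nat (Suc b))) * (?P * z * (1 / of_nat (Suc b))))"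
    by (intro rat_cong_scale IH p_integral_add p_integral_mult p_integral_diff p_integral_uminus p_integral_of_nat)
  also have "\<dots> = ?P * (z * (1 / of_nat (Suc b))) * (?P * (of_nat M - of_nat a) + (- of_nat (Suc b)))"
    by (simp only: mult_ac)
  also have "rat_cong p 2 \<dots> (?P * (z * (1 / of_nat (Suc b))) * (- of_nat (Suc b)))"
    using z p_unit_imp_integral[OF p_unit_inverse[OF u1]] by (intro rat_cong_drop_p p_integral_mult p_integral_diff p_integral_of_nat)
  also have "?P * (z * (1 / of_nat (Suc b))) * (- of_nat (Suc b)) = ?P * (- z * (1 / of_nat (Suc (Suc b)))) * of_nat (Suc (Suc b))"
    using p_unit_nonzero[OF u1] p_unit_nonzero[OF u2] by (simp del: of_nat_Suc)
  also have "rat_cong p 2 \<dots> (?P * (- z * (1 / of_nat (Suc (Suc b)))) * (?P * of_nat a + of_nat (Suc (Suc b))))"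
    using z p_unit_imp_integral[OF p_unit_inverse[OF u2]]
    by (intro rat_cong_sym[OF rat_cong_drop_p] p_integral_mult p_integral_uminus p_integral_of_nat)
  also have "\<dots> = ?u * (?P * (- z) * (1 / of_nat (Suc (Suc b))))" by (simp only: mult_ac)
  finally have "rat_cong p 2 (of_nat ((p * M) choose (p * a + Suc (Suc b)))) (?P * (- z) * (1 / of_nat (Suc (Suc b))))"
    by (rule rat_cong_cancel[OF u])
  thus ?case by (simp add: z_def)
qed

end

lemma sum_symmetric_about:
  fixes f :: "nat \<Rightarrow> 'a :: comm_monoid_add"
  shows "(\<Sum>a\<le>2*m. f a) = f m + (\<Sum>b\<in>{1..m}. f (m - b) + f (m + b))"
proof -
  have "{..2*m} = {m} \<union> ({..<m} \<union> {m+1..2*m})" by auto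
  hence "(\<Sum>a\<le>2*m. f a) = sum f ({m} \<union> ({..<m} \<union> {m+1..2*m}))" by (simp only:)
  also have "\<dots> = sum f {m} + sum f ({..<m} \<union> {m+1..2*m})" by (rule sum.union_disjoint) auto
  also have "sum f ({..<m} \<union> {m+1..2*m}) = sum f {..<m} + sum f {m+1..2*m}" by (rule sum.union_disjoint) auto
  also have "sum f {..<m} = (\<Sum>b\<in>{1..m}. f (m - b))"
    by (rule sum.reindex_bij_witness[of _ "\<lambda>b. m - b" "\<lambda>a. m - a"]) auto
  also have "sum f {m+1..2*m} = (\<Sum>b\<in>{1..m}. f (m + b))"
    by (rule sum.reindex_bij_witness[of _ "\<lambda>b. m + b" "\<lambda>a. a - m"]) auto
  finally show ?thesis by (simp add: sum.distrib)
qed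

context prime_1_mod_4
begin

lemma quarter_binomial_center: "rat_cong p 2 (of_int (quarter_binomial (2 * m))) (of_nat ((2 * m) choose m))"
proof -
  have idx: "2 * p * m = p * (2 * m)" "m * (2 * (2 * m) + 1) = p * m" by (simp_all add: p_eq_m)
  show ?thesis unfolding quarter_binomial_def idx using choose_multiples_rat_cong[of "2 * m" m] by simp
qed

text \<open>
  The index is \<open>m(4(m-b) + 1) = p(m-b) + b\<close>.
\<close>

lemma quarter_binomial_off_center:
  assumes b: "b \<in> {1..m}"
  shows "rat_cong p 2 (of_int (quarter_binomial (2 * (m - b))))
     (of_nat p * ((-1) ^ (b + 1) * of_nat ((2 * m) choose (m - b)) * ((of_nat m + of_nat b) / of_nat b)))"
proof -
  obtain d where d: "b = Suc d" using b by (cases b) auto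
  obtain k where k: "m = b + k" using b le_Suc_ex by auto
  have idx: "m * (2 * (2 * (m - b)) + 1) = p * (m - b) + Suc d"
    using k d by (simp add: p_eq_m algebra_simps)
  have "m - b < 2 * m" "Suc d < p" using b d m_pos p_eq_m by auto
  from choose_near_multiple[OF this]
  have "rat_cong p 2 (of_nat ((p * (2 * m)) choose (p * (m - b) + Suc d)))
     (of_nat p * ((-1) ^ d * (of_nat (2 * m) - of_nat (m - b)) * of_nat ((2 * m) choose (m - b))) * (1 / of_nat (Suc d)))" .
  moreover have "rat_of_nat (2 * m) - of_nat (m - b) = of_nat m + of_nat b"
    using b by (simp add: of_nat_diff)
  moreover have "(-1 :: rat) ^ d = (-1) ^ (b + 1)" by (simp add: d)
  moreover have "rat_of_int (quarter_binomial (2 * (m - b))) = of_nat ((p * (2 * m)) choose (p * (m - b) + Suc d))"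
    unfolding quarter_binomial_def idx by (simp add: mult_ac)
  ultimately show ?thesis unfolding d[symmetric] by (simp add: mult_ac)
qed

lemma quarter_binomial_symmetric:
  assumes b: "b \<in> {1..m}"
  shows "quarter_binomial (2 * (m + b)) = quarter_binomial (2 * (m - b))"
proof -
  obtain k where k: "m = b + k" using b le_Suc_ex by auto
  have "m * (2 * (2 * (m - b)) + 1) + m * (2 * (2 * (m + b)) + 1) = 2 * p * m"
    using k by (simp add: p_eq_m algebra_simps)
  hence "2 * p * m - m * (2 * (2 * (m + b)) + 1) = m * (2 * (2 * (m - b)) + 1)"
    "m * (2 * (2 * (m + b)) + 1) \<le> 2 * p * m" by linarith+
  thus ?thesis unfolding quarter_binomial_def
    using binomial_symmetric[of "m * (2 * (2 * (m + b)) + 1)" "2 * p * m"] by simp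
qed

lemma quarter_binomial_sum:
  "rat_cong p 2 (\<Sum>a\<le>2*m. of_int (quarter_binomial (2 * a)))
     (of_nat ((2 * m) choose m) * (1 + of_nat p * (1 + 2 * of_nat m * quarter_harm m)))"
proof -
  let ?C = "rat_of_nat ((2 * m) choose m)"
  let ?t = "\<lambda>b. (-1) ^ (b + 1) * rat_of_nat ((2 * m) choose (m - b)) * ((of_nat m + of_nat b) / of_nat b)"
  have "(\<Sum>a\<le>2*m. rat_of_int (quarter_binomial (2 * a)))
      = of_int (quarter_binomial (2 * m)) + (\<Sum>b\<in>{1..m}. 2 * of_int (quarter_binomial (2 * (m - b))))"
    unfolding sum_symmetric_about
  proof (intro arg_cong2[of _ _ _ _ "(+)"] sum.cong refl)
    fix b assume "b \<in> {1..m}"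
    from quarter_binomial_symmetric[OF this]
    show "rat_of_int (quarter_binomial (2 * (m - b))) + of_int (quarter_binomial (2 * (m + b)))
        = 2 * of_int (quarter_binomial (2 * (m - b)))" by simp
  qed
  also have "rat_cong p 2 \<dots> (?C + (\<Sum>b\<in>{1..m}. 2 * (of_nat p * ?t b)))"
    by (intro rat_cong_add quarter_binomial_center rat_cong_sum rat_cong_scale quarter_binomial_off_center) auto
  also have "(\<Sum>b\<in>{1..m}. 2 * (of_nat p * ?t b)) = 2 * (of_nat p * (\<Sum>b\<in>{1..m}. ?t b))"
    by (simp only: sum_distrib_left)
  also have "(\<Sum>b\<in>{1..m}. ?t b) = ?C * (1 / 2 + of_nat m * quarter_harm m)"
    by (rule alternating_central_sum[OF m_pos])
  also have "?C + 2 * (of_nat p * (?C * (1 / 2 + of_nat m * quarter_harm m)))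
      = ?C * (1 + of_nat p * (1 + 2 * of_nat m * quarter_harm m))"
    by (simp add: algebra_simps)
  finally show ?thesis .
qed

text \<open>
  With \<open>h = 1/(m+1) + \<dots> + 1/(2m)\<close>, the product \<open>(1-p)(1 + p(1 + 2mh))\<close> is \<open>1 + 2pmh\<close> to first order, and its
  square is \<open>1 + 4pmh \<equiv> 1 - ph\<close> because \<open>4m = p - 1\<close>.
\<close>

theorem sum_of_squares_common_residue:
  fixes x y :: int
  assumes "int p = x ^ 2 + y ^ 2" "odd x"
  shows "rat_cong p 2 (of_int (4 * x ^ 2 - 2 * int p)) (common_residue m)"
proof -
  define C where "C = rat_of_nat ((2 * m) choose m)"
  define h where "h = quarter_harm m"
  let ?P = "of_nat p :: rat"
  let ?y = "1 + 2 * of_nat m * h"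
  have h: "p_integral h" unfolding h_def by (rule p_integral_quarter_harm[OF n_eq])
  have y: "p_integral ?y" using h by (intro p_integral_add p_integral_mult) auto
  have mh: "p_integral (2 * of_nat m * h)" using h by (intro p_integral_mult) auto
  have C: "p_integral C" by (simp add: C_def)
  have "rat_cong p 2 (of_int (4 * x ^ 2 - 2 * int p)) (of_int ((int p - 1) ^ 2 * (\<Sum>a\<le>2*m. quarter_binomial (2 * a)) ^ 2))"
    using sum_of_squares_cong[OF assms] by (simp only: rat_cong_of_int_iff)
  also have "rat_of_int ((int p - 1) ^ 2 * (\<Sum>a\<le>2*m. quarter_binomial (2 * a)) ^ 2)
      = ((1 + ?P * (-1)) * (\<Sum>a\<le>2*m. of_int (quarter_binomial (2 * a)))) ^ 2"
    by (simp add: power_mult_distrib power2_commute[of "rat_of_nat p" 1])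
  also have "rat_cong p 2 \<dots> (((1 + ?P * (-1)) * (C * (1 + ?P * ?y))) ^ 2)"
    using quarter_binomial_sum unfolding C_def[symmetric] h_def[symmetric]
    by (intro rat_cong_power rat_cong_scale p_integral_mult p_integral_add p_integral_sum p_integral_uminus) auto
  also have "((1 + ?P * (-1)) * (C * (1 + ?P * ?y))) ^ 2 = (C * ((1 + ?P * (-1)) * (1 + ?P * ?y))) ^ 2"
    by (simp only: mult_ac)
  also have "rat_cong p 2 \<dots> ((C * (1 + ?P * (-1 + ?y))) ^ 2)"
    using C y h by (intro rat_cong_power rat_cong_scale one_plus_p_mult p_integral_mult p_integral_add p_integral_uminus) auto
  also have "(C * (1 + ?P * (-1 + ?y))) ^ 2 = C ^ 2 * ((1 + ?P * (2 * of_nat m * h)) * (1 + ?P * (2 * of_nat m * h)))"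
    by (simp add: power_mult_distrib power2_eq_square)
  also have "rat_cong p 2 \<dots> (C ^ 2 * (1 + ?P * (2 * of_nat m * h + 2 * of_nat m * h)))"
    using C mh by (intro rat_cong_scale one_plus_p_mult p_integral_power)
  also have "1 + ?P * (2 * of_nat m * h + 2 * of_nat m * h) = 1 - ?P * h + ?P ^ 2 * h"
    by (simp add: p_eq_m power2_eq_square algebra_simps)
  also have "rat_cong p 2 (C ^ 2 * (1 - ?P * h + ?P ^ 2 * h)) (C ^ 2 * (1 - ?P * h + 0))"
    using C h by (intro rat_cong_scale rat_cong_add rat_cong_refl rat_cong_0I p_integral_power)
  finally show ?thesis by (simp add: common_residue_def C_def h_def)
qed

end

section \<open>The alternating sums of Apery polynomials\<close>

theorem corollary1p1:
  fixes p :: nat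
  assumes "prime p" and "odd p"
  shows "rat_cong p 2 (\<Sum>k=0..p-1. (-1) ^ k * apery_poly k (-2))
                      (\<Sum>k=0..p-1. (-1) ^ k * apery_poly k (1/4))
    \<and> (\<forall>x y :: int. p mod 4 = 1 \<and> int p = x ^ 2 + y ^ 2 \<and> odd x \<longrightarrow>
         rat_cong p 2 (\<Sum>k=0..p-1. (-1) ^ k * apery_poly k (-2)) (of_int (4 * x ^ 2 - 2 * int p))
       \<and> rat_cong p 2 (\<Sum>k=0..p-1. (-1) ^ k * apery_poly k (1/4)) (of_int (4 * x ^ 2 - 2 * int p)))
    \<and> (p mod 4 = 3 \<longrightarrow>
         rat_cong p 2 (\<Sum>k=0..p-1. (-1) ^ k * apery_poly k (-2)) 0
       \<and> rat_cong p 2 (\<Sum>k=0..p-1. (-1) ^ k * apery_poly k (1/4)) 0)"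
proof -
  define n where "n = p div 2"
  interpret odd_prime_modulus p n
    by unfold_locales (use assms in \<open>auto simp: n_def\<close>)
  let ?A = "\<Sum>k=0..p-1. (-1) ^ k * apery_poly k (-2)"
  let ?B = "\<Sum>k=0..p-1. (-1) ^ k * apery_poly k (1/4)"
  have A: "rat_cong p 2 ?A (legendre_sum n 1 ^ 2)"
    by (rule alternating_apery_sum_cong) (auto intro: p_integral_uminus)
  have "p_integral (1 / (2 * 2))" by (intro p_integral_divide p_unit_mult p_unit_2 p_integral_numeral)
  hence B: "rat_cong p 2 ?B (legendre_sum n (-1/2) ^ 2)"
    by (intro alternating_apery_sum_cong) simp_all
  show ?thesis
  proof (cases "even n")
    case True
    then obtain m where m: "n = 2 * m" by (auto elim: evenE)
    interpret prime_1_mod_4 p n m by unfold_locales (fact m)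
    have A': "rat_cong p 2 ?A (common_residue m)" by (rule rat_cong_trans[OF A legendre_sum_1_common_residue[OF m]])
    have B': "rat_cong p 2 ?B (common_residue m)" by (rule rat_cong_trans[OF B legendre_sum_half_common_residue[OF m]])
    have "p mod 4 = 1" by (simp add: p_eq_m)
    moreover have "rat_cong p 2 ?A ?B" by (rule rat_cong_trans[OF A' rat_cong_sym[OF B']])
    moreover have "rat_cong p 2 ?A (of_int (4 * x ^ 2 - 2 * int p)) \<and> rat_cong p 2 ?B (of_int (4 * x ^ 2 - 2 * int p))"
      if "int p = x ^ 2 + y ^ 2" "odd x" for x y :: int
      using rat_cong_trans[OF A' rat_cong_sym[OF sum_of_squares_common_residue[OF that]]]
        rat_cong_trans[OF B' rat_cong_sym[OF sum_of_squares_common_residue[OF that]]] by blast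
    ultimately show ?thesis by auto
  next
    case False
    have "rat_cong p 2 (legendre_sum n 1 ^ 2) 0" using legendre_sum_1_square_cong False by simp
    hence A': "rat_cong p 2 ?A 0" by (rule rat_cong_trans[OF A])
    have "legendre_sum n (-1/2) = 0" unfolding legendre_sum_minus_half using False by simp
    hence B': "rat_cong p 2 ?B 0" using B by (simp only: power2_eq_square mult_zero_left)
    have "p mod 4 \<noteq> 1" using False p_eq by presburger
    thus ?thesis using A' B' rat_cong_trans[OF A' rat_cong_sym[OF B']] by auto
  qed
qed

end
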